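(* There exist trees whose disjoint convex obstacle number is at least $4$.
   Context: An obstacle representation of a graph $G$ consists of an injective placement of the vertices of $G$ as points in the plane together with a set of polygons (obstacles), such that the vertex points together with the polygon vertices are in general position (no three collinear), and two vertices $u,v$ are adjacent in $G$ if and only if the straight-line segment $\overline{uv}$ does not meet any obstacle. The disjoint convex obstacle number of $G$ is the smallest number of obstacles in an obstacle representation of $G$ in which all obstacles are convex polygons and are pairwise disjoint. *)

theory Defs
  imports
    "HOL-Analysis.Analysis"
    "HOL-Library.Extended_Nat"
    "Graph_Theory.Digraph_Component"
begin

text \<open>
  A finite simple graph is a symmetric loop-free finite digraph (\<^locale>\<open>pair_graph\<close>), each edge
  being represented by its two arcs. In such a digraph the walk u, v, u is already a \<open>cycle\<close> in the
  sense of \<open>Digraph_Component.forest\<close>, so that \<open>Digraph_Component.tree\<close> is not the undirected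
  notion. The cycles of the undirected graph are those of length at least 3.
\<close>

definition undirected_tree :: "'a pair_pre_digraph \<Rightarrow> bool" where
  "undirected_tree G \<longleftrightarrow>
     pair_graph G \<and>
     Digraph_Component.connected (with_proj G) \<and>
     \<not> (\<exists>p. pre_digraph.cycle (with_proj G) p \<and> 3 \<le> length p)"

text \<open>
  A convex polygon is a closed, nondegenerate region in the plane; its vertices are its extreme
  points.
\<close>

definition convex_polygon :: "(real^2) set \<Rightarrow> bool" where
  "convex_polygon P \<longleftrightarrow> polytope P \<and> aff_dim P = 2"

definition polygon_vertices :: "(real^2) set \<Rightarrow> (real^2) set" where
  "polygon_vertices P = {x. x extreme_point_of P}"

definition general_position :: "(real^2) set \<Rightarrow> bool" where
  "general_position S \<longleftrightarrow> (\<forall>T \<subseteq> S. card T = 3 \<longrightarrow> \<not> collinear T)"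

definition convex_obstacle_representation ::
    "'a pair_pre_digraph \<Rightarrow> ('a \<Rightarrow> real^2) \<Rightarrow> (real^2) set set \<Rightarrow> bool" where
  "convex_obstacle_representation G pos Obs \<longleftrightarrow>
     inj_on pos (pverts G) \<and>
     finite Obs \<and>
     (\<forall>P \<in> Obs. convex_polygon P) \<and>
     general_position (pos ` pverts G \<union> (\<Union>P \<in> Obs. polygon_vertices P)) \<and>
     (\<forall>u \<in> pverts G. \<forall>v \<in> pverts G. u \<noteq> v \<longrightarrow>
        ((u, v) \<in> parcs G \<longleftrightarrow> (\<forall>P \<in> Obs. closed_segment (pos u) (pos v) \<inter> P = {})))"

text \<open>
  The infimum is taken in \<^typ>\<open>enat\<close>: it is attained if there is a representation at all, and is
  \<open>\<infinity>\<close> otherwise.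
\<close>

definition disjoint_convex_obstacle_number :: "'a pair_pre_digraph \<Rightarrow> enat" where
  "disjoint_convex_obstacle_number G =
     Inf {enat (card Obs) | pos Obs. convex_obstacle_representation G pos Obs \<and> disjoint Obs}"

end

theory Submission
  imports Defs "HOL-Library.Ramsey"
begin

text \<open>
  The tree has a root \<open>v\<close> with many children \<open>a\<close>, each of which has many children \<open>b\<close>, each of
  which has one child \<open>c\<close>. Suppose that three disjoint convex obstacles suffice. If two edges cross,
  no obstacle meets two sides of the convex quadrilateral they span; hence two edges at distance at
  least 2 are disjoint, and if two crossing edges are joined by an edge, the three other sides
  of the quadrilateral are met by three different obstacles.

  Sort the children of a vertex by angle. By Ramsey's theorem one obstacle \<open>P\<close> blocks all pairs of
  them, and then \<open>P\<close> also lies behind each inner child. If the edges below the children did not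
  cross the edges above them, every grandchild would be hidden from the top by one of the other two
  obstacles; two of these obstacles can be taken equal and on the same side, which convexity forbids.
  So after another use of Ramsey's theorem every edge \<open>ab\<close> crosses all edges \<open>va'\<close> with \<open>a'\<close> before
  \<open>a\<close>. The quadrilaterals now fix the roles: \<open>P\<close> blocks \<open>aa'\<close>, a second obstacle \<open>Q\<close> blocks \<open>vb\<close>, the
  third obstacle \<open>R\<close> blocks \<open>a'b\<close>. Doing the same one level deeper leaves finitely many combinations
  of roles and orientations, and each is refuted by a path of segments that some convex obstacle can
  neither cross nor avoid.
\<close>

subsection \<open>Segments and convex sets\<close>

text \<open>One device carries the geometry, \<open>convex_set_wraps_around_end\<close>: a convex
  obstacle that misses both edges of a path \<open>v\<close>, \<open>a\<close>, \<open>b\<close>,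
  meets the segment \<open>vb\<close> and reaches the far side of the line \<open>ab\<close> must
  pass behind \<open>b\<close>. Two disjoint obstacles forced into such detours end up with crossing
  chords, by \<open>pasch\<close>. The bound three enters through crossings only. A crossing with
  four blocked sides needs four obstacles. A crossing with three blocked sides uses up all three, so
  naming two of them names the third. Constants: the outer fan keeps 4 children. The first is
  \<open>a1\<close>; each of the other three has an obstacle other than \<open>P\<close> that hides
  several of its feet, so two of them share it; these are \<open>a2\<close> and \<open>a3\<close>,
  and the shared obstacle is \<open>Q\<close>. Each child carries 9 feet because the Ramsey step
  keeps at least half of the feet, hence 5, and among 5 feet hidden by two obstacles 3 are hidden by
  the same one; these are \<open>b1\<close>, \<open>b2\<close>, \<open>b3\<close>.\<close>

lemma pasch:
  fixes a :: "'a::real_vector"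
  assumes "p \<in> closed_segment a b" "q \<in> closed_segment a c"
  shows "closed_segment p c \<inter> closed_segment q b \<noteq> {}"
proof -
  obtain s where s: "0 \<le> s" "s \<le> 1" "p = (1 - s) *\<^sub>R a + s *\<^sub>R b"
    using assms(1) by (auto simp: in_segment)
  obtain t where t: "0 \<le> t" "t \<le> 1" "q = (1 - t) *\<^sub>R a + t *\<^sub>R c"
    using assms(2) by (auto simp: in_segment)
  have "s * t \<le> 1"
    using s t by (simp add: mult_le_one)
  then consider "s * t = 1" | "s * t < 1" by linarith
  then show ?thesis
  proof cases
    \<comment> \<open>Here \<open>p\<close> and \<open>q\<close> are the far endpoints and both
      segments are \<open>bc\<close>; the denominators of the other case vanish.\<close>
    case 1
    moreover have "s * t \<le> s" "s * t \<le> t"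
      using s t by (simp_all add: mult_left_le mult_left_le_one_le)
    ultimately have "p = b" "q = c" using s t by auto
    then show ?thesis by (metis Int_iff closed_segment_commute emptyE ends_in_segment(1))
  next
    case 2
    \<comment> \<open>Comparing coefficients over \<open>a\<close>, \<open>b\<close>,
      \<open>c\<close> at the meeting point gives \<open>(1 - l) * s = m\<close> and
      \<open>(1 - m) * t = l\<close>; this is the solution.\<close>
    define l where "l = t * (1 - s) / (1 - s * t)"
    define m where "m = s * (1 - t) / (1 - s * t)"
    have ne: "1 - s * t \<noteq> 0" using 2 by simp
    have l1: "1 - l = (1 - t) / (1 - s * t)" using ne by (simp add: l_def divide_simps) (simp add: algebra_simps)
    have m1: "1 - m = (1 - s) / (1 - s * t)" using ne by (simp add: m_def divide_simps) (simp add: algebra_simps)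
    have "0 \<le> 1 - l" "0 \<le> 1 - m" unfolding l1 m1 using s(1,2) t(1,2) 2 by simp_all
    moreover have "0 \<le> l" "0 \<le> m" unfolding l_def m_def using s(1,2) t(1,2) 2 by simp_all
    moreover have "(1 - l) *\<^sub>R p + l *\<^sub>R c = (1 - m) *\<^sub>R q + m *\<^sub>R b"
    proof -
      have e1: "(1 - l) * s = m" "(1 - m) * t = l"
        unfolding l1 m1 by (simp_all add: l_def m_def mult.commute)
      have "(1 - l) * (1 - s) = (1 - m) * (1 - t)" by (simp add: l1 m1)
      then have "(1 - l) *\<^sub>R p + l *\<^sub>R c
          = ((1 - m) * (1 - t)) *\<^sub>R a + m *\<^sub>R b + ((1 - m) * t) *\<^sub>R c"
        unfolding s(3) using e1 by (simp add: scaleR_add_right)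
      also have "\<dots> = (1 - m) *\<^sub>R q + m *\<^sub>R b"
        unfolding t(3) by (simp add: scaleR_add_right)
      finally show ?thesis .
    qed
    ultimately have "(1 - l) *\<^sub>R p + l *\<^sub>R c \<in> closed_segment p c \<inter> closed_segment q b"
      unfolding Int_iff in_segment by (metis diff_ge_0_iff_ge)
    then show ?thesis by blast
  qed
qed

lemma hull3_cevian:
  fixes a :: "'a::real_vector"
  assumes "t \<in> convex hull {a, b, c}"
  obtains w where "w \<in> closed_segment b c" "t \<in> closed_segment a w"
proof -
  have "t \<in> convex hull (insert a {b, c})" using assms by simp
  then obtain u v w where *: "u \<ge> 0" "v \<ge> 0" "u + v = 1" "w \<in> convex hull {b, c}"
      "t = u *\<^sub>R a + v *\<^sub>R w"
    by (subst (asm) convex_hull_insert) auto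
  have "t \<in> closed_segment a w"
    using * by (auto simp: in_segment intro!: exI[of _ v])
  with * that show thesis by (simp add: segment_convex_hull)
qed

lemma in_hull3:
  "a \<in> convex hull {a, b, c}" "b \<in> convex hull {a, b, c}" "c \<in> convex hull {a, b, c}"
  by (auto intro: hull_inc)

lemma segment_subset_hull3:
  fixes a :: "'a::real_vector"
  shows "p \<in> convex hull {a, b, c} \<Longrightarrow> q \<in> convex hull {a, b, c} \<Longrightarrow>
    closed_segment p q \<subseteq> convex hull {a, b, c}"
  by (simp add: closed_segment_subset)

lemma segment_through:
  fixes a :: "'a::real_vector"
  assumes "b1 \<in> closed_segment a z1" "b2 \<in> closed_segment a z2" "s \<in> closed_segment b1 b2"
  obtains z where "z \<in> closed_segment z1 z2" "s \<in> closed_segment a z"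
proof -
  have "b1 \<in> convex hull {a, z1, z2}" "b2 \<in> convex hull {a, z1, z2}"
    using assms segment_subset_hull3[OF in_hull3(1) in_hull3(2)]
      segment_subset_hull3[OF in_hull3(1) in_hull3(3)] by blast+
  then have "s \<in> convex hull {a, z1, z2}"
    using assms(3) segment_subset_hull3 by blast
  then show thesis using hull3_cevian that by metis
qed

text \<open>Two uses of \<open>pasch\<close>: \<open>cx\<close> meets \<open>pb\<close> in a point
  \<open>y\<close>, and then, in the triangle \<open>b\<close>, \<open>c\<close>, \<open>p\<close>,
  the part \<open>yc\<close> of the cevian meets \<open>pq\<close>.\<close>

lemma cevian:
  fixes a :: "'a::real_vector"
  assumes "x \<in> closed_segment a b" "p \<in> closed_segment c a" "q \<in> closed_segment c b"
  shows "closed_segment p q \<inter> closed_segment c x \<noteq> {}"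
proof -
  obtain y where y: "y \<in> closed_segment p b" "y \<in> closed_segment c x"
  proof -
    have "closed_segment x c \<inter> closed_segment p b \<noteq> {}"
      using pasch[of x a b p c] assms by (simp add: closed_segment_commute)
    then show thesis using that by (auto simp: closed_segment_commute)
  qed
  have "closed_segment q p \<inter> closed_segment y c \<noteq> {}"
    using pasch[of q b c y p] assms y by (simp add: closed_segment_commute)
  moreover have "closed_segment y c \<subseteq> closed_segment c x"
    using y by (simp add: subset_closed_segment)
  ultimately show ?thesis by (auto simp: closed_segment_commute)
qed

text \<open>The cevian from \<open>z\<close> through \<open>t\<close> ends in a point
  \<open>m\<close> of \<open>bc\<close>, and \<open>pasch\<close> at the corner \<open>z\<close>
  makes \<open>xt\<close> cut \<open>bm\<close>. A line of sight from behind \<open>b\<close> enters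
  the triangle through \<open>bc\<close>.\<close>

lemma hull3_exit:
  fixes a :: "'a::real_vector"
  assumes "b \<in> closed_segment x z" "t \<in> convex hull {z, b, c}"
  shows "closed_segment x t \<inter> closed_segment b c \<noteq> {}"
proof -
  obtain m where m: "m \<in> closed_segment b c" "t \<in> closed_segment z m"
    using hull3_cevian assms(2) by metis
  have "closed_segment t x \<inter> closed_segment b m \<noteq> {}"
    using pasch[of t z m b x] m assms(1) by (simp add: closed_segment_commute)
  moreover have "closed_segment b m \<subseteq> closed_segment b c"
    using m by (simp add: subset_closed_segment)
  ultimately show ?thesis by (auto simp: closed_segment_commute)
qed

definition misses :: "'a::real_vector set \<Rightarrow> 'a \<Rightarrow> 'a \<Rightarrow> bool" where
  "misses K a b \<longleftrightarrow> K \<inter> closed_segment a b = {}"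

lemma misses_sym: "misses K a b \<Longrightarrow> misses K b a"
  by (simp add: misses_def closed_segment_commute)

lemma missesD: "misses K a b \<Longrightarrow> z \<in> K \<Longrightarrow> z \<notin> closed_segment a b"
  by (auto simp: misses_def)

lemma misses_ends: "misses K a b \<Longrightarrow> a \<notin> K" "misses K a b \<Longrightarrow> b \<notin> K"
  by (auto simp: misses_def)

lemma misses_part: "misses K a b \<Longrightarrow> x \<in> closed_segment a b \<Longrightarrow> y \<in> closed_segment a b \<Longrightarrow> misses K x y"
  unfolding misses_def using closed_segment_subset[of x "closed_segment a b" y] by auto

lemma misses_segment:
  assumes "misses K a b" "convex K" "p \<in> K" "q \<in> K"
    and "x \<in> closed_segment a b" "y \<in> closed_segment a b"
  shows "closed_segment p q \<inter> closed_segment x y = {}"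
  using assms closed_segment_subset[of p K q] misses_part[of K a b x y] by (auto simp: misses_def)

text \<open>A convex set is connected and the frontier of the triangle consists of its sides, so a
  set that is inside somewhere and touches no side is trapped.\<close>

lemma convex_meets_side:
  fixes K :: "(real^2) set"
  assumes "convex K" "K \<inter> convex hull {a, b, c} \<noteq> {}"
    and "misses K a b" "misses K b c" "misses K c a"
  shows "K \<subseteq> convex hull {a, b, c}"
proof (rule ccontr)
  assume "\<not> ?thesis"
  then have "K \<inter> frontier (convex hull {a, b, c}) \<noteq> {}"
    using assms by (intro connected_Int_frontier convex_connected) auto
  then show False using assms by (auto simp: frontier_of_triangle misses_def)
qed

subsection \<open>Orientation of triples\<close>

text \<open>Twice the signed area of the triangle, positive for counterclockwise order.\<close>

definition det3 :: "real^2 \<Rightarrow> real^2 \<Rightarrow> real^2 \<Rightarrow> real" where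
  "det3 a b c = (b$1 - a$1) * (c$2 - a$2) - (b$2 - a$2) * (c$1 - a$1)"

lemma det3_cyc: "det3 b c a = det3 a b c" "det3 c a b = det3 a b c"
  by (simp_all add: det3_def algebra_simps)

lemma det3_swap: "det3 a c b = - det3 a b c" "det3 b a c = - det3 a b c"
  by (simp_all add: det3_def algebra_simps)

lemma det3_same[simp]: "det3 a a b = 0" "det3 a b a = 0" "det3 b a a = 0"
  by (simp_all add: det3_def algebra_simps)

lemma det3_affine: "det3 a b ((1 - t) *\<^sub>R p + t *\<^sub>R q) = (1 - t) * det3 a b p + t * det3 a b q"
  by (simp add: det3_def algebra_simps)

text \<open>The three-term Grassmann-Pluecker relation; it restricts the possible angular orders of
  four points around \<open>a\<close>.\<close>

lemma det3_pluecker: "det3 a b c * det3 a d e - det3 a b d * det3 a c e + det3 a b e * det3 a c d = 0"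
  by (simp add: det3_def algebra_simps)

lemma det3_eq_0_obtain:
  assumes "det3 a b c = 0" "a \<noteq> b"
  obtains t where "c = (1 - t) *\<^sub>R a + t *\<^sub>R b"
proof -
  have ne: "b$1 - a$1 \<noteq> 0 \<or> b$2 - a$2 \<noteq> 0"
    using assms(2) by (auto simp: vec_eq_iff forall_2)
  have eq: "(b$1 - a$1) * (c$2 - a$2) = (b$2 - a$2) * (c$1 - a$1)"
    using assms(1) by (simp add: det3_def)
  obtain s where s: "s * (b$1 - a$1) = c$1 - a$1" "s * (b$2 - a$2) = c$2 - a$2"
  proof (cases "b$1 - a$1 = 0")
    case True
    with ne have "b$2 - a$2 \<noteq> 0" by simp
    moreover from this True eq have "c$1 - a$1 = 0" by (metis mult_eq_0_iff)
    ultimately show thesis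
      using True by (intro that[of "(c$2 - a$2) / (b$2 - a$2)"]) simp_all
  next
    case False
    then show thesis
      using eq by (intro that[of "(c$1 - a$1) / (b$1 - a$1)"]) (simp_all add: divide_simps mult.commute)
  qed
  have "c = (1 - s) *\<^sub>R a + s *\<^sub>R b"
    using s by (simp add: vec_eq_iff forall_2 algebra_simps)
  then show thesis by (rule that)
qed

lemma det3_eq_0_imp_collinear:
  assumes "det3 a b c = 0"
  shows "collinear {a, b, c}"
proof (cases "a = b")
  case False
  then obtain t where "c = (1 - t) *\<^sub>R a + t *\<^sub>R b"
    using det3_eq_0_obtain assms by metis
  then have "c \<in> affine hull {a, b}"
    unfolding affine_hull_2 by (intro CollectI exI[of _ "1 - t"] exI[of _ t]) simp
  then have "{a, b, c} \<subseteq> affine hull {a, b}"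
    by (simp add: hull_inc)
  then show ?thesis
    by (auto simp: collinear_affine_hull)
qed simp

lemma on_line_cases:
  assumes "det3 a b z = 0" "a \<noteq> b"
  shows "z \<in> closed_segment a b \<or> a \<in> closed_segment z b \<or> b \<in> closed_segment a z"
proof -
  obtain t where t: "z = (1 - t) *\<^sub>R a + t *\<^sub>R b"
    using det3_eq_0_obtain assms by metis
  consider "0 \<le> t \<and> t \<le> 1" | "t < 0" | "1 < t" by linarith
  then show ?thesis
  proof cases
    case 1
    with t show ?thesis by (auto simp: in_segment)
  next
    case 2
    \<comment> \<open>The solution of
      \<open>a = (1 - u) *\<^sub>R z + u *\<^sub>R b\<close>.\<close>
    define u where "u = - t / (1 - t)"
    have "(1 - u) * (1 - t) = 1" "(1 - u) * t + u = 0"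
      using 2 by (simp_all add: u_def field_simps)
    moreover have "(1 - u) *\<^sub>R z + u *\<^sub>R b = ((1 - u) * (1 - t)) *\<^sub>R a + ((1 - u) * t + u) *\<^sub>R b"
      by (simp add: t scaleR_add_right scaleR_add_left)
    ultimately have "a = (1 - u) *\<^sub>R z + u *\<^sub>R b" by simp
    moreover have "0 \<le> u" "u \<le> 1"
      using 2 by (auto simp: u_def field_simps)
    ultimately show ?thesis by (auto simp: in_segment)
  next
    case 3
    define u where "u = 1 / t"
    have "1 - u + u * (1 - t) = 0" "u * t = 1"
      using 3 by (simp_all add: u_def field_simps)
    moreover have "(1 - u) *\<^sub>R a + u *\<^sub>R z = (1 - u + u * (1 - t)) *\<^sub>R a + (u * t) *\<^sub>R b"
      by (simp add: t scaleR_add_right scaleR_add_left)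
    ultimately have "b = (1 - u) *\<^sub>R a + u *\<^sub>R z" by simp
    moreover have "0 \<le> u" "u \<le> 1"
      using 3 by (auto simp: u_def)
    ultimately show ?thesis by (auto simp: in_segment)
  qed
qed

text \<open>A product of orientations ignores the direction of the line and survives reflection, so
  mirror images need no separate treatment. Being strict, \<open>opp_side\<close> and
  \<open>same_side\<close> both certify that neither point lies on the line.\<close>

definition opp_side :: "real^2 \<Rightarrow> real^2 \<Rightarrow> real^2 \<Rightarrow> real^2 \<Rightarrow> bool" where
  "opp_side a b p q \<longleftrightarrow> det3 a b p * det3 a b q < 0"

definition same_side :: "real^2 \<Rightarrow> real^2 \<Rightarrow> real^2 \<Rightarrow> real^2 \<Rightarrow> bool" where
  "same_side a b p q \<longleftrightarrow> 0 < det3 a b p * det3 a b q"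

lemma opp_sym: "opp_side a b p q \<Longrightarrow> opp_side a b q p"
  by (simp add: opp_side_def mult.commute)

lemma opp_line_sym: "opp_side a b p q \<Longrightarrow> opp_side b a p q"
  by (simp add: opp_side_def det3_swap(2)[of a b])

lemma same_sym: "same_side a b p q \<Longrightarrow> same_side a b q p"
  by (simp add: same_side_def mult.commute)

lemma same_line_sym: "same_side a b p q \<Longrightarrow> same_side b a p q"
  by (simp add: same_side_def det3_swap(2)[of a b])

lemma same_opp_trans: "same_side a b p q \<Longrightarrow> opp_side a b q r \<Longrightarrow> opp_side a b p r"
  by (auto simp: same_side_def opp_side_def zero_less_mult_iff mult_less_0_iff)

lemma opp_same_trans: "opp_side a b p q \<Longrightarrow> same_side a b q r \<Longrightarrow> opp_side a b p r"
  by (auto simp: same_side_def opp_side_def zero_less_mult_iff mult_less_0_iff)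

lemma opp_opp_trans: "opp_side a b p q \<Longrightarrow> opp_side a b q r \<Longrightarrow> same_side a b p r"
  by (auto simp: same_side_def opp_side_def zero_less_mult_iff mult_less_0_iff)

lemma same_trans: "same_side a b p q \<Longrightarrow> same_side a b q r \<Longrightarrow> same_side a b p r"
  by (auto simp: same_side_def zero_less_mult_iff)

lemma opp_nz: assumes "opp_side a b p q" shows "det3 a b p \<noteq> 0" "det3 a b q \<noteq> 0"
  using assms by (auto simp: opp_side_def)

lemma same_nz: assumes "same_side a b p q" shows "det3 a b p \<noteq> 0" "det3 a b q \<noteq> 0"
  using assms by (auto simp: same_side_def)

lemma not_same_opp: "same_side a b p q \<Longrightarrow> \<not> opp_side a b p q"
  by (auto simp: same_side_def opp_side_def)

lemma square_pos: "x \<noteq> 0 \<Longrightarrow> 0 < x * (x::real)"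
  by (metis mult_neg_neg mult_pos_pos neqE)

lemma same_towards:
  assumes "q \<in> closed_segment p x" "q \<noteq> x" "det3 a b x = 0" "det3 a b p \<noteq> 0"
  shows "same_side a b p q"
proof -
  obtain t where t: "0 \<le> t" "t \<le> 1" "q = (1 - t) *\<^sub>R p + t *\<^sub>R x"
    using assms(1) by (auto simp: in_segment)
  then have "t < 1" using assms(2) by (cases "t = 1") auto
  moreover have "det3 a b q = (1 - t) * det3 a b p" using assms(3) t by (simp add: det3_affine)
  moreover have "0 < det3 a b p * det3 a b p" using assms(4) by (rule square_pos)
  ultimately show ?thesis by (simp add: same_side_def mult.left_commute)
qed

lemma same_segment:
  assumes "z \<in> closed_segment p q" "same_side a b p q"
  shows "same_side a b p z"
proof -
  obtain t where t: "0 \<le> t" "t \<le> 1" "z = (1 - t) *\<^sub>R p + t *\<^sub>R q"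
    using assms(1) by (auto simp: in_segment)
  have "det3 a b p * det3 a b z = (1 - t) * (det3 a b p * det3 a b p) + t * (det3 a b p * det3 a b q)"
    unfolding t(3) det3_affine by (simp only: algebra_simps)
  moreover have "0 < det3 a b p * det3 a b p" "0 < det3 a b p * det3 a b q"
    using assms(2) by (auto simp: same_side_def zero_less_mult_iff)
  ultimately show ?thesis
    using t(1,2) unfolding same_side_def
    by (smt (verit, best) mult_nonneg_nonneg mult_pos_pos)
qed

lemma opp_through:
  assumes "x \<in> closed_segment p q" "det3 a b x = 0" "x \<noteq> q" "det3 a b p \<noteq> 0"
  shows "opp_side a b p q"
proof -
  obtain t where t: "0 \<le> t" "t \<le> 1" "x = (1 - t) *\<^sub>R p + t *\<^sub>R q"
    using assms(1) by (auto simp: in_segment)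
  have t1: "t < 1" using assms(3) t by (cases "t = 1") auto
  have e: "(1 - t) * det3 a b p + t * det3 a b q = 0"
    using assms(2) unfolding t(3) det3_affine .
  then have "t \<noteq> 0" using assms(4) by auto
  then have "0 < t" using t by simp
  have "t * (det3 a b p * det3 a b q) = - (1 - t) * (det3 a b p * det3 a b p)"
    using arg_cong[OF e, of "\<lambda>x. det3 a b p * x"] by (simp add: algebra_simps)
  moreover have "0 < (1 - t) * (det3 a b p * det3 a b p)"
    using t1 square_pos[OF assms(4)] by simp
  ultimately have "t * (det3 a b p * det3 a b q) < 0" by (simp only: mult_minus_left)
  with \<open>0 < t\<close> show ?thesis by (auto simp: opp_side_def mult_less_0_iff)
qed

lemma cross_line:
  assumes "opp_side a b p q"
  obtains z where "z \<in> closed_segment p q" "det3 a b z = 0"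
    "z \<in> closed_segment a b \<or> a \<in> closed_segment z b \<or> b \<in> closed_segment a z"
proof -
  have ne: "a \<noteq> b" using assms by (auto simp: opp_side_def)
  define f where "f = det3 a b p"
  define g where "g = det3 a b q"
  have fg: "f < 0 \<and> 0 < g \<or> 0 < f \<and> g < 0"
    using assms by (auto simp: opp_side_def f_def g_def mult_less_0_iff)
  \<comment> \<open>The zero of the affine function \<open>det3 a b\<close> along
    \<open>pq\<close>.\<close>
  define t where "t = f / (f - g)"
  have t: "0 \<le> t" "t \<le> 1" "(1 - t) * f + t * g = 0"
    using fg by (auto simp: t_def field_simps)
  define z where "z = (1 - t) *\<^sub>R p + t *\<^sub>R q"
  have "det3 a b z = 0" using t(3) by (simp add: z_def det3_affine f_def g_def)
  moreover have "z \<in> closed_segment p q" using t by (auto simp: in_segment z_def)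
  ultimately show thesis using on_line_cases[OF _ ne] that by blast
qed

text \<open>The chord from \<open>q\<close> to \<open>th\<close> crosses the line \<open>ab\<close>
  inside \<open>K\<close>. It cannot cross the edge \<open>ab\<close>, and if it crossed behind
  \<open>a\<close>, then \<open>pasch\<close> would make it cut \<open>va\<close>. Only the part
  behind \<open>b\<close> remains.\<close>

lemma convex_set_wraps_around_end:
  assumes K: "convex K" "misses K v a" "misses K a b"
    and q: "q \<in> K" "q \<in> closed_segment v b" and th: "th \<in> K" and o: "opp_side a b v th"
  obtains z where "z \<in> K" "z \<in> closed_segment q th" "b \<in> closed_segment a z"
proof -
  have "q \<noteq> b" using misses_ends[OF K(3)] q(1) by auto
  then have "same_side a b v q"
    using same_towards[OF q(2), of a b] o by (force simp: opp_side_def)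
  then have "opp_side a b q th" using o same_sym same_opp_trans by blast
  then obtain z where z: "z \<in> closed_segment q th"
    "z \<in> closed_segment a b \<or> a \<in> closed_segment z b \<or> b \<in> closed_segment a z"
    using cross_line by metis
  have zK: "z \<in> K" using z(1) q(1) th K(1) closed_segment_subset by blast
  have "a \<notin> closed_segment z b"
  proof
    assume "a \<in> closed_segment z b"
    then have "closed_segment q z \<inter> closed_segment a v \<noteq> {}"
      using pasch[of q b v a z] q(2) by (simp add: closed_segment_commute)
    moreover have "closed_segment q z \<subseteq> K" using zK q(1) K(1) closed_segment_subset by blast
    ultimately show False using misses_sym[OF K(2)] by (auto simp: misses_def)
  qed
  with z(2) zK missesD[OF K(3)] have "b \<in> closed_segment a z" by blast
  with zK z(1) that show thesis by blast
qed

lemma det3_on_segment: "z \<in> closed_segment a b \<Longrightarrow> det3 a b z = 0"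
  by (auto simp: in_segment det3_affine)

text \<open>The degenerate case of \<open>pasch\<close> in which one of the two segments shrinks to
  the point \<open>b\<close>.\<close>

lemma segment_tail:
  fixes a :: "'a::real_vector"
  assumes "p \<in> closed_segment a b" "b \<in> closed_segment a c"
  shows "b \<in> closed_segment p c"
  using pasch[OF assms] by auto

lemma segment_mono:
  fixes a :: "'a::real_vector"
  assumes "p \<in> closed_segment a b" "b \<in> closed_segment a c"
  shows "p \<in> closed_segment a c"
  using assms closed_segment_subset[of a "closed_segment a c" b] by auto

text \<open>The points lie in the order \<open>b\<close>, \<open>x\<close>, \<open>a\<close>,
  \<open>z\<close>; for \<open>x = a\<close> the second hypothesis would say nothing about the
  direction of \<open>z\<close>.\<close>

lemma segment_overlap:
  fixes a :: "'a::real_vector"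
  assumes "x \<in> closed_segment b a" "a \<in> closed_segment x z" "x \<noteq> a"
  shows "x \<in> closed_segment b z"
proof -
  obtain t where t: "0 \<le> t" "t \<le> 1" "x = (1 - t) *\<^sub>R b + t *\<^sub>R a"
    using assms(1) by (auto simp: in_segment)
  obtain s where s: "0 \<le> s" "s \<le> 1" "a = (1 - s) *\<^sub>R x + s *\<^sub>R z"
    using assms(2) by (auto simp: in_segment)
  have "t < 1" using t assms(3) by (cases "t = 1") auto
  define u where "u = t * s / (1 - t + t * s)"
  have pos: "0 < 1 - t + t * s" using t s \<open>t < 1\<close> by (simp add: add_pos_nonneg)
  have "1 - u = (1 - t) / (1 - t + t * s)"
    using pos by (simp add: u_def divide_simps)
  have "x = (1 - t) *\<^sub>R b + t *\<^sub>R ((1 - s) *\<^sub>R x + s *\<^sub>R z)"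
    using t(3) s(3) by simp
  then have "(1 - t + t * s) *\<^sub>R x = (1 - t) *\<^sub>R b + (t * s) *\<^sub>R z"
    by (simp add: algebra_simps)
  then have "(1 / (1 - t + t * s)) *\<^sub>R ((1 - t + t * s) *\<^sub>R x) = (1 - u) *\<^sub>R b + u *\<^sub>R z"
    unfolding \<open>1 - u = _\<close> by (simp add: scaleR_add_right u_def)
  then have "x = (1 - u) *\<^sub>R b + u *\<^sub>R z" using pos by simp
  moreover have "0 \<le> u" "0 \<le> 1 - u"
    unfolding \<open>1 - u = _\<close> using pos t s by (simp_all add: u_def)
  ultimately show ?thesis unfolding in_segment by (intro exI[of _ u]) simp
qed

lemma opp_on_line:
  assumes "opp_side a b p q" "x \<in> closed_segment a b" "x \<noteq> a"
  shows "opp_side x a p q"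
proof -
  obtain t where t: "0 \<le> t" "x = (1 - t) *\<^sub>R a + t *\<^sub>R b"
    using assms(2) by (auto simp: in_segment)
  then have "0 < t" using assms(3) by (cases "t = 0") auto
  have e: "det3 x a z = - t * det3 a b z" for z
    unfolding t(2) by (simp add: det3_def algebra_simps)
  have "det3 x a p * det3 x a q = (t * t) * (det3 a b p * det3 a b q)"
    by (simp add: e)
  then show ?thesis
    using assms(1) \<open>0 < t\<close> by (simp add: opp_side_def mult_pos_neg)
qed

lemma outside_hull3:
  assumes "opp_side a b p q"
  shows "q \<notin> convex hull {p, a, b}"
proof
  assume "q \<in> convex hull {p, a, b}"
  then obtain w where w: "w \<in> closed_segment a b" "q \<in> closed_segment p w"
    by (rule hull3_cevian)
  have "det3 a b w = 0" using w(1) by (rule det3_on_segment)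
  moreover from this have "q \<noteq> w" using assms by (auto simp: opp_side_def)
  ultimately have "same_side a b p q"
    using same_towards[OF w(2)] assms by (force simp: opp_side_def)
  with assms not_same_opp show False by blast
qed

lemma hull3_from_sides:
  assumes "same_side a b c p" "same_side b c a p" "same_side c a b p"
  shows "p \<in> convex hull {a, b, c}"
proof -
  define D where "D = det3 a b c"
  \<comment> \<open>Barycentric coordinates as ratios of signed areas; the three hypotheses are
    their positivity.\<close>
  define u where "u = det3 b c p / D"
  define v where "v = det3 c a p / D"
  define w where "w = det3 a b p / D"
  have D: "D \<noteq> 0" using assms(1) by (auto simp: same_side_def D_def)
  have "det3 b c a = D" "det3 c a b = D" by (simp_all add: D_def det3_cyc)
  then have "0 < D * det3 b c p" "0 < D * det3 c a p" "0 < D * det3 a b p"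
    using assms unfolding same_side_def by (simp_all add: D_def[symmetric])
  moreover have "0 \<le> x / D" if "0 < D * x" for x
    using that by (auto simp: zero_less_mult_iff zero_le_divide_iff)
  ultimately have "0 \<le> u" "0 \<le> v" "0 \<le> w"
    unfolding u_def v_def w_def by blast+
  moreover have "det3 b c p + det3 c a p + det3 a b p = D"
    by (simp add: D_def det3_def algebra_simps)
  then have "u + v + w = 1"
    using D by (simp add: u_def v_def w_def flip: add_divide_distrib)
  moreover have "p = u *\<^sub>R a + v *\<^sub>R b + w *\<^sub>R c"
  proof -
    have "D *\<^sub>R p = det3 b c p *\<^sub>R a + det3 c a p *\<^sub>R b + det3 a b p *\<^sub>R c"
      by (simp add: D_def det3_def vec_eq_iff forall_2 algebra_simps)
    then have "(1 / D) *\<^sub>R (D *\<^sub>R p) = u *\<^sub>R a + v *\<^sub>R b + w *\<^sub>R c"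
      by (simp add: u_def v_def w_def scaleR_add_right)
    then show ?thesis using D by simp
  qed
  ultimately show ?thesis unfolding convex_hull_3 by blast
qed

text \<open>The hypotheses put \<open>d\<close> inside the angle at \<open>a\<close> between the
  rays to \<open>v\<close> and \<open>b\<close>.\<close>

lemma between_rays:
  assumes "same_side v a b d" "same_side a b v d"
  shows "opp_side a d v b"
proof -
  have "det3 v a b = det3 a b v" "det3 v a d = det3 a d v" "det3 a d b = - det3 a b d"
    by (simp_all add: det3_def algebra_simps)
  with assms show ?thesis
    by (auto simp: same_side_def opp_side_def zero_less_mult_iff mult_less_0_iff)
qed

lemma ray_linear_aux:
  fixes a :: "'a::real_vector"
  assumes "0 < t" "t \<le> u" "(1 - t) *\<^sub>R a + t *\<^sub>R y = (1 - u) *\<^sub>R a + u *\<^sub>R z"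
  shows "z \<in> closed_segment a y"
proof -
  have "u *\<^sub>R z = (u - t) *\<^sub>R a + t *\<^sub>R y"
    using assms(3) by (simp add: algebra_simps)
  then have "(1 / u) *\<^sub>R (u *\<^sub>R z) = ((u - t) / u) *\<^sub>R a + (t / u) *\<^sub>R y"
    by (simp add: scaleR_add_right)
  moreover have "(u - t) / u = 1 - t / u" using assms by (simp add: diff_divide_distrib)
  ultimately have "z = (1 - t / u) *\<^sub>R a + (t / u) *\<^sub>R y" using assms by simp
  moreover have "0 \<le> t / u" "t / u \<le> 1" using assms by auto
  ultimately show ?thesis unfolding in_segment by blast
qed

lemma ray_linear:
  fixes a :: "'a::real_vector"
  assumes "b \<in> closed_segment a y" "b \<in> closed_segment a z" "a \<noteq> b"
  shows "y \<in> closed_segment a z \<or> z \<in> closed_segment a y"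
proof -
  obtain t where t: "0 \<le> t" "b = (1 - t) *\<^sub>R a + t *\<^sub>R y"
    using assms(1) by (auto simp: in_segment)
  obtain u where u: "0 \<le> u" "b = (1 - u) *\<^sub>R a + u *\<^sub>R z"
    using assms(2) by (auto simp: in_segment)
  have "t \<noteq> 0" "u \<noteq> 0" using t u assms(3) by auto
  then have "0 < t" "0 < u" using t(1) u(1) by simp_all
  then show ?thesis
    using ray_linear_aux[of t u a y z] ray_linear_aux[of u t a z y] t(2) u(2) by fastforce
qed

subsection \<open>Convex obstacles, crossings and stars\<close>

text \<open>The chord \<open>pq\<close> of \<open>K\<close> cuts off the corner \<open>c\<close>,
  hence it cuts the cevian \<open>cx\<close>, which is part of the missed edge
  \<open>cd\<close>.\<close>

lemma crossing_adjacent_sides: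
  assumes "convex K" "misses K c d"
    and "x \<in> closed_segment a b" "x \<in> closed_segment c d"
    and "p \<in> K" "p \<in> closed_segment a c" "q \<in> K" "q \<in> closed_segment c b"
  shows False
proof -
  have "closed_segment p q \<inter> closed_segment c x \<noteq> {}"
    using cevian[of x a b p c q] assms by (simp add: closed_segment_commute)
  then show False using misses_segment[of K c d p q c x] assms by auto
qed

text \<open>Applied to the path \<open>c\<close>, \<open>x\<close>, \<open>a\<close>, the wrapping
  lemma leads \<open>K\<close> to a point \<open>z\<close> behind \<open>a\<close>. From there the
  chord to \<open>q\<close> must cut the half \<open>xd\<close> of the other edge.\<close>

lemma crossing_opposite_sides:
  assumes K: "convex K" "misses K a b" "misses K c d"
    and x: "x \<in> closed_segment a b" "x \<in> closed_segment c d"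
    and o: "opp_side a b c d"
    and p: "p \<in> K" "p \<in> closed_segment a c" and q: "q \<in> K" "q \<in> closed_segment b d"
  shows False
proof (cases "x = a")
  case True
  then have "p \<in> closed_segment c d"
    using p x segment_mono[of p c a d] by (simp add: closed_segment_commute)
  then show False using K p by (auto simp: misses_def)
next
  case False
  have "q \<noteq> b" using misses_ends[OF K(2)] q by auto
  then have "same_side a b d q"
    using same_towards[of q d b a b] q opp_nz[OF o] by (simp add: closed_segment_commute)
  then have "opp_side x a c q"
    using opp_sym[OF same_opp_trans[OF same_sym opp_sym[OF o]]] opp_on_line x(1) False by blast
  moreover have "misses K c x" "misses K x a"
    using misses_part[OF K(3) _ x(2), of c] misses_part[OF K(2) x(1), of a] by simp_all
  moreover have "p \<in> closed_segment c a" using p by (simp add: closed_segment_commute)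
  ultimately obtain z where z: "z \<in> K" "a \<in> closed_segment x z"
    using convex_set_wraps_around_end[of K c x a p q] K p q by blast
  have "x \<in> closed_segment b z"
    using segment_overlap[of x b a z] z x False by (simp add: closed_segment_commute)
  then have "closed_segment x d \<inter> closed_segment q z \<noteq> {}"
    using pasch[of x b z q d] q by simp
  then show False
    using misses_segment[of K c d q z x d] K x q z by auto
qed

text \<open>Wrapping around the end of the path \<open>a1\<close>, \<open>v\<close>,
  \<open>a2\<close>: the obstacle cannot get from \<open>a1a2\<close> to \<open>a2a3\<close> in
  front of \<open>a2\<close>.\<close>

lemma star_beyond:
  assumes "convex P" "misses P v a1" "misses P v a2"
    and "p12 \<in> P" "p12 \<in> closed_segment a1 a2" "p23 \<in> P" "p23 \<in> closed_segment a2 a3"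
    and "opp_side v a2 a1 a3"
  obtains w where "w \<in> P" "a2 \<in> closed_segment v w"
proof -
  have "p23 \<noteq> a2" using assms misses_ends by metis
  then have "same_side v a2 a3 p23"
    using same_towards[of p23 a3 a2 v a2] assms(7) opp_nz[OF assms(8)] by (simp add: closed_segment_commute)
  then have "opp_side v a2 a1 p23" using assms(8) opp_sym same_opp_trans same_sym by blast
  then show thesis
    using convex_set_wraps_around_end[of P a1 v a2 p12 p23] assms misses_sym that by metis
qed

text \<open>The triangle \<open>v\<close>, \<open>p1\<close>, \<open>p3\<close> contains
  \<open>a2\<close>, and the edge \<open>a2b\<close> cannot leave it: \<open>p1p3\<close> lies in
  \<open>P\<close>, and the other two sides are avoided. As \<open>P\<close> has a point behind
  \<open>b\<close>, a point of \<open>P\<close> on \<open>vb\<close> would force \<open>b\<close>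
  into \<open>P\<close>.\<close>

lemma uncrossed_leg:
  assumes P: "convex P" "misses P v a2" "misses P a2 b"
    and p: "p1 \<in> P" "a1 \<in> closed_segment v p1" "p3 \<in> P" "a3 \<in> closed_segment v p3"
    and p12: "p12 \<in> P" "p12 \<in> closed_segment a1 a2"
    and p23: "p23 \<in> P" "p23 \<in> closed_segment a2 a3"
    and o: "same_side v a1 a2 a3" "same_side v a3 a1 a2" "opp_side v a2 a1 a3"
    and nc: "closed_segment a2 b \<inter> closed_segment v a1 = {}" "closed_segment a2 b \<inter> closed_segment v a3 = {}"
  shows "b \<in> convex hull {v, p1, p3}" "misses P v b"
proof -
  have vP: "v \<notin> P" using P misses_ends by blast
  have a1v: "a1 \<noteq> v" "a3 \<noteq> v" using o by (auto simp: same_side_def)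
  have side: "same_side v c a p" if "a \<in> closed_segment v p" "a \<noteq> v" "det3 v c a \<noteq> 0" for a p c
  proof -
    have "det3 v c p \<noteq> 0"
    proof
      assume "det3 v c p = 0"
      then have "det3 v c a = 0" using that(1) by (auto simp: in_segment det3_affine)
      with that show False by simp
    qed
    then show ?thesis using same_towards[of a p v v c] that same_sym
      by (auto simp: closed_segment_commute)
  qed
  have p1: "same_side v a2 a1 p1" using side p a1v opp_nz[OF o(3)] by blast
  have p3: "same_side v a2 a3 p3" using side p a1v opp_nz[OF o(3)] by blast
  have "opp_side v a2 p1 p3" using p1 p3 o(3) same_opp_trans same_sym opp_sym by metis
  then obtain w where w: "w \<in> closed_segment p1 p3" "det3 v a2 w = 0"
    "w \<in> closed_segment v a2 \<or> v \<in> closed_segment w a2 \<or> a2 \<in> closed_segment v w"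
    using cross_line by metis
  have wP: "w \<in> P" using w p P closed_segment_subset by blast
  \<comment> \<open>Behind \<open>v\<close> the point \<open>w\<close> would be separated from
    \<open>a2\<close> by the line \<open>va1\<close>; but \<open>p1\<close> is on that line and
    \<open>p3\<close> is on the side of \<open>a3\<close>, which is that of
    \<open>a2\<close>.\<close>
  have "v \<notin> closed_segment w a2"
  proof
    assume v: "v \<in> closed_segment w a2"
    have "det3 v p1 a1 = 0" using p(2) by (rule det3_on_segment)
    then have "det3 v a1 p1 = 0" using det3_swap(1)[of v a1 p1] by simp
    have "same_side v a1 a3 p3" using side p a1v same_nz[OF o(1)] by blast
    moreover have "w \<noteq> p1 \<Longrightarrow> same_side v a1 p3 w"
      using same_towards[of w p3 p1 v a1] w(1) same_nz[OF \<open>same_side v a1 a3 p3\<close>] \<open>det3 v a1 p1 = 0\<close>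
      by (simp add: closed_segment_commute)
    moreover have "opp_side v a1 a2 w"
      using opp_through[of v a2 w v a1] v vP wP same_nz[OF o(1)] by (metis closed_segment_commute det3_same(2))
    ultimately show False using o(1) \<open>det3 v a1 p1 = 0\<close> by (metis not_same_opp same_trans opp_nz(2))
  qed
  then have a2: "a2 \<in> convex hull {v, p1, p3}"
    using w wP missesD[OF P(2)] segment_subset_hull3[OF in_hull3(1), of w v p1 p3]
      segment_subset_hull3[OF in_hull3(2) in_hull3(3), of p1 p3 v] by blast
  \<comment> \<open>The part \<open>va\<close> is avoided by hypothesis; a hit on the part
    \<open>ap\<close> would let the chord of \<open>P\<close> from \<open>pa\<close> to
    \<open>p\<close> cut \<open>a2b\<close>, by \<open>pasch\<close>.\<close>
  have ray: "misses (closed_segment a2 b) v p"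
    if "p \<in> P" "a \<in> closed_segment v p" and nc: "closed_segment a2 b \<inter> closed_segment v a = {}"
      and
      "pa \<in> P" "pa \<in> closed_segment a a2" for a p pa
  proof -
    have "False" if x: "x \<in> closed_segment a2 b" "x \<in> closed_segment v p" for x
    proof -
      have "x \<in> closed_segment a p"
        using x Un_closed_segment[OF \<open>a \<in> closed_segment v p\<close>] nc by blast
      then have "closed_segment pa p \<inter> closed_segment x a2 \<noteq> {}"
        using pasch[of pa a a2 x p] \<open>pa \<in> closed_segment a a2\<close> by simp
      then show False
        using misses_segment[of P a2 b pa p x a2] P \<open>pa \<in> P\<close> \<open>p \<in> P\<close> x by auto
    qed
    then show ?thesis by (auto simp: misses_def)
  qed
  have "misses (closed_segment a2 b) v p1" using ray p p12 nc by blast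
  moreover have "misses (closed_segment a2 b) v p3"
    using ray[of p3 a3 p23] p p23 nc by (auto simp: closed_segment_commute)
  moreover have "misses (closed_segment a2 b) p1 p3"
    using misses_segment[of P a2 b p1 p3 a2 b] P p by (auto simp: misses_def)
  ultimately have "closed_segment a2 b \<subseteq> convex hull {v, p1, p3}"
    using a2 by (intro convex_meets_side) (auto intro: misses_sym)
  then show b: "b \<in> convex hull {v, p1, p3}" by auto
  then obtain y where y: "y \<in> closed_segment p1 p3" "b \<in> closed_segment v y"
    by (rule hull3_cevian)
  have yP: "y \<in> P" using y p P closed_segment_subset by blast
  show "misses P v b"
  proof -
    have "False" if "x \<in> P" "x \<in> closed_segment v b" for x
    proof -
      have "b \<in> closed_segment x y" using segment_tail[OF that(2) y(2)] .
      then have "b \<in> P" using that yP P closed_segment_subset by blast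
      then show False using misses_ends P by blast
    qed
    then show ?thesis by (auto simp: misses_def)
  qed
qed

text \<open>Along the path \<open>b\<close>, \<open>a\<close>, \<open>v\<close> the obstacle would
  have to pass behind \<open>v\<close>. But its chord \<open>qq'\<close> and the point
  \<open>a\<close> lie in one open half-plane bounded by the line \<open>va0\<close>.\<close>

lemma opposite_legs:
  assumes Q: "convex Q" "misses Q v a" "misses Q a b"
    and q: "q \<in> Q" "q \<in> closed_segment v b" "q' \<in> Q" "q' \<in> closed_segment v b'"
    and o: "opp_side v a b b'" "same_side v a0 b b'" "same_side v a0 b a"
  shows False
proof -
  have vQ: "v \<notin> Q" using Q misses_ends by blast
  have "same_side v a b' q'"
    using same_towards[of q' b' v v a] q opp_nz[OF o(1)] vQ by (auto simp: closed_segment_commute)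
  then have "opp_side v a b q'" using o(1) opp_sym same_opp_trans same_sym by blast
  then have "opp_side a v b q'" by (rule opp_line_sym)
  then obtain z where z: "z \<in> Q" "z \<in> closed_segment q q'" "v \<in> closed_segment a z"
    using convex_set_wraps_around_end[of Q b a v q q'] Q q misses_sym by (metis closed_segment_commute)
  have "same_side v a0 b q"
    using same_towards[of q b v v a0] q same_nz[OF o(2)] vQ by (auto simp: closed_segment_commute)
  moreover have "same_side v a0 b' q'"
    using same_towards[of q' b' v v a0] q same_nz[OF o(2)] vQ by (auto simp: closed_segment_commute)
  ultimately have "same_side v a0 q q'" using o(2) same_trans same_sym by blast
  then have "same_side v a0 q z" using z same_segment by blast
  then have "same_side v a0 a z" using \<open>same_side v a0 b q\<close> o(3) same_trans same_sym by blast
  moreover have "opp_side v a0 a z"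
    using opp_through[of v a z v a0] z vQ same_nz[OF o(3)] by auto
  ultimately show False using not_same_opp by blast
qed

lemma same_towards':
  assumes "q \<in> closed_segment x p" "q \<noteq> x" "det3 a b x = 0" "det3 a b p \<noteq> 0"
  shows "same_side a b p q"
  using same_towards[of q p x a b] assms by (simp add: closed_segment_commute)

text \<open>The obstacle passes behind \<open>b\<close>, and from there its chord back to
  \<open>k\<close> on \<open>ac\<close> cuts \<open>bc\<close>.\<close>

lemma convex_set_misses_zigzag:
  assumes "convex Q" "misses Q v a" "misses Q a b" "misses Q b c"
    and "q \<in> Q" "q \<in> closed_segment v b" "k \<in> Q" "k \<in> closed_segment a c"
    and "opp_side a b v c"
  shows False
proof -
  have "k \<noteq> a" using assms misses_ends by metis
  then have "same_side a b c k"
    using same_towards'[of k a c a b] assms(8) opp_nz[OF assms(9)] by simp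
  then have "opp_side a b v k" using assms(9) opp_sym same_opp_trans same_sym by blast
  then obtain z where z: "z \<in> Q" "b \<in> closed_segment a z"
    using convex_set_wraps_around_end[of Q v a b q k] assms by metis
  have "closed_segment b c \<inter> closed_segment k z \<noteq> {}"
    using pasch[of b a z k c] z assms by simp
  then show False
    using misses_segment[of Q b c k z b c] assms z by auto
qed

text \<open>All three sides of the triangle are missed, two of them as parts of edges. So
  \<open>Q\<close> would be trapped inside, whereas \<open>q\<close> lies across the line
  \<open>a'd\<close>.\<close>

lemma beyond_blocked:
  assumes Q: "convex Q" "misses Q v a" "misses Q a' d" "misses Q a d"
    and q: "q \<in> Q" "q \<in> closed_segment v d"
    and u: "u \<in> closed_segment v a" "u \<in> closed_segment a' d"
    and o: "opp_side a' d v a"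
  shows "Q \<inter> convex hull {a, u, d} = {}"
proof (rule ccontr)
  assume *: "\<not> ?thesis"
  have "misses Q a u" "misses Q u d"
    using misses_part[OF Q(2) _ u(1), of a] misses_part[OF Q(3) u(2), of d] by simp_all
  then have "Q \<subseteq> convex hull {a, u, d}"
    using * convex_meets_side[of Q a u d] Q misses_sym[OF Q(4)] by blast
  then obtain w where w: "w \<in> closed_segment u d" "q \<in> closed_segment a w"
    using hull3_cevian q by blast
  have "w \<in> closed_segment a' d" using w u by (meson closed_segment_subset convex_closed_segment ends_in_segment(2) subsetD)
  then have "q \<in> convex hull {a, a', d}"
    using w segment_subset_hull3[of a a a' d w] segment_subset_hull3[of a' a a' d d] in_hull3 by blast
  moreover have "q \<noteq> d" using misses_ends Q q by blast
  then have "same_side a' d v q"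
    using same_towards[OF q(2)] opp_nz[OF o] by simp
  then have "opp_side a' d a q" using o opp_sym same_opp_trans same_sym by blast
  ultimately show False using outside_hull3 by blast
qed

text \<open>The line \<open>ab\<close> separates \<open>u\<close> from \<open>d\<close>, so it meets
  \<open>ud\<close>; on the side of \<open>d\<close> this can only happen at or behind
  \<open>b\<close>, and the edge itself avoids \<open>ud\<close>.\<close>

lemma in_crossing_triangle:
  assumes u: "u \<in> closed_segment v a" "u \<noteq> a" and o: "opp_side a b v d" "same_side v a b d"
    and nc: "closed_segment a b \<inter> closed_segment u d = {}"
  shows "b \<in> convex hull {a, u, d}"
proof -
  have "same_side a b v u" using same_towards[OF u] opp_nz[OF o(1)] by simp
  then have "opp_side a b u d" using o(1) same_opp_trans same_sym by blast
  then obtain y where y: "y \<in> closed_segment u d"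
    "y \<in> closed_segment a b \<or> a \<in> closed_segment y b \<or> b \<in> closed_segment a y"
    using cross_line by metis
  have u0: "det3 v a u = 0" using u(1) by (rule det3_on_segment)
  have "a \<notin> closed_segment y b"
  proof
    assume a: "a \<in> closed_segment y b"
    have "y \<noteq> a" using y nc by auto
    then have "opp_side v a b y"
      using opp_through[of a b y v a] a same_nz[OF o(2)] by (simp add: closed_segment_commute)
    moreover from this have "y \<noteq> u" using opp_nz u0 by blast
    then have "same_side v a d y"
      using same_towards'[OF y(1)] u0 same_nz[OF o(2)] by simp
    ultimately show False using o(2) not_same_opp same_trans by blast
  qed
  with y nc have "b \<in> closed_segment a y" by blast
  then show ?thesis
    using y segment_subset_hull3[of a a u d y] segment_subset_hull3[of u a u d d] in_hull3 by blast
qed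

subsection \<open>The impossible configurations\<close>

text \<open>
  Configurations: \<open>v\<close> has the children \<open>a1\<close>, \<open>a2\<close>, \<open>a3\<close> in this angular order, \<open>b1\<close>, \<open>b2\<close>, \<open>b3\<close> are
  children of \<open>a2\<close>, \<open>c\<close> is the child of \<open>b3\<close> and \<open>d\<close> a child of \<open>a3\<close>. The edges \<open>a2b\<close> cross \<open>va1\<close>, the edge
  \<open>a3d\<close> crosses \<open>va2\<close> in \<open>u\<close>, and \<open>b3c\<close> crosses \<open>a2b1\<close> and \<open>a2b2\<close>.
\<close>

lemma star_obstacle_not_upper:
  assumes Q: "convex Q" "misses Q v a2" "misses Q a3 d" "misses Q a2 d"
    and R: "convex R" "misses R a1 a2" "misses R a2 b1" "misses R a2 b2"
    and QR: "Q \<inter> R = {}"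
    and q: "q \<in> Q" "q \<in> closed_segment v d"
    and s: "s \<in> Q" "s \<in> closed_segment b1 b2"
    and r: "r \<in> R" "r \<in> closed_segment a2 d"
    and r1: "r1 \<in> R" "r1 \<in> closed_segment b1 a1"
    and r2: "r2 \<in> R" "r2 \<in> closed_segment b2 a1"
    and u: "u \<in> closed_segment v a2" "u \<in> closed_segment a3 d"
    and o: "opp_side a3 d v a2"
    and nc: "closed_segment a2 b1 \<inter> closed_segment a3 d = {}" "closed_segment a2 b2 \<inter> closed_segment a3 d = {}"
    and left: "same_side v a2 b1 d" "same_side v a2 b2 d"
    and below: "opp_side a2 b1 v a1" "opp_side a2 b2 v a1"
    and d: "same_side a2 b1 v d \<and> same_side a2 b2 v d \<or> opp_side a2 b1 v d \<and> opp_side a2 b2 v d"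
  shows False
  using d
proof
  \<comment> \<open>Both feet, and so \<open>s\<close>, lie in the triangle \<open>a2\<close>,
    \<open>u\<close>, \<open>d\<close>, which \<open>beyond_blocked\<close> denies to
    \<open>Q\<close>.\<close>
  assume d: "opp_side a2 b1 v d \<and> opp_side a2 b2 v d"
  have ud: "closed_segment u d \<subseteq> closed_segment a3 d"
    using u by (simp add: subset_closed_segment)
  have "det3 a3 d u = 0" using u(2) by (rule det3_on_segment)
  then have "u \<noteq> a2" using opp_nz[OF o] by auto
  then have "b1 \<in> convex hull {a2, u, d}" "b2 \<in> convex hull {a2, u, d}"
    using in_crossing_triangle[OF u(1)] d left nc ud by blast+
  then have "s \<in> convex hull {a2, u, d}" using s segment_subset_hull3 by blast
  then show False using beyond_blocked[OF Q q u o] s by blast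
next
  \<comment> \<open>\<open>R\<close> passes behind \<open>b1\<close> and \<open>b2\<close>,
    \<open>Q\<close> passes behind \<open>d\<close>. Seen from \<open>a2\<close>, the point
    \<open>s\<close> of \<open>Q\<close> is in front of a chord of \<open>R\<close> and the point
    \<open>r\<close> of \<open>R\<close> is in front of \<open>w\<close> in \<open>Q\<close>, so two
    chords cross.\<close>
  assume d: "same_side a2 b1 v d \<and> same_side a2 b2 v d"
  have ra: "r \<noteq> a2" using R r misses_ends by blast
  have z: "\<exists>z\<in>R. b \<in> closed_segment a2 z"
    if "misses R a2 b" "r' \<in> R" "r' \<in> closed_segment b a1" "opp_side a2 b v a1" "same_side a2 b v d" for b r'
  proof -
    have "opp_side a2 b a1 d" using opp_same_trans[OF opp_sym[OF that(4)] that(5)] .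
    moreover have "same_side a2 b d r"
      using same_towards'[OF r(2) ra, of a2 b] same_nz[OF that(5)] by simp
    ultimately have "opp_side a2 b a1 r" by (rule opp_same_trans)
    moreover have "r' \<in> closed_segment a1 b" using that(3) by (simp add: closed_segment_commute)
    ultimately show ?thesis using convex_set_wraps_around_end[of R a1 a2 b r' r] R(1,2) r(1) that(1,2) by metis
  qed
  obtain z1 where z1: "z1 \<in> R" "b1 \<in> closed_segment a2 z1" using z[OF R(3) r1 below(1)] d by blast
  obtain z2 where z2: "z2 \<in> R" "b2 \<in> closed_segment a2 z2" using z[OF R(4) r2 below(2)] d by blast
  have d1: "opp_side a2 d v b1" and d2: "opp_side a2 d v b2"
    using between_rays left d by simp_all
  have "same_side a2 d b1 b2" using opp_opp_trans[OF opp_sym[OF d1] d2] .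
  then have "opp_side a2 d v s" using opp_same_trans[OF d1] same_segment[OF s(2)] by blast
  then obtain w where w: "w \<in> Q" "d \<in> closed_segment a2 w"
    using convex_set_wraps_around_end[of Q v a2 d q s] Q(1,2,4) q s(1) by metis
  obtain z where zz: "z \<in> closed_segment z1 z2" "s \<in> closed_segment a2 z"
    using segment_through[OF z1(2) z2(2) s(2)] .
  have "z \<in> R" using zz z1 z2 R closed_segment_subset by blast
  have "r \<in> closed_segment a2 w" using segment_mono[OF r(2) w(2)] .
  then have "closed_segment r z \<inter> closed_segment s w \<noteq> {}"
    using pasch zz by blast
  moreover have "closed_segment r z \<subseteq> R" "closed_segment s w \<subseteq> Q"
    using R Q r s w \<open>z \<in> R\<close> closed_segment_subset by blast+
  ultimately show False using QR by blast
qed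

text \<open>\<open>P\<close> hides \<open>c\<close> from \<open>a2\<close>, and its detour behind
  \<open>a2\<close> forces \<open>c\<close> across the line \<open>va2\<close>. The edge
  \<open>b3c\<close> then passes behind \<open>v\<close>, which puts \<open>q\<close> into the
  triangle \<open>a2\<close>, \<open>b3\<close>, \<open>c\<close>. \<open>Q\<close> misses the sides
  of this triangle, yet \<open>th\<close> lies outside it.\<close>

lemma upward_leg_hidden_by_star:
  assumes P: "convex P" "misses P b3 c" "misses P a2 b3"
    and k: "k \<in> P" "k \<in> closed_segment a2 c" and p: "p \<in> P" "p \<in> closed_segment a1 a2"
    and Q: "convex Q" "misses Q b3 c" "misses Q a2 b3" "misses Q a2 c"
    and q: "q \<in> Q" "q \<in> closed_segment v b3" and th: "th \<in> Q" "th \<in> closed_segment c b1"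
    and x: "x \<in> closed_segment a2 b3" "x \<in> closed_segment v a1"
    and nc: "closed_segment v a1 \<inter> closed_segment b3 c = {}"
    and o: "opp_side a2 b3 v a1" "same_side a2 b3 v c" "same_side v a2 a1 b3" "det3 v a2 c \<noteq> 0" "opp_side b3 c a2 b1"
  shows False
proof -
  have a2P: "a2 \<notin> P" using P misses_ends by blast
  have "same_side a2 b3 a1 p"
    using same_towards[OF p(2), of a2 b3] p(1) a2P opp_nz[OF o(1)] by auto
  then have "opp_side a2 b3 c p" using o same_opp_trans same_sym opp_sym by meson
  then have "opp_side b3 a2 c p" by (rule opp_line_sym)
  moreover have "k \<in> closed_segment c a2" using k by (simp add: closed_segment_commute)
  ultimately obtain z where z: "z \<in> P" "z \<in> closed_segment k p" "a2 \<in> closed_segment b3 z"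
    using convex_set_wraps_around_end[of P c b3 a2 k p] P k p misses_sym by metis
  have "opp_side v a2 b3 z"
    using opp_through[OF z(3), of v a2] z(1) a2P same_nz[OF o(3)] by auto
  have "\<not> same_side v a2 b3 c"
  proof
    assume "same_side v a2 b3 c"
    then have "same_side v a2 b3 k"
      using same_towards'[OF k(2), of v a2] k(1) a2P o(4) same_trans[OF \<open>same_side v a2 b3 c\<close>] by auto
    moreover have "same_side v a2 a1 p"
      using same_towards[OF p(2), of v a2] p(1) a2P same_nz[OF o(3)] by auto
    ultimately have "same_side v a2 k p" using o(3) same_trans same_sym by meson
    then have "same_side v a2 b3 z" using z(2) same_segment \<open>same_side v a2 b3 k\<close> same_trans by meson
    then show False using \<open>opp_side v a2 b3 z\<close> not_same_opp by blast
  qed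
  then have "opp_side v a2 b3 c"
    using same_nz[OF o(3)] o(4) by (auto simp: same_side_def opp_side_def not_less zero_less_mult_iff mult_less_0_iff neq_iff)
  then obtain w where w: "w \<in> closed_segment b3 c" "det3 v a2 w = 0"
    "w \<in> closed_segment v a2 \<or> v \<in> closed_segment w a2 \<or> a2 \<in> closed_segment v w"
    using cross_line by metis
  \<comment> \<open>Otherwise \<open>pasch\<close> in the triangle \<open>a2\<close>,
    \<open>b3\<close>, \<open>v\<close> makes \<open>b3c\<close> cross \<open>va1\<close>.\<close>
  have w1: "w \<notin> closed_segment v a2"
  proof
    assume "w \<in> closed_segment v a2"
    then have "closed_segment x v \<inter> closed_segment w b3 \<noteq> {}"
      using pasch[of x a2 b3 w v] x by (simp add: closed_segment_commute)
    moreover have "closed_segment x v \<subseteq> closed_segment v a1" "closed_segment w b3 \<subseteq> closed_segment b3 c"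
      using x w by (simp_all add: subset_closed_segment)
    ultimately show False using nc by blast
  qed
  \<comment> \<open>Behind \<open>a2\<close> the point \<open>w\<close> would lie across the line
    \<open>a2b3\<close> from \<open>v\<close>, but \<open>c\<close> is on the side of
    \<open>v\<close>.\<close>
  have "a2 \<notin> closed_segment v w"
  proof
    assume "a2 \<in> closed_segment v w"
    moreover have "a2 \<noteq> w" using w1 by auto
    ultimately have "opp_side a2 b3 v w" using opp_through[of a2 v w a2 b3] opp_nz[OF o(1)] by simp
    moreover have "same_side a2 b3 c w"
      using same_towards'[OF w(1), of a2 b3] opp_nz[OF \<open>opp_side a2 b3 v w\<close>] same_nz[OF o(2)] det3_same(3)[of b3 a2]
      by (metis det3_same(2) det3_cyc(1))
    ultimately show False using o(2) same_trans not_same_opp by blast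
  qed
  with w w1 have v: "v \<in> closed_segment w a2" by blast
  have "v \<noteq> w" using w nc by auto
  have w0: "det3 b3 c w = 0" using w(1) by (rule det3_on_segment)
  have "same_side b3 c a2 v"
    using same_towards'[OF v] \<open>v \<noteq> w\<close> w0 opp_nz[OF o(5)] by simp
  moreover have "same_side b3 c v q"
    using same_towards[OF q(2), of b3 c] q(1) misses_ends(1)[OF Q(2)] same_nz(2)[OF calculation] by auto
  ultimately have "same_side b3 c a2 q" using same_trans by blast
  moreover have "same_side b3 c b1 th"
    using same_towards'[OF th(2), of b3 c] th(1) misses_ends(2)[OF Q(2)] opp_nz[OF o(5)] by auto
  ultimately have "opp_side b3 c q th" using o(5) same_opp_trans same_sym opp_sym by meson
  then obtain t where t: "t \<in> closed_segment q th"
    "t \<in> closed_segment b3 c \<or> b3 \<in> closed_segment t c \<or> c \<in> closed_segment b3 t"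
    using cross_line by metis
  have tQ: "t \<in> Q" using t q th Q closed_segment_subset by blast
  have "w \<in> convex hull {a2, b3, c}" using w segment_subset_hull3[of b3 a2 b3 c c] in_hull3 by blast
  then have "v \<in> convex hull {a2, b3, c}" using v segment_subset_hull3[of w a2 b3 c a2] in_hull3 by blast
  then have qT: "q \<in> convex hull {a2, b3, c}" using q segment_subset_hull3[of v a2 b3 c b3] in_hull3 by blast
  show False
    using t(2)
  proof (elim disjE)
    assume "t \<in> closed_segment b3 c"
    then show False using tQ Q missesD by blast
  next
    assume "b3 \<in> closed_segment t c"
    moreover have "q \<in> convex hull {c, b3, a2}" using qT by (simp add: insert_commute)
    ultimately have "closed_segment t q \<inter> closed_segment b3 a2 \<noteq> {}" by (rule hull3_exit)
    then show False using misses_segment[of Q a2 b3 t q b3 a2] Q tQ q by auto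
  next
    assume "c \<in> closed_segment b3 t"
    then have "c \<in> closed_segment t b3" by (simp add: closed_segment_commute)
    moreover have "q \<in> convex hull {b3, c, a2}" using qT by (simp add: insert_commute)
    ultimately have "closed_segment t q \<inter> closed_segment c a2 \<noteq> {}" by (rule hull3_exit)
    then show False using misses_segment[of Q a2 c t q c a2] Q tQ q by auto
  qed
qed

lemma same_or_opp: "det3 a b p \<noteq> 0 \<Longrightarrow> det3 a b q \<noteq> 0 \<Longrightarrow> same_side a b p q \<or> opp_side a b p q"
  by (auto simp: same_side_def opp_side_def zero_less_mult_iff mult_less_0_iff neq_iff)

lemma in_hull_segment:
  "z \<in> closed_segment p q \<Longrightarrow> p \<in> convex hull S \<Longrightarrow> q \<in> convex hull S \<Longrightarrow> z \<in> convex hull S"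
  using closed_segment_subset[of p "convex hull S" q] by auto

lemma segment_part:
  fixes a :: "'a::real_vector"
  shows "x \<in> closed_segment a b \<Longrightarrow> y \<in> closed_segment a b \<Longrightarrow> closed_segment x y \<subseteq> closed_segment a b"
  by (simp add: subset_closed_segment)

text \<open>The chord stays on one side of the line \<open>ab\<close> once it has left
  \<open>z\<close>, so it meets the line \<open>bc\<close> on the ray from \<open>b\<close> through
  \<open>c\<close> and not on the opposite one.\<close>

lemma chord_meets_ray:
  assumes z: "det3 a b z = 0" and o: "opp_side b c z r" and s: "same_side a b c r"
  obtains g where "g \<in> closed_segment z r" "g \<in> closed_segment b c \<or> c \<in> closed_segment b g"
proof -
  obtain g where g: "g \<in> closed_segment z r"
    "g \<in> closed_segment b c \<or> b \<in> closed_segment g c \<or> c \<in> closed_segment b g"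
    using cross_line[OF o] by metis
  have "g \<in> closed_segment b c" if "b \<in> closed_segment g c"
  proof (cases "g = b")
    case False
    then have "opp_side a b c g"
      using opp_through[of b c g a b] that same_nz[OF s] by (simp add: closed_segment_commute)
    moreover have "g \<noteq> z" using opp_nz[OF \<open>opp_side a b c g\<close>] z by auto
    then have "same_side a b r g" using same_towards'[OF g(1), of a b] z same_nz[OF s] by simp
    ultimately show ?thesis using s same_trans not_same_opp by blast
  qed simp
  with g that show thesis by blast
qed

text \<open>The rays from \<open>b\<close> to \<open>c\<close> and \<open>a1\<close> lie in one
  half-plane of the line \<open>ab\<close>; whichever is closer in angle to the ray
  \<open>bz\<close> separates \<open>z\<close> from the other point.\<close>

lemma ray_order:
  assumes b: "b \<in> closed_segment a z" "z \<noteq> b" and s: "same_side a b c a1" and n: "det3 b c a1 \<noteq> 0"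
  shows "opp_side b c z a1 \<or> opp_side b a1 z c"
proof -
  obtain t where t: "0 \<le> t" "t \<le> 1" "b = (1 - t) *\<^sub>R a + t *\<^sub>R z"
    using b(1) by (auto simp: in_segment)
  have "t \<noteq> 1" using t(3) b(2) by auto
  then have t1: "0 < 1 - t" using t by simp
  have ab: "a \<noteq> b" using same_nz[OF s] by auto
  then have "t \<noteq> 0" using t(3) by auto
  then have t0: "0 < t" using t(1) by simp
  have e: "(1 - t) * det3 a b p = t * det3 b z p" for p
  proof -
    have "det3 p b b = (1 - t) * det3 p b a + t * det3 p b z" unfolding t(3) det3_affine ..
    moreover have "det3 p b a = - det3 a b p" "det3 p b z = det3 b z p"
      by (simp_all add: det3_def algebra_simps)
    ultimately show ?thesis by simp
  qed
  have sg: "0 < det3 b z p \<longleftrightarrow> 0 < det3 a b p" "det3 b z p < 0 \<longleftrightarrow> det3 a b p < 0" for p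
    using e[of p] t0 t1 by (metis mult_less_cancel_left_pos mult_zero_right)+
  have "det3 b c z = - det3 b z c" "det3 b a1 z = - det3 b z a1" "det3 b a1 c = - det3 b c a1"
    by (simp_all add: det3_def algebra_simps)
  then show ?thesis
    using s n sg[of c] sg[of a1]
    by (auto simp: opp_side_def same_side_def zero_less_mult_iff mult_less_0_iff neq_iff)
qed

text \<open>\<open>Q\<close> and \<open>R\<close> both pass behind \<open>b1\<close> and
  \<open>b2\<close>. Disjointness fixes their order there, then the order of the rays from
  \<open>b1\<close> to \<open>c\<close> and \<open>a1\<close>, until the edges \<open>va1\<close>
  and \<open>b3c\<close> are forced to cross.\<close>

lemma downward_leg_hidden_by_upper:
  assumes Q: "convex Q" "misses Q v a2" "misses Q a2 b1" "misses Q a2 b2" "misses Q a1 b1"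
    and R: "convex R" "misses R a1 a2" "misses R a2 b1" "misses R a2 b2" "misses R c b1"
    and QR: "Q \<inter> R = {}"
    and q: "q1 \<in> Q" "q1 \<in> closed_segment v b1" "q2 \<in> Q" "q2 \<in> closed_segment v b2"
    and th: "th1 \<in> Q" "th1 \<in> closed_segment c b1" "th2 \<in> Q" "th2 \<in> closed_segment c b2"
    and r: "r1 \<in> R" "r1 \<in> closed_segment b1 a1" "r2 \<in> R" "r2 \<in> closed_segment b2 a1"
    and s: "s1 \<in> R" "s1 \<in> closed_segment b1 b3" "s2 \<in> R" "s2 \<in> closed_segment b2 b3"
    and s12: "s12 \<in> R" "s12 \<in> closed_segment b1 b2"
    and o1: "opp_side a2 b1 v c" "opp_side a2 b1 v a1" "same_side a2 b1 v b3"
    and o2: "opp_side a2 b2 v c" "opp_side a2 b2 v a1" "same_side a2 b2 v b3"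
    and n: "det3 b1 c a1 \<noteq> 0"
    and y: "y \<in> closed_segment a2 b1" "y \<in> closed_segment b3 c"
    and x1: "x1 \<in> closed_segment a2 b1" "x1 \<in> closed_segment v a1"
    and x3: "x3 \<in> closed_segment a2 b3" "x3 \<in> closed_segment v a1"
    and nc: "closed_segment v a1 \<inter> closed_segment b3 c = {}"
  shows False
proof -
  have Qb: "\<exists>z\<in>Q. b \<in> closed_segment a2 z"
    if "misses Q a2 b" "q \<in> Q" "q \<in> closed_segment v b" "th \<in> Q" "th \<in> closed_segment c b" "opp_side a2 b v c"
    for b q th
  proof -
    have "th \<noteq> b" using misses_ends[OF that(1)] that(4) by auto
    then have "same_side a2 b c th" using same_towards[OF that(5), of a2 b] opp_nz[OF that(6)] by simp
    then have "opp_side a2 b v th" by (rule opp_same_trans[OF that(6)])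
    then show ?thesis using convex_set_wraps_around_end[of Q v a2 b q th] Q(1,2) that(1-4) by metis
  qed
  have Rb: "\<exists>z\<in>R. b \<in> closed_segment a2 z"
    if "misses R a2 b" "r \<in> R" "r \<in> closed_segment b a1" "s \<in> R" "s \<in> closed_segment b b3"
      "opp_side a2 b v a1" "same_side a2 b v b3" for b r s
  proof -
    have "s \<noteq> b" using misses_ends[OF that(1)] that(4) by auto
    then have "same_side a2 b b3 s" using same_towards'[OF that(5), of a2 b] same_nz[OF that(7)] by simp
    then have "opp_side a2 b a1 s"
      using opp_same_trans[OF opp_same_trans[OF opp_sym[OF that(6)] that(7)]] by blast
    moreover have "r \<in> closed_segment a1 b" using that(3) by (simp add: closed_segment_commute)
    ultimately show ?thesis using convex_set_wraps_around_end[of R a1 a2 b r s] R(1,2) that(1,2,4) by metis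
  qed
  obtain z1 where z1: "z1 \<in> Q" "b1 \<in> closed_segment a2 z1"
    using Qb[OF Q(3) q(1,2) th(1,2) o1(1)] by blast
  obtain z2 where z2: "z2 \<in> Q" "b2 \<in> closed_segment a2 z2"
    using Qb[OF Q(4) q(3,4) th(3,4) o2(1)] by blast
  obtain y1 where y1: "y1 \<in> R" "b1 \<in> closed_segment a2 y1"
    using Rb[OF R(3) r(1,2) s(1,2) o1(2,3)] by blast
  obtain y2 where y2: "y2 \<in> R" "b2 \<in> closed_segment a2 y2"
    using Rb[OF R(4) r(3,4) s(3,4) o2(2,3)] by blast
  have QRs: "closed_segment p p' \<inter> closed_segment t t' = {}"
    if "p \<in> Q" "p' \<in> Q" "t \<in> R" "t' \<in> R" for p p' t t'
    using closed_segment_subset[OF that(1,2) Q(1)] closed_segment_subset[OF that(3,4) R(1)] QR by blast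
  have ab: "a2 \<noteq> b1" "a2 \<noteq> b2" using opp_nz[OF o1(1)] opp_nz[OF o2(1)] by auto
  \<comment> \<open>Behind \<open>b1\<close>, \<open>R\<close> comes before \<open>Q\<close>. If
    not, then either \<open>R\<close> comes first behind \<open>b2\<close> and two chords cross, or
    \<open>Q\<close> comes first at both feet and a point \<open>e\<close> of its chord lies between
    the points \<open>s12\<close> and \<open>e'\<close> of \<open>R\<close>.\<close>
  have "y1 \<in> closed_segment a2 z1"
  proof (rule ccontr)
    assume *: "y1 \<notin> closed_segment a2 z1"
    then have z1y: "z1 \<in> closed_segment a2 y1" using ray_linear[OF y1(2) z1(2) ab(1)] by blast
    consider "y2 \<in> closed_segment a2 z2" | "z2 \<in> closed_segment a2 y2"
      using ray_linear[OF y2(2) z2(2) ab(2)] by blast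
    then show False
    proof cases
      case 1
      then show False using pasch[OF z1y 1] QRs[OF z1(1) z2(1) y2(1) y1(1)] by simp
    next
      case 2
      obtain e where e: "e \<in> closed_segment z1 z2" "s12 \<in> closed_segment a2 e"
        using segment_through[OF z1(2) z2(2) s12(2)] .
      obtain e' where e': "e' \<in> closed_segment y1 y2" "e \<in> closed_segment a2 e'"
        using segment_through[OF z1y 2 e(1)] .
      have "e' \<in> R" using e' closed_segment_subset[OF y1(1) y2(1) R(1)] by blast
      moreover have "e \<in> closed_segment s12 e'" using segment_tail[OF e(2) e'(2)] .
      ultimately show False using e(1) QRs[OF z1(1) z2(1) s12(1) \<open>e' \<in> R\<close>] by blast
    qed
  qed
  then have y1z: "y1 \<in> closed_segment b1 z1"
    using segment_tail[OF y1(2)] by simp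
  have z1b: "z1 \<noteq> b1" "y1 \<noteq> b1" using z1 y1 misses_ends[OF Q(3)] misses_ends[OF R(3)] by auto
  have z0: "det3 a2 b1 z1 = 0" "det3 a2 b1 y1 = 0"
    using det3_on_segment[OF z1(2)] det3_on_segment[OF y1(2)] det3_swap(1)[of a2 b1] by simp_all
  have ca1: "same_side a2 b1 c a1" using opp_opp_trans[OF opp_sym[OF o1(1)] o1(2)] .
  have thb: "th1 \<in> closed_segment b1 c" using th(2) by (simp add: closed_segment_commute)
  have "th1 \<noteq> b1" "r1 \<noteq> b1" using th r misses_ends[OF Q(3)] misses_ends[OF R(3)] by auto
  then have sth: "same_side a2 b1 c th1" "same_side a2 b1 a1 r1"
    using same_towards'[OF thb, of a2 b1] same_towards'[OF r(2), of a2 b1] same_nz[OF ca1] by simp_all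
  \<comment> \<open>Otherwise the chord of \<open>R\<close> from \<open>y1\<close> to
    \<open>r1\<close> meets the ray \<open>b1c\<close> behind \<open>c\<close>, and the chord of
    \<open>Q\<close> from \<open>th1\<close> to \<open>z1\<close> crosses a chord of
    \<open>R\<close>.\<close>
  have "\<not> opp_side b1 c y1 a1"
  proof
    assume "opp_side b1 c y1 a1"
    moreover have "same_side b1 c a1 r1"
      using same_towards'[OF r(2), of b1 c] n \<open>r1 \<noteq> b1\<close> by simp
    ultimately have "opp_side b1 c y1 r1" by (rule opp_same_trans)
    moreover have "same_side a2 b1 c r1" using ca1 sth same_trans by blast
    ultimately obtain g where g: "g \<in> closed_segment y1 r1"
        "g \<in> closed_segment b1 c \<or> c \<in> closed_segment b1 g"
      using chord_meets_ray[OF z0(2)] by metis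
    have gR: "g \<in> R" using g closed_segment_subset[OF y1(1) r(1) R(1)] by blast
    then have "c \<in> closed_segment b1 g" using g missesD[OF misses_sym[OF R(5)]] by blast
    then have "th1 \<in> closed_segment b1 g" using segment_mono[OF thb] by blast
    then show False using pasch[OF y1z] QRs[OF th(1) z1(1) y1(1) gR] by (metis inf_commute)
  qed
  then have "opp_side b1 a1 y1 c" using ray_order[OF y1(2) z1b(2) ca1 n] by blast
  have "opp_side b1 a1 z1 c"
  proof -
    have "det3 b1 a1 z1 \<noteq> 0"
    proof
      assume "det3 b1 a1 z1 = 0"
      then have "det3 b1 a1 y1 = 0" using y1z by (auto simp: in_segment det3_affine)
      then show False using opp_nz[OF \<open>opp_side b1 a1 y1 c\<close>] by simp
    qed
    then have "same_side b1 a1 z1 y1" using same_towards'[OF y1z, of b1 a1] z1b by simp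
    then show ?thesis using same_opp_trans \<open>opp_side b1 a1 y1 c\<close> by blast
  qed
  moreover have "same_side b1 a1 c th1"
    using same_towards'[OF thb, of b1 a1] opp_nz[OF \<open>opp_side b1 a1 y1 c\<close>] \<open>th1 \<noteq> b1\<close> by simp
  ultimately have "opp_side b1 a1 z1 th1" by (rule opp_same_trans)
  moreover have "same_side a2 b1 a1 th1" using same_trans[OF same_sym[OF ca1] sth(1)] .
  ultimately obtain g where g: "g \<in> closed_segment z1 th1"
      "g \<in> closed_segment b1 a1 \<or> a1 \<in> closed_segment b1 g"
    using chord_meets_ray[OF z0(1)] by metis
  have gQ: "g \<in> Q" using g closed_segment_subset[OF z1(1) th(1) Q(1)] by blast
  then have a1g: "a1 \<in> closed_segment b1 g" using g missesD[OF misses_sym[OF Q(5)]] by blast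
  \<comment> \<open>The edge \<open>b3c\<close> starts below \<open>va1\<close>; meeting
    \<open>a2b1\<close> above it would require a crossing with \<open>va1\<close>.\<close>
  have "y \<notin> closed_segment a2 x1"
  proof
    assume "y \<in> closed_segment a2 x1"
    then have "closed_segment x3 x1 \<inter> closed_segment y b3 \<noteq> {}"
      using pasch[OF x3(1)] by blast
    moreover have "closed_segment x3 x1 \<subseteq> closed_segment v a1" using segment_part[OF x3(2) x1(2)] .
    moreover have "closed_segment y b3 \<subseteq> closed_segment b3 c" using segment_part[OF y(2)] by simp
    ultimately show False using nc by blast
  qed
  then have yx: "y \<in> closed_segment x1 b1"
    using y(1) Un_closed_segment[OF x1(1)] by blast
  have "y \<in> closed_segment x1 z1"
  proof -
    have "b1 \<in> closed_segment x1 z1" using segment_tail[OF x1(1) z1(2)] .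
    then show ?thesis using segment_mono[OF yx] by blast
  qed
  \<comment> \<open>\<open>Q\<close> passes behind \<open>a1\<close> as seen from \<open>b1\<close>,
    so the endpoint \<open>a1\<close> is enclosed and the edge reaching it from \<open>x1\<close>
    must cross \<open>yc\<close>.\<close>
  moreover have "a1 \<in> convex hull {z1, y, c}"
  proof -
    have b: "b1 \<in> closed_segment y z1" using segment_tail[OF y(1) z1(2)] .
    have "b1 \<in> convex hull {z1, y, c}"
      by (rule in_hull_segment[OF b in_hull3(2) in_hull3(1)])
    moreover from this have "th1 \<in> convex hull {z1, y, c}"
      by (rule in_hull_segment[OF thb _ in_hull3(3)])
    then have "g \<in> convex hull {z1, y, c}"
      by (rule in_hull_segment[OF g(1) in_hull3(1)])
    ultimately show ?thesis by (rule in_hull_segment[OF a1g])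
  qed
  ultimately have "closed_segment x1 a1 \<inter> closed_segment y c \<noteq> {}" by (rule hull3_exit)
  moreover have "closed_segment x1 a1 \<subseteq> closed_segment v a1" "closed_segment y c \<subseteq> closed_segment b3 c"
    using segment_part[OF x1(2)] segment_part[OF y(2)] by simp_all
  ultimately show False using nc by blast
qed

text \<open>The rays from \<open>a\<close> come in the order \<open>v\<close>, \<open>d\<close>,
  \<open>c\<close>, \<open>b\<close>. That they span less than a half turn is read off from the
  Grassmann-Pluecker relation, in the form \<open>G * C = B * E - A * F\<close>.\<close>

lemma between_rays':
  assumes o: "same_side v a b d" "same_side a b v d" "opp_side a d v c" "same_side a b v c"
  shows "same_side v a d c \<and> opp_side a c d b"
proof -
  define A where "A = det3 a v d"
  define B where "B = det3 a v b"
  define C where "C = det3 a d b"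
  define E where "E = det3 a d c"
  define F where "F = det3 a b c"
  define G where "G = det3 a v c"
  have eqs: "det3 v a b = - B" "det3 v a d = - A" "det3 v a c = - G"
    "det3 a b v = - B" "det3 a b d = - C" "det3 a d v = - A"
    "det3 a c d = - E" "det3 a c b = - F"
    by (simp_all add: A_def B_def C_def E_def F_def G_def det3_def algebra_simps)
  have AB: "0 < B * A" and BC: "0 < B * C" and AE: "0 < A * E" and BF: "B * F < 0"
    using o by (auto simp: same_side_def opp_side_def eqs E_def[symmetric] F_def[symmetric])
  have G: "G * C = B * E - A * F"
    using det3_pluecker[of a v d c b]
    by (simp add: A_def B_def C_def E_def F_def G_def det3_def algebra_simps)
  consider "0 < A" "0 < B" "0 < C" "0 < E" "F < 0" | "A < 0" "B < 0" "C < 0" "E < 0" "0 < F"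
    using AB BC AE BF by (auto simp: zero_less_mult_iff mult_less_0_iff)
  then have "0 < A * G \<and> E * F < 0"
  proof cases
    case 1
    then have "0 < B * E" "A * F < 0" by (simp_all add: mult_pos_neg)
    then have "0 < G * C" using G by linarith
    then have "0 < G" using 1 by (simp add: zero_less_mult_iff)
    then show ?thesis using 1 by (simp add: mult_pos_neg)
  next
    case 2
    then have "0 < B * E" "A * F < 0" by (simp_all add: mult_neg_pos mult_neg_neg)
    then have "0 < G * C" using G by linarith
    then have "G < 0" using 2 by (simp add: zero_less_mult_iff)
    then show ?thesis using 2 by (simp add: mult_neg_neg mult_neg_pos)
  qed
  then show ?thesis by (simp add: same_side_def opp_side_def eqs)
qed

text \<open>\<open>Q\<close> cannot enter the triangle \<open>a2\<close>, \<open>u\<close>,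
  \<open>d\<close>, so \<open>c\<close>, which \<open>Q\<close> hides from \<open>a2\<close>, is not
  in it. The cases follow the angular position of \<open>d\<close> around \<open>a2\<close> relative
  to \<open>b3\<close> and \<open>c\<close>.\<close>

lemma upward_leg_hidden_by_upper:
  assumes Q: "convex Q" "misses Q v a2" "misses Q a3 d" "misses Q a2 d"
    and R: "convex R" "misses R a2 b3" "misses R b3 c" "misses R a2 c"
    and QR: "Q \<inter> R = {}"
    and q: "q \<in> Q" "q \<in> closed_segment v d" and k: "k \<in> Q" "k \<in> closed_segment a2 c"
    and r: "r \<in> R" "r \<in> closed_segment a2 d" and s: "s \<in> R" "s \<in> closed_segment b1 b3"
    and y: "y \<in> closed_segment a2 b1" "y \<in> closed_segment b3 c"
    and u: "u \<in> closed_segment v a2" "u \<in> closed_segment a3 d"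
    and nc: "closed_segment b3 c \<inter> closed_segment a3 d = {}" "closed_segment b3 c \<inter> closed_segment v a2 = {}"
      "closed_segment a2 b3 \<inter> closed_segment a3 d = {}"
    and o: "opp_side a3 d v a2" "same_side v a2 b3 d" "same_side v a2 b1 d" "same_side a2 b3 v c" "opp_side b3 c a2 b1"
    and n: "det3 a2 d c \<noteq> 0" "det3 a2 d b3 \<noteq> 0" "det3 v a2 c \<noteq> 0" "det3 a3 d c \<noteq> 0" "det3 a2 b1 c \<noteq> 0"
  shows False
proof -
  have QT: "Q \<inter> convex hull {a2, u, d} = {}" by (rule beyond_blocked[OF Q q u o(1)])
  have cT: "c \<notin> convex hull {a2, u, d}"
    using QT k(1) in_hull_segment[OF k(2) in_hull3(1)] by blast
  have u0: "det3 a3 d u = 0" "det3 v a2 u = 0" using u det3_on_segment by blast+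
  have ne: "u \<noteq> a2" "u \<noteq> v" using opp_nz[OF o(1)] u0 by auto
  have ua: "closed_segment a2 u \<subseteq> closed_segment v a2" "closed_segment u d \<subseteq> closed_segment a3 d"
    using segment_part[OF _ u(1), of a2] segment_part[OF u(2), of d] by simp_all
  have dis: "misses (closed_segment x c) a2 u" "misses (closed_segment x c) u d"
    if "x \<in> closed_segment b3 c" for x
    using ua nc segment_part[OF that, of c] by (auto simp: misses_def)
  have a2c: "a2 \<notin> closed_segment b3 c" using nc by auto
  have da: "d \<noteq> a2" using n(1) by auto
  have nd: "det3 a2 b3 d \<noteq> 0" using n(2) by (simp add: det3_swap(1)[of a2 b3 d])
  show False
  proof (cases "same_side a2 b3 v d")
    \<comment> \<open>\<open>b3\<close> is in the triangle and \<open>b3c\<close> can leave it only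
      through \<open>a2d\<close>, at a point that would be on the side of \<open>d\<close> and also
      on the side of \<open>c\<close> of the line \<open>a2b3\<close>.\<close>
    case False
    then have opp_side: "opp_side a2 b3 v d"
      using same_nz[OF o(4)] nd same_or_opp by blast
    have "b3 \<in> convex hull {a2, u, d}"
      using in_crossing_triangle[OF u(1) ne(1) opp_side o(2)] nc ua by blast
    then have "\<not> misses (closed_segment b3 c) d a2"
      using convex_meets_side[of "closed_segment b3 c" a2 u d] dis[of b3] cT by auto
    then obtain t where t: "t \<in> closed_segment b3 c" "t \<in> closed_segment d a2"
      by (auto simp: misses_def)
    have "t \<noteq> a2" using t a2c by auto
    then have "same_side a2 b3 d t" using same_towards[OF t(2), of a2 b3] nd by simp
    then have "opp_side a2 b3 v t" by (rule opp_same_trans[OF opp_side])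
    have "t \<noteq> b3" using opp_nz[OF \<open>opp_side a2 b3 v t\<close>] by auto
    then have "same_side a2 b3 c t" using same_towards'[OF t(1), of a2 b3] same_nz[OF o(4)] by simp
    then have "same_side a2 b3 v t" by (rule same_trans[OF o(4)])
    then show False using not_same_opp \<open>opp_side a2 b3 v t\<close> by blast
  next
    case d: True
    have db: "opp_side a2 d v b3" by (rule between_rays[OF o(2) d])
    show False
    proof (cases "same_side a2 d v c")
      \<comment> \<open>Around \<open>a2\<close> the order is \<open>v\<close>, \<open>d\<close>,
        \<open>c\<close>, \<open>b3\<close>. \<open>R\<close> meets \<open>a2d\<close> and passes
        behind \<open>c\<close>, while \<open>Q\<close> meets \<open>a2c\<close> and passes behind
        \<open>d\<close>: two chords cross.\<close>
      case False
      then have vc: "opp_side a2 d v c"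
        using opp_nz[OF db] n(1) same_or_opp by blast
      have "k \<noteq> a2" using k misses_ends[OF Q(2)] by auto
      then have "same_side a2 d c k" using same_towards'[OF k(2), of a2 d] n by simp
      then have "opp_side a2 d v k" by (rule opp_same_trans[OF vc])
      then obtain w where w: "w \<in> Q" "d \<in> closed_segment a2 w"
        using convex_set_wraps_around_end[of Q v a2 d q k] Q(1,2,4) q k by metis
      have sg: "same_side v a2 d c" "opp_side a2 c d b3"
        using between_rays'[OF o(2) d vc o(4)] by blast+
      have ra: "r \<noteq> a2" "s \<noteq> b3" using r s misses_ends[OF R(2)] by auto
      have "same_side a2 c d r" using same_towards'[OF r(2), of a2 c] opp_nz[OF sg(2)] ra by simp
      have y0: "det3 b3 c y = 0" using y(2) by (rule det3_on_segment)
      have "y \<noteq> a2" using y a2c by auto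
      have "y \<noteq> c"
      proof
        assume "y = c"
        then show False using det3_on_segment[OF y(1)] n(5) by simp
      qed
      then have "same_side a2 c b3 y"
        using same_towards[OF y(2), of a2 c] opp_nz[OF sg(2)] by simp
      moreover have "same_side a2 c b1 y"
      proof -
        have "det3 a2 c b1 \<noteq> 0"
        proof
          assume "det3 a2 c b1 = 0"
          then have "det3 a2 c y = 0" using y(1) by (auto simp: in_segment det3_affine)
          then show False using same_nz[OF \<open>same_side a2 c b3 y\<close>] by simp
        qed
        then show ?thesis using same_towards'[OF y(1), of a2 c] \<open>y \<noteq> a2\<close> by simp
      qed
      ultimately have "same_side a2 c b3 b1" using same_trans same_sym by blast
      then have "same_side a2 c b3 s" using same_segment[of s b3 b1] s by (simp add: closed_segment_commute)
      then have "opp_side a2 c r s"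
        using same_opp_trans[OF same_sym[OF \<open>same_side a2 c d r\<close>] opp_same_trans[OF sg(2)]] by blast
      then obtain z where z: "z \<in> closed_segment r s"
        "z \<in> closed_segment a2 c \<or> a2 \<in> closed_segment z c \<or> c \<in> closed_segment a2 z"
        using cross_line by metis
      have zR: "z \<in> R" using z(1) closed_segment_subset[OF r(1) s(1) R(1)] by blast
      have "a2 \<notin> closed_segment z c"
      proof
        assume a: "a2 \<in> closed_segment z c"
        have "same_side v a2 d r" using same_towards'[OF r(2), of v a2] same_nz[OF o(2)] ra by simp
        moreover have "same_side v a2 b1 s"
          using same_segment[OF s(2)] same_trans[OF o(3) same_sym[OF o(2)]] by blast
        ultimately have "same_side v a2 r s" using o(3) same_trans same_sym by meson
        then have "same_side v a2 r z" using z(1) same_segment by blast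
        then have "same_side v a2 c z"
          using same_trans[OF same_sym[OF sg(1)] same_trans[OF \<open>same_side v a2 d r\<close>]] by blast
        moreover have "a2 \<noteq> z" using zR misses_ends[OF R(2)] by auto
        then have "opp_side v a2 c z"
          using opp_through[of a2 c z v a2] a n(3) by (simp add: closed_segment_commute)
        ultimately show False using not_same_opp by blast
      qed
      moreover have "z \<notin> closed_segment a2 c" using zR missesD[OF R(4)] by blast
      ultimately have "c \<in> closed_segment a2 z" using z by blast
      then have "k \<in> closed_segment a2 z" using segment_mono[OF k(2)] by blast
      moreover have "r \<in> closed_segment a2 w" using segment_mono[OF r(2) w(2)] .
      ultimately have "closed_segment k w \<inter> closed_segment r z \<noteq> {}" by (rule pasch)
      then show False
        using closed_segment_subset[OF k(1) w(1) Q(1)] closed_segment_subset[OF r(1) zR R(1)] QR by blast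
    next
      case vc: True
      have "opp_side a2 d b3 c" using opp_same_trans[OF opp_sym[OF db] vc] .
      then obtain t where t: "t \<in> closed_segment b3 c" "det3 a2 d t = 0"
        "t \<in> closed_segment a2 d \<or> a2 \<in> closed_segment t d \<or> d \<in> closed_segment a2 t"
        using cross_line by metis
      have "t \<noteq> a2" using t a2c by auto
      show False
        using t(3)
      proof (elim disjE)
        assume "a2 \<in> closed_segment t d"
        then have "opp_side a2 b3 d t"
          using opp_through[of a2 d t a2 b3] nd \<open>t \<noteq> a2\<close> by (simp add: closed_segment_commute)
        moreover have "t \<noteq> b3" using opp_nz[OF \<open>opp_side a2 b3 d t\<close>] by auto
        then have "same_side a2 b3 c t" using same_towards'[OF t(1), of a2 b3] same_nz[OF o(4)] by simp
        ultimately show False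
          using same_trans[OF same_sym[OF d] same_trans[OF o(4)]] not_same_opp by blast
      next
        \<comment> \<open>\<open>R\<close> meets the triangle \<open>a2\<close>, \<open>b3\<close>,
          \<open>c\<close> in \<open>r\<close> and misses its sides, but \<open>s\<close> lies
          across \<open>b3c\<close>.\<close>
        assume "d \<in> closed_segment a2 t"
        then have "r \<in> closed_segment a2 t" using segment_mono[OF r(2)] by blast
        moreover have "t \<in> convex hull {a2, b3, c}"
          by (rule in_hull_segment[OF t(1) in_hull3(2) in_hull3(3)])
        ultimately have "r \<in> convex hull {a2, b3, c}"
          by (rule in_hull_segment[OF _ in_hull3(1)])
        then have "R \<subseteq> convex hull {a2, b3, c}"
          using convex_meets_side[of R a2 b3 c] R(1-3) misses_sym[OF R(4)] r(1) by blast
        moreover have "s \<notin> convex hull {a2, b3, c}"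
        proof -
          have "s \<noteq> b3" using s misses_ends[OF R(2)] by auto
          then have "same_side b3 c b1 s" using same_towards[OF s(2), of b3 c] opp_nz[OF o(5)] by simp
          then show ?thesis using outside_hull3[OF opp_same_trans[OF o(5)]] by blast
        qed
        ultimately show False using s by blast
      next
        \<comment> \<open>Now \<open>tc\<close> starts on the side \<open>a2d\<close> of the
          triangle. It avoids the two sides at \<open>u\<close>, and by \<open>bad\<close> it does
          not get back across the line \<open>a2d\<close>, so \<open>c\<close> would be
          inside.\<close>
        assume ta: "t \<in> closed_segment a2 d"
        have bad: False if "z \<in> closed_segment t c" "opp_side a2 d u z" for z
        proof -
          have "same_side a2 d v u" using same_towards[OF u(1), of a2 d] ne opp_nz[OF db] by simp
          then have "opp_side a2 d c z" using same_opp_trans[OF same_sym[OF vc] same_opp_trans] that(2) by blast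
          moreover have "z \<noteq> t" using opp_nz[OF \<open>opp_side a2 d c z\<close>] t by auto
          then have "same_side a2 d c z" using same_towards'[OF that(1) _ t(2)] n by simp
          ultimately show False using not_same_opp by blast
        qed
        have du: "det3 a2 d u \<noteq> 0"
          using same_nz[OF same_towards[OF u(1), of a2 d]] ne opp_nz[OF db] by simp
        have tc: "t \<in> closed_segment t c" "c \<in> closed_segment t c" by auto
        have ta': "t \<in> closed_segment d a2" using ta by (simp add: closed_segment_commute)
        have td: "misses (closed_segment t c) a2 u" "misses (closed_segment t c) u d"
          using dis[OF t(1)] .
        have "\<not> opp_side u a2 d c"
        proof
          assume "opp_side u a2 d c"
          then obtain z where z: "z \<in> closed_segment t c" "a2 \<in> closed_segment u z"
            using convex_set_wraps_around_end[OF _ misses_sym[OF td(2)] misses_sym[OF td(1)] tc(1) ta' tc(2)] by auto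
          have "z \<noteq> a2" using z t a2c segment_part[OF t(1), of c] by auto
          then have "opp_side a2 d u z" using opp_through[OF z(2), of a2 d] du by simp
          then show False using bad z by blast
        qed
        moreover have "\<not> opp_side u d a2 c"
        proof
          assume "opp_side u d a2 c"
          then obtain z where z: "z \<in> closed_segment t c" "d \<in> closed_segment u z"
            using convex_set_wraps_around_end[OF _ td tc(1) ta tc(2)] by auto
          have "z \<noteq> d" using z td missesD[OF td(2)] by auto
          then have "opp_side a2 d u z" using opp_through[OF z(2), of a2 d] du by simp
          then show False using bad z by blast
        qed
        moreover have "det3 u a2 c \<noteq> 0"
        proof
          assume "det3 u a2 c = 0"
          then obtain t where "c = (1 - t) *\<^sub>R u + t *\<^sub>R a2" using det3_eq_0_obtain ne(1) by metis
          then show False using n(3) u0 by (simp add: det3_affine)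
        qed
        moreover have "u \<noteq> d" using u0 du by auto
        have "det3 u d c \<noteq> 0"
        proof
          assume "det3 u d c = 0"
          then obtain t where "c = (1 - t) *\<^sub>R u + t *\<^sub>R d" using det3_eq_0_obtain \<open>u \<noteq> d\<close> by metis
          then show False using n(4) u0 by (simp add: det3_affine)
        qed
        moreover have "det3 u a2 d \<noteq> 0" "det3 u d a2 \<noteq> 0"
          using du by (simp_all add: det3_def algebra_simps)
        ultimately have "same_side u a2 d c" "same_side u d a2 c"
          using same_or_opp by blast+
        moreover have "same_side a2 d u c"
          using same_trans[OF same_sym[OF same_towards[OF u(1), of a2 d]] vc] ne opp_nz[OF db] by simp
        ultimately have "c \<in> convex hull {a2, u, d}"
          by (intro hull3_from_sides same_line_sym[of u a2] same_line_sym[of a2 d])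
        then show False using cT by blast
      qed
    qed
  qed
qed

subsection \<open>Visibility among at most three obstacles\<close>

lemma det3_scale:
  assumes "a \<in> closed_segment v p"
  obtains t where "0 \<le> t" "\<And>q. det3 v a q = t * det3 v p q" "t = 0 \<Longrightarrow> a = v"
proof -
  obtain t where t: "0 \<le> t" "t \<le> 1" "a = (1 - t) *\<^sub>R v + t *\<^sub>R p"
    using assms by (auto simp: in_segment)
  have "det3 v a q = t * det3 v p q" for q
    unfolding t(3) by (simp add: det3_def algebra_simps)
  with t that show thesis by auto
qed

lemma opp_extend:
  assumes "a \<in> closed_segment v p" "opp_side v a x y"
  shows "opp_side v p x y"
proof -
  obtain t where t: "0 \<le> t" "\<And>q. det3 v a q = t * det3 v p q"
    using det3_scale[OF assms(1)] by metis
  have "t * (t * (det3 v p x * det3 v p y)) < 0"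
    using assms(2) by (simp add: opp_side_def t(2) mult_ac)
  with t(1) show ?thesis by (auto simp: opp_side_def mult_less_0_iff)
qed

lemma same_beyond:
  assumes "a \<in> closed_segment v p" "det3 v c a \<noteq> 0"
  shows "same_side v c a p"
proof -
  obtain t where t: "0 \<le> t" "\<And>q. det3 v a q = t * det3 v p q"
    using det3_scale[OF assms(1)] by metis
  have e: "det3 v c a = t * det3 v c p"
    using t(2)[of c] by (simp add: det3_swap(1)[of v c])
  then have "t \<noteq> 0" "det3 v c p \<noteq> 0" using assms(2) by auto
  then show ?thesis using t(1) square_pos[of "det3 v c p"] by (simp add: same_side_def e mult.assoc)
qed

text \<open>\<open>p1\<close> and \<open>p3\<close> only prolong the rays through \<open>a1\<close>
  and \<open>a3\<close>, so membership in the triangle gives the angular position of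
  \<open>b\<close> between \<open>a1\<close> and \<open>a3\<close>.\<close>

lemma in_wedge_sides:
  assumes b: "b \<in> convex hull {v, p1, p3}" "b \<noteq> v"
    and p: "a1 \<in> closed_segment v p1" "a3 \<in> closed_segment v p3"
    and o: "det3 v a1 a3 \<noteq> 0"
  shows "det3 v a1 b \<noteq> 0 \<Longrightarrow> same_side v a1 a3 b" "det3 v a3 b \<noteq> 0 \<Longrightarrow> same_side v a3 a1 b"
    "same_side v c a1 a3 \<Longrightarrow> same_side v c a1 b"
proof -
  have *: "same_side v a a' b"
    if "a \<in> closed_segment v p" "a' \<in> closed_segment v p'" "b \<in> convex hull {v, p, p'}"
      "det3 v a b \<noteq> 0" "det3 v a a' \<noteq> 0" for a a' p p'
  proof (rule ccontr)
    assume "\<not> ?thesis"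
    then have "opp_side v a a' b" using same_or_opp that by blast
    then have "opp_side v a p' b" using same_opp_trans[OF same_sym[OF same_beyond[OF that(2,5)]]] by blast
    then have "opp_side v p p' b" using opp_extend that by blast
    then have "b \<notin> convex hull {p', v, p}" by (rule outside_hull3)
    moreover have "{p', v, p} = {v, p, p'}" by auto
    ultimately show False using that(3) by simp
  qed
  show "same_side v a1 a3 b" if "det3 v a1 b \<noteq> 0" using *[OF p b(1) that o] .
  show "same_side v a3 a1 b" if "det3 v a3 b \<noteq> 0"
    using *[OF p(2,1) _ that] b(1) o by (simp add: insert_commute det3_swap(1)[of v a3 a1])
  assume s: "same_side v c a1 a3"
  have 1: "same_side v c a1 p1" "same_side v c a3 p3" using same_beyond p same_nz[OF s] by blast+
  obtain w where w: "w \<in> closed_segment p1 p3" "b \<in> closed_segment v w" using hull3_cevian b(1) .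
  have "same_side v c p1 p3" using 1 s same_trans same_sym by meson
  then have "same_side v c p1 w" using same_segment w by blast
  then have "same_side v c w b" using same_towards'[OF w(2) b(2), of v c] same_nz by simp
  then show "same_side v c a1 b" using 1 \<open>same_side v c p1 w\<close> same_trans by meson
qed

text \<open>\<open>X\<close> holds the vertex points. \<open>card_obs\<close> is the assumption to
  be refuted, so the facts of this locale describe a hypothetical drawing.\<close>

locale visibility =
  fixes X :: "(real^2) set" and Obs :: "(real^2) set set"
  assumes general: "\<And>x y z. x \<in> X \<Longrightarrow> y \<in> X \<Longrightarrow> z \<in> X \<Longrightarrow> x \<noteq> y \<Longrightarrow> x \<noteq> z \<Longrightarrow> y \<noteq> z \<Longrightarrow> det3 x y z \<noteq> 0"
    and convex_obs: "\<And>K. K \<in> Obs \<Longrightarrow> convex K"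
    and disjoint_obs: "\<And>K L. K \<in> Obs \<Longrightarrow> L \<in> Obs \<Longrightarrow> K \<noteq> L \<Longrightarrow> K \<inter> L = {}"
    and finite_obs: "finite Obs"
    and card_obs: "card Obs \<le> 3"
begin

definition sees :: "real^2 \<Rightarrow> real^2 \<Rightarrow> bool" where
  "sees x y \<longleftrightarrow> (\<forall>K\<in>Obs. misses K x y)"

lemma sees_sym: "sees x y \<Longrightarrow> sees y x"
  by (auto simp: sees_def misses_sym)

lemma seesD: "sees x y \<Longrightarrow> K \<in> Obs \<Longrightarrow> misses K x y"
  by (simp add: sees_def)

lemma not_seesE:
  assumes "\<not> sees x y"
  obtains K where "K \<in> Obs" "\<not> misses K x y"
  using assms by (auto simp: sees_def)

lemma sees_refl: "sees x y \<Longrightarrow> sees x x"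
  by (auto simp: sees_def misses_def)

lemma crossing_opp:
  assumes "{a, b, c, d} \<subseteq> X" "distinct [a, b, c, d]"
    and "x \<in> closed_segment a b" "x \<in> closed_segment c d"
  shows "opp_side a b c d"
proof -
  have n: "det3 a b c \<noteq> 0" "det3 a b d \<noteq> 0" using general assms by auto
  have "det3 a b x = 0" using assms det3_on_segment by blast
  moreover from this have "x \<noteq> d" using n by auto
  ultimately show ?thesis using opp_through[OF assms(4), of a b] n by simp
qed

text \<open>For the crossing edges \<open>ab\<close> and \<open>cd\<close>, two of the other sides
  are adjacent to \<open>ac\<close> and one is opposite to it.\<close>

lemma crossing_sides:
  assumes "{a, b, c, d} \<subseteq> X" "distinct [a, b, c, d]" "sees a b" "sees c d"
    and x: "closed_segment a b \<inter> closed_segment c d \<noteq> {}"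
    and K: "K \<in> Obs" "\<not> misses K a c"
  shows "misses K c b" "misses K b d" "misses K d a"
proof -
  obtain x where x: "x \<in> closed_segment a b" "x \<in> closed_segment c d" using x by blast
  have o: "opp_side a b c d" using crossing_opp assms x by blast
  have m: "misses K a b" "misses K c d" "convex K" using assms seesD convex_obs by blast+
  obtain p where p: "p \<in> K" "p \<in> closed_segment a c" using K(2) by (auto simp: misses_def)
  show "misses K c b"
    unfolding misses_def using crossing_adjacent_sides[OF m(3,2) x p] by blast
  show "misses K b d"
    unfolding misses_def using crossing_opposite_sides[OF m(3,1,2) x o p] by blast
  have "misses K a d"
    unfolding misses_def
    using crossing_adjacent_sides[OF m(3,1) x(2,1) p(1)] p(2) by (auto simp: closed_segment_commute)
  then show "misses K d a" by (rule misses_sym)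
qed

text \<open>Four blocked sides need pairwise different obstacles, one more than there are.\<close>

lemma nonadjacent_edges_disjoint:
  assumes X: "{a, b, c, d} \<subseteq> X" "distinct [a, b, c, d]" and e: "sees a b" "sees c d"
    and n: "\<not> sees a c" "\<not> sees c b" "\<not> sees b d" "\<not> sees d a"
  shows "closed_segment a b \<inter> closed_segment c d = {}"
proof (rule ccontr)
  assume x: "closed_segment a b \<inter> closed_segment c d \<noteq> {}"
  obtain K1 where K1: "K1 \<in> Obs" "\<not> misses K1 a c" using n not_seesE by metis
  obtain K2 where K2: "K2 \<in> Obs" "\<not> misses K2 c b" using n not_seesE by metis
  obtain K3 where K3: "K3 \<in> Obs" "\<not> misses K3 b d" using n not_seesE by metis
  obtain K4 where K4: "K4 \<in> Obs" "\<not> misses K4 d a" using n not_seesE by metis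
  have 1: "misses K1 c b" "misses K1 b d" "misses K1 d a"
    using crossing_sides[OF X e x K1] .
  have "misses K2 b d" "misses K2 d a"
    using crossing_sides[of c d b a K2] X e x K2 sees_sym by (auto simp: closed_segment_commute Int_commute)
  moreover have "misses K3 d a"
    using crossing_sides[of b a d c K3] X e x K3 sees_sym by (auto simp: closed_segment_commute Int_commute)
  ultimately have "distinct [K1, K2, K3, K4]" using 1 K1 K2 K3 K4 by auto
  then have "card {K1, K2, K3, K4} = 4" using distinct_card by fastforce
  moreover have "card {K1, K2, K3, K4} \<le> card Obs"
    using K1 K2 K3 K4 finite_obs by (intro card_mono) auto
  ultimately show False using card_obs by simp
qed

text \<open>Three blocked sides have three different blockers, which therefore exhaust
  \<open>Obs\<close>. This is how a crossing assigns roles to the obstacles.\<close>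

lemma crossing_obstacles:
  assumes X: "{a, b, c, d} \<subseteq> X" "distinct [a, b, c, d]" and e: "sees a b" "sees c d"
    and x: "closed_segment a b \<inter> closed_segment c d \<noteq> {}"
    and K1: "K1 \<in> Obs" "\<not> misses K1 c b" and K2: "K2 \<in> Obs" "\<not> misses K2 b d"
    and K3: "K3 \<in> Obs" "\<not> misses K3 d a"
  shows "Obs = {K1, K2, K3} \<and> distinct [K1, K2, K3]"
    "misses K1 b d" "misses K1 d a" "misses K2 c b" "misses K2 d a" "misses K3 c b" "misses K3 b d"
    "misses K1 a c" "misses K2 a c" "misses K3 a c"
proof -
  show 1: "misses K1 b d" "misses K1 d a" "misses K1 a c"
    using crossing_sides[of c d b a K1] X e x K1 sees_sym by (auto simp: closed_segment_commute Int_commute)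
  show 2: "misses K2 d a" "misses K2 c b" "misses K2 a c"
    using crossing_sides[of b a d c K2] X e x K2 sees_sym misses_sym by (auto simp: closed_segment_commute Int_commute)
  show 3: "misses K3 a c" "misses K3 c b" "misses K3 b d"
    using crossing_sides[of d c a b K3] X e x K3 sees_sym misses_sym by (auto simp: closed_segment_commute Int_commute)
  have d: "distinct [K1, K2, K3]" using 1 2 3 K1 K2 K3 by auto
  then have "card {K1, K2, K3} = 3" by auto
  then have "{K1, K2, K3} = Obs"
    using card_obs finite_obs K1 K2 K3 by (intro card_seteq) auto
  with d show "Obs = {K1, K2, K3} \<and> distinct [K1, K2, K3]" by blast
qed

end

subsection \<open>Homogeneous spiders\<close>

lemma obtain_sorted_enumeration:
  fixes key :: "'a \<Rightarrow> 'b::linorder"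
  assumes "finite J" "inj_on key J"
  obtains g where "\<And>x. x < card J \<Longrightarrow> g x \<in> J"
    "\<And>x y. x < y \<Longrightarrow> y < card J \<Longrightarrow> key (g x) < key (g y)"
proof -
  define ks where "ks = sorted_list_of_set (key ` J)"
  have len: "length ks = card J" using assms by (simp add: ks_def card_image)
  have set: "set ks = key ` J" using assms by (simp add: ks_def)
  have ks: "sorted_wrt (<) ks" by (simp add: ks_def)
  define g where "g x = inv_into J key (ks ! x)" for x
  have "ks ! x \<in> key ` J" if "x < card J" for x using that len set by (metis nth_mem)
  then have "g x \<in> J" "key (g x) = ks ! x" if "x < card J" for x
    using that by (simp_all add: g_def inv_into_into f_inv_into_f)
  moreover have "ks ! x < ks ! y" if "x < y" "y < card J" for x y
    using sorted_wrt_nth_less[OF ks] that len by simp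
  ultimately show thesis using that[of g] by simp
qed

text \<open>The palette \<open>S\<close> is quantified after \<open>N\<close> and only its size is
  bounded: the obstacles that serve as colours depend on the drawing, while \<open>N\<close> fixes
  the tree beforehand.\<close>

lemma ramsey_pairs:
  fixes n q :: nat
  shows
  "\<exists>N. \<forall>(col :: nat \<Rightarrow> nat \<Rightarrow> 'c) S. finite S \<and> card S \<le> q \<and>
      (\<forall>x y. x < y \<and> y < N \<longrightarrow> col x y \<in> S) \<longrightarrow>
      (\<exists>h c. (\<forall>x<n. h x < N) \<and> (\<forall>x y. x < y \<and> y < n \<longrightarrow> h x < h y) \<and>
        (\<forall>x y. x < y \<and> y < n \<longrightarrow> col (h x) (h y) = c))"
proof -
  obtain N :: nat where N: "partn_lst {..<N} (replicate q n) 2"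
    using ramsey_full by blast
  show ?thesis
  proof (intro exI[of _ N] allI impI)
    fix col :: "nat \<Rightarrow> nat \<Rightarrow> 'c" and S
    assume "finite S \<and> card S \<le> q \<and> (\<forall>x y. x < y \<and> y < N \<longrightarrow> col x y \<in> S)"
    then have S: "finite S" "card S \<le> q" and col: "\<And>x y. x < y \<Longrightarrow> y < N \<Longrightarrow> col x y \<in> S"
      by blast+
    obtain e where e: "inj_on e S" "e ` S \<subseteq> {..<q}"
    proof -
      obtain e where "bij_betw e S {0..<card S}" using S ex_bij_betw_finite_nat by blast
      moreover have "{0..<card S} \<subseteq> {..<q}" using S by auto
      ultimately show thesis using that[of e] by (simp add: bij_betw_def)
    qed
    define f where "f A = e (col (Min A) (Max A))" for A
    have f2: "f {x, y} = e (col x y)" if "x < y" for x y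
      using that by (simp add: f_def)
    have "f \<in> nsets {..<N} 2 \<rightarrow> {..<q}"
    proof
      fix A assume "A \<in> nsets {..<N} 2"
      then obtain x y where A: "A = {x, y}" "x < y" "y < N"
        by (auto simp: nsets_def card_2_iff) (metis insert_commute linorder_neqE_nat)
      then show "f A \<in> {..<q}" using f2 col e by blast
    qed
    then obtain i where i: "i < q" "monochromatic {..<N} n 2 f i"
      using N by (auto simp: partn_lst_def)
    then obtain H where H: "H \<subseteq> {..<N}" "finite H" "card H = n" "f ` nsets H 2 \<subseteq> {i}"
      by (auto simp: monochromatic_def nsets_def)
    obtain h where h: "\<And>x. x < n \<Longrightarrow> h x \<in> H" "\<And>x y. x < y \<Longrightarrow> y < n \<Longrightarrow> h x < h y"
      using obtain_sorted_enumeration[of H "\<lambda>x. x"] H by (metis inj_on_id2)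
    have hi: "e (col (h x) (h y)) = i" if "x < y" "y < n" for x y
    proof -
      have "{h x, h y} \<in> nsets H 2"
        using h that by (auto simp: nsets_def card_2_iff) (metis less_irrefl)
      then have "f {h x, h y} = i" using H by blast
      then show ?thesis using f2 h that by simp
    qed
    have "\<exists>c. \<forall>x y. x < y \<and> y < n \<longrightarrow> col (h x) (h y) = c"
    proof -
      have "col (h x) (h y) = inv_into S e i" if "x < y" "y < n" for x y
        using hi[OF that] e(1) col[of "h x" "h y"] h that H by (metis inv_into_f_f lessThan_iff subsetD)
      then show ?thesis by blast
    qed
    moreover have "\<forall>x<n. h x < N" using h H by blast
    ultimately show "\<exists>h c. (\<forall>x<n. h x < N) \<and> (\<forall>x y. x < y \<and> y < n \<longrightarrow> h x < h y) \<and>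
        (\<forall>x y. x < y \<and> y < n \<longrightarrow> col (h x) (h y) = c)"
      using h by blast
  qed
qed

text \<open>The key is minus the cotangent of the angle at \<open>v\<close> from \<open>e\<close>,
  measured in the direction \<open>\<sigma>\<close>; it increases with the angle on an open
  half-plane. This turns angular order into a linear order of reals.\<close>

lemma angular_key:
  assumes "0 < \<sigma> * det3 v e p" "0 < \<sigma> * det3 v e q" "\<sigma> * \<sigma> = 1"
  shows "- ((p - v) \<bullet> (e - v)) / (\<sigma> * det3 v e p) < - ((q - v) \<bullet> (e - v)) / (\<sigma> * det3 v e q)
    \<longleftrightarrow> 0 < \<sigma> * det3 v p q"
proof -
  define P where "P = \<sigma> * det3 v e p"
  define Q where "Q = \<sigma> * det3 v e q"
  have pos: "0 < P" "0 < Q" using assms by (simp_all add: P_def Q_def)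
  have "v \<noteq> e" using assms by auto
  then have ne: "0 < (e - v) \<bullet> (e - v)" by simp
  have "((p - v) \<bullet> (e - v)) * Q - ((q - v) \<bullet> (e - v)) * P = ((e - v) \<bullet> (e - v)) * (\<sigma> * det3 v p q)"
    by (simp add: P_def Q_def inner_vec_def sum_2 det3_def algebra_simps)
  moreover have "- ((p - v) \<bullet> (e - v)) / P < - ((q - v) \<bullet> (e - v)) / Q
      \<longleftrightarrow> 0 < ((p - v) \<bullet> (e - v)) * Q - ((q - v) \<bullet> (e - v)) * P"
    using pos by (simp add: divide_simps mult.commute)
  ultimately show ?thesis
    using ne unfolding P_def[symmetric] Q_def[symmetric] by (simp add: zero_less_mult_iff)
qed

text \<open>Instantiated at two levels: with the root of the tree and nine selected feet per child,
  and with each child of the root and one leaf per foot.\<close>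

locale spider = visibility +
  fixes v :: "real^2" and a :: "nat \<Rightarrow> real^2" and b :: "nat \<Rightarrow> nat \<Rightarrow> real^2" and N m :: nat
  assumes m_pos: "0 < m"
    and X: "v \<in> X" "\<And>i. i < N \<Longrightarrow> a i \<in> X" "\<And>i k. i < N \<Longrightarrow> k < m \<Longrightarrow> b i k \<in> X"
    and va: "\<And>i. i < N \<Longrightarrow> sees v (a i)"
    and ab: "\<And>i k. i < N \<Longrightarrow> k < m \<Longrightarrow> sees (a i) (b i k)"
    and vb: "\<And>i k. i < N \<Longrightarrow> k < m \<Longrightarrow> \<not> sees v (b i k)"
    and aa: "\<And>i j. i < N \<Longrightarrow> j < N \<Longrightarrow> i \<noteq> j \<Longrightarrow> \<not> sees (a i) (a j)"
    and aib: "\<And>i j k. i < N \<Longrightarrow> j < N \<Longrightarrow> i \<noteq> j \<Longrightarrow> k < m \<Longrightarrow> \<not> sees (a i) (b j k)"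
begin

text \<open>Distinctness is not assumed but read off from visibility: equal points would see the
  same points.\<close>

lemma vne: "i < N \<Longrightarrow> v \<noteq> a i"
  using ab[of i 0] vb[of i 0] m_pos by auto

lemma ane: "i < N \<Longrightarrow> j < N \<Longrightarrow> i \<noteq> j \<Longrightarrow> a i \<noteq> a j"
  using aa va sees_refl sees_sym by metis

lemma vbne: "i < N \<Longrightarrow> k < m \<Longrightarrow> v \<noteq> b i k"
  using vb va sees_refl by metis

lemma abne: "i < N \<Longrightarrow> j < N \<Longrightarrow> k < m \<Longrightarrow> a i \<noteq> b j k"
  using va vb by metis

lemma det3_root_children: "i < N \<Longrightarrow> j < N \<Longrightarrow> i \<noteq> j \<Longrightarrow> det3 v (a i) (a j) \<noteq> 0"
  by (intro general X vne ane)

lemma det3_root_child_foot: "i < N \<Longrightarrow> j < N \<Longrightarrow> k < m \<Longrightarrow> det3 v (a i) (b j k) \<noteq> 0"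
  by (intro general X vne vbne abne)

text \<open>At most four legs can stay uncrossed: two legs whose feet are hidden from \<open>v\<close> by the same
  obstacle on the same side contradict \<open>opposite_legs\<close>.\<close>
lemma uncrossed_spider_small:
  fixes f :: "nat \<Rightarrow> nat"
  assumes f: "\<And>x. x < 9 \<Longrightarrow> f x < N" and e: "e < N" and k: "k < m" and P: "P \<in> Obs"
    and sgn: "\<sigma> * \<sigma> = 1"
    and half: "\<And>x. x < 9 \<Longrightarrow> 0 < \<sigma> * det3 v (a e) (a (f x))"
    and ord: "\<And>x y. x < y \<Longrightarrow> y < 9 \<Longrightarrow> 0 < \<sigma> * det3 v (a (f x)) (a (f y))"
    and blk: "\<And>x y. x < y \<Longrightarrow> y < 9 \<Longrightarrow> \<not> misses P (a (f x)) (a (f y))"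
    and L: "\<And>x y. x < y \<Longrightarrow> y < 9 \<Longrightarrow> closed_segment (a (f y)) (b (f y) k) \<inter> closed_segment v (a (f x)) = {}"
    and R: "\<And>x y. x < y \<Longrightarrow> y < 9 \<Longrightarrow> closed_segment (a (f x)) (b (f x) k) \<inter> closed_segment v (a (f y)) = {}"
  shows False
proof -
  define A where "A x = a (f x)" for x
  define B where "B x = b (f x) k" for x
  have sg: "same_side v x y z \<longleftrightarrow> 0 < (\<sigma> * det3 v x y) * (\<sigma> * det3 v x z)"
    "opp_side v x y z \<longleftrightarrow> (\<sigma> * det3 v x y) * (\<sigma> * det3 v x z) < 0" for x y z
  proof -
    have "(\<sigma> * det3 v x y) * (\<sigma> * det3 v x z) = (\<sigma> * \<sigma>) * (det3 v x y * det3 v x z)"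
      by (simp only: mult_ac)
    then show "same_side v x y z \<longleftrightarrow> 0 < (\<sigma> * det3 v x y) * (\<sigma> * det3 v x z)"
      "opp_side v x y z \<longleftrightarrow> (\<sigma> * det3 v x y) * (\<sigma> * det3 v x z) < 0"
      using sgn by (simp_all only: same_side_def opp_side_def mult_1)
  qed
  have nP: "convex P" "misses P v (A x)" "misses P (A x) (B x)" if "x < 9" for x
    using that f k P convex_obs seesD va ab by (auto simp: A_def B_def)
  have sw: "\<sigma> * det3 v (A y) (A x) < 0" if "x < y" "y < 9" for x y
    using ord[OF that] by (simp add: A_def det3_swap(1)[of v "a (f y)"])
  have opp3: "opp_side v (A y) (A x) (A z)" if "x < y" "y < z" "z < 9" for x y z
    unfolding sg using sw[of x y] ord[of y z] that by (simp add: A_def mult_neg_pos)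
  have "\<exists>p\<in>P. A y \<in> closed_segment v p" if y: "0 < y" "y < 8" for y
  proof -
    have "\<not> misses P (A 0) (A y)" "\<not> misses P (A y) (A 8)" using blk y by (auto simp: A_def)
    then obtain p12 p23 where "p12 \<in> P" "p12 \<in> closed_segment (A 0) (A y)"
      "p23 \<in> P" "p23 \<in> closed_segment (A y) (A 8)" by (auto simp: misses_def)
    moreover have "opp_side v (A y) (A 0) (A 8)" using opp3 y by simp
    moreover have "misses P v (A 0)" "misses P v (A y)" using nP y by simp_all
    moreover have "convex P" using nP[of 0] by simp
    ultimately show ?thesis using star_beyond by metis
  qed
  then obtain p where p: "\<And>y. 0 < y \<Longrightarrow> y < 8 \<Longrightarrow> p y \<in> P" "\<And>y. 0 < y \<Longrightarrow> y < 8 \<Longrightarrow> A y \<in> closed_segment v (p y)"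
    by metis
  have foot: "misses P v (B y)" "0 < \<sigma> * det3 v (A x) (B y)" "\<sigma> * det3 v (A z) (B y) < 0"
    "0 < \<sigma> * det3 v (a e) (B y)"
    if xyz: "0 < x" "x < y" "y < z" "z < 8" for x y z
  proof -
    obtain p12 p23 where p12: "p12 \<in> P" "p12 \<in> closed_segment (A x) (A y)"
      and p23: "p23 \<in> P" "p23 \<in> closed_segment (A y) (A z)"
      using blk[of x y] blk[of y z] xyz by (auto simp: misses_def A_def)
    have s1: "same_side v (A x) (A y) (A z)" unfolding sg using ord[of x y] ord[of x z] xyz by (simp add: A_def)
    have s2: "same_side v (A z) (A x) (A y)"
      unfolding sg using sw[of x z] sw[of y z] xyz by (simp add: mult_neg_neg)
    have nc: "closed_segment (A y) (B y) \<inter> closed_segment v (A x) = {}"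
      "closed_segment (A y) (B y) \<inter> closed_segment v (A z) = {}"
      using L[of x y] R[of y z] xyz by (simp_all add: A_def B_def)
    have px: "p x \<in> P" "A x \<in> closed_segment v (p x)" "p z \<in> P" "A z \<in> closed_segment v (p z)"
      using p xyz by simp_all
    have yP: "misses P v (A y)" "misses P (A y) (B y)" using nP[of y] xyz by simp_all
    have "opp_side v (A y) (A x) (A z)" using opp3 xyz by simp
    note leg = uncrossed_leg[OF nP(1) yP px p12 p23 s1 s2 this nc, of 0]
    have hull: "B y \<in> convex hull {v, p x, p z}" using leg(1) by simp
    show "misses P v (B y)" using leg(2) by simp
    have fN: "f x < N" "f y < N" "f z < N" using f xyz by simp_all
    have bv: "B y \<noteq> v" using vbne[OF fN(2) k] by (auto simp: B_def)
    have n0: "det3 v (A x) (A z) \<noteq> 0" using same_nz[OF s1] by simp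
    note sides = in_wedge_sides[OF hull bv px(2,4) n0]
    have "same_side v (A x) (A z) (B y)" using sides(1) det3_root_child_foot[OF fN(1,2) k] by (simp add: A_def B_def)
    then show "0 < \<sigma> * det3 v (A x) (B y)"
      unfolding sg using ord[of x z] xyz zero_less_mult_pos by (auto simp: A_def)
    have "same_side v (A z) (A x) (B y)" using sides(2) det3_root_child_foot[OF fN(3,2) k] by (simp add: A_def B_def)
    then show "\<sigma> * det3 v (A z) (B y) < 0"
      unfolding sg
      using sw[of x z] xyz zero_less_mult_pos[of "- (\<sigma> * det3 v (A z) (A x))" "- (\<sigma> * det3 v (A z) (B y))"] by simp
    have "same_side v (a e) (A x) (A z)" unfolding sg using half[of x] half[of z] xyz by (simp add: A_def)
    then have "same_side v (a e) (A x) (B y)" using sides(3) by blast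
    then show "0 < \<sigma> * det3 v (a e) (B y)"
      unfolding sg using half[of x] xyz zero_less_mult_pos by (auto simp: A_def)
  qed
  have "\<exists>K\<in>Obs - {P}. \<not> misses K v (B y)" if "y \<in> {2..6}" for y
  proof -
    have "\<not> sees v (B y)" using vb f k that by (simp add: B_def)
    then obtain K where "K \<in> Obs" "\<not> misses K v (B y)" by (rule not_seesE)
    moreover have "misses P v (B y)" using foot(1)[of 1 y 7] that by simp
    ultimately show ?thesis by blast
  qed
  then obtain K where K: "\<And>y. y \<in> {2..6} \<Longrightarrow> K y \<in> Obs - {P}" "\<And>y. y \<in> {2..6} \<Longrightarrow> \<not> misses (K y) v (B y)"
    by metis
  \<comment> \<open>Of the indices 0 to 8, obtaining \<open>p\<close> and then \<open>foot\<close>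
    each costs one index at either end, which leaves five. Two obstacles other than \<open>P\<close>
    and two sides make four colours.\<close>
  define c where "c y = (K y, 0 < \<sigma> * det3 v (A y) (B y))" for y
  have "card ((Obs - {P}) \<times> (UNIV :: bool set)) \<le> 4"
    using card_obs finite_obs P by (simp add: card_cartesian_product)
  moreover have "c ` {2..6} \<subseteq> (Obs - {P}) \<times> UNIV" using K(1) unfolding c_def by blast
  ultimately have "card (c ` {2..6}) \<le> 4"
    using card_mono[of "(Obs - {P}) \<times> (UNIV :: bool set)" "c ` {2..6}"] finite_obs by simp
  then have "\<not> inj_on c {2..6::nat}" using card_image[of c "{2..6::nat}"] by auto
  then obtain i j where ij: "i \<in> {2..6}" "j \<in> {2..6}" "i < j" "c i = c j"
    unfolding inj_on_def by (metis linorder_neqE_nat)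
  have Kij: "K i = K j" "0 < \<sigma> * det3 v (A i) (B i) \<longleftrightarrow> 0 < \<sigma> * det3 v (A j) (B j)"
    using ij by (simp_all add: c_def)
  have KO: "K j \<in> Obs" using K ij by blast
  have KA: "misses (K j) v (A x)" "misses (K j) (A x) (B x)" if "x < 9" for x
    using that f k KO seesD va ab by (auto simp: A_def B_def)
  obtain q q' where q: "q \<in> K j" "q \<in> closed_segment v (B i)" "q' \<in> K j" "q' \<in> closed_segment v (B j)"
    using K(2)[of i] K(2)[of j] ij Kij by (auto simp: misses_def)
  have hi: "0 < \<sigma> * det3 v (a e) (B i)" and hj: "0 < \<sigma> * det3 v (a e) (B j)"
    using foot(4)[of 1 i 7] foot(4)[of 1 j 7] ij by simp_all
  have eh: "0 < \<sigma> * det3 v (a e) (A x)" if "x < 9" for x using half that by (simp add: A_def)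
  show False
  \<comment> \<open>If both feet lie past their own child in the angular order, the line through
    \<open>v\<close> and \<open>A j\<close> separates them, because \<open>B i\<close> comes before
    \<open>A j\<close>. If both lie before it, the line through \<open>v\<close> and
    \<open>A i\<close> does.\<close>
  proof (cases "0 < \<sigma> * det3 v (A j) (B j)")
    case True
    have "\<sigma> * det3 v (A j) (B i) < 0" using foot(3)[of 1 i j] ij by simp
    then have "opp_side v (A j) (B j) (B i)" unfolding sg using True by (simp add: mult_pos_neg)
    moreover have "same_side v (a e) (B j) (B i)" "same_side v (a e) (B j) (A j)"
      unfolding sg using hi hj eh[of j] ij by simp_all
    ultimately show False
      using opposite_legs[OF convex_obs[OF KO] KA(1) KA(2) q(3,4,1,2)] ij by simp
  next
    case False
    have "\<sigma> * det3 v (A i) (B i) \<noteq> 0"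
      using det3_root_child_foot[of "f i" "f i" k] f k ij sgn by (auto simp: A_def B_def)
    then have "\<sigma> * det3 v (A i) (B i) < 0" using False Kij(2) by linarith
    moreover have "0 < \<sigma> * det3 v (A i) (B j)" using foot(2)[of i j 7] ij by simp
    ultimately have "opp_side v (A i) (B i) (B j)" unfolding sg by (simp add: mult_neg_pos)
    moreover have "same_side v (a e) (B i) (B j)" "same_side v (a e) (B i) (A i)"
      unfolding sg using hi hj eh[of i] ij by simp_all
    ultimately show False
      using opposite_legs[OF convex_obs[OF KO] KA(1) KA(2) q] ij by simp
  qed
qed

end

context spider
begin

text \<open>The line through \<open>v\<close> and child 0 distributes the other \<open>2 * M\<close>
  children over two sides; the fuller side is sorted by \<open>angular_key\<close>.\<close>

lemma half_plane_enumeration: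
  assumes N: "N = 2 * M + 1"
  obtains \<sigma> g where "\<sigma> * \<sigma> = (1::real)" "\<And>x. x < M \<Longrightarrow> g x < N"
    "\<And>x. x < M \<Longrightarrow> 0 < \<sigma> * det3 v (a 0) (a (g x))"
    "\<And>x y. x < y \<Longrightarrow> y < M \<Longrightarrow> 0 < \<sigma> * det3 v (a (g x)) (a (g y))"
proof -
  define J where "J \<sigma> = {i\<in>{1..<N}. 0 < \<sigma> * det3 v (a 0) (a i)}" for \<sigma> :: real
  have "i \<in> J 1 \<union> J (-1)" if "i \<in> {1..<N}" for i
    using det3_root_children[of 0 i] that by (simp add: J_def) linarith
  moreover have "J \<sigma> \<subseteq> {1..<N}" for \<sigma> by (auto simp: J_def)
  ultimately have "{1..<N} = J 1 \<union> J (-1)" by blast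
  then have "2 * M \<le> card (J 1) + card (J (-1))"
    using card_Un_le[of "J 1" "J (-1)"] N by (metis add_diff_cancel_right' card_atLeastLessThan)
  then have "M \<le> card (J 1) \<or> M \<le> card (J (-1))" by linarith
  then obtain \<sigma> where \<sigma>: "\<sigma> = 1 \<or> \<sigma> = -1" "M \<le> card (J \<sigma>)" by blast
  then have s: "\<sigma> * \<sigma> = 1" by auto
  define key where "key i = - ((a i - v) \<bullet> (a 0 - v)) / (\<sigma> * det3 v (a 0) (a i))" for i
  have key: "key i < key j \<longleftrightarrow> 0 < \<sigma> * det3 v (a i) (a j)" if "i \<in> J \<sigma>" "j \<in> J \<sigma>" for i j
    using angular_key[of \<sigma> v "a 0" "a i" "a j"] that s by (simp add: key_def J_def)
  have "inj_on key (J \<sigma>)"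
  proof (rule inj_onI, rule ccontr)
    fix i j assume ij: "i \<in> J \<sigma>" "j \<in> J \<sigma>" "key i = key j" "i \<noteq> j"
    then have "\<sigma> * det3 v (a i) (a j) \<noteq> 0" using det3_root_children[of i j] s by (auto simp: J_def)
    moreover have "\<sigma> * det3 v (a j) (a i) = - (\<sigma> * det3 v (a i) (a j))"
      by (simp add: det3_swap(1)[of v "a j"])
    ultimately show False using key[of i j] key[of j i] ij by linarith
  qed
  moreover have "finite (J \<sigma>)" by (simp add: J_def)
  ultimately obtain g where g: "\<And>x. x < card (J \<sigma>) \<Longrightarrow> g x \<in> J \<sigma>"
    "\<And>x y. x < y \<Longrightarrow> y < card (J \<sigma>) \<Longrightarrow> key (g x) < key (g y)"
    using obtain_sorted_enumeration by metis
  have gJ: "g x \<in> J \<sigma>" if "x < M" for x using g(1) that \<sigma>(2) by simp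
  show thesis
  proof (rule that[OF s])
    fix x y assume "x < y" "y < M"
    then show "0 < \<sigma> * det3 v (a (g x)) (a (g y))"
      using key[OF gJ gJ, of x y] g(2)[of x y] \<sigma>(2) by simp
  qed (use gJ in \<open>auto simp: J_def\<close>)
qed

end

text \<open>\<open>\<sigma>\<close> is 1 or -1 and records the sense of rotation, so that reversing
  the enumeration only changes its sign. Crossings are required in one direction only, of the leg of
  a later child with the edge to an earlier one.\<close>

definition fan :: "(real^2) set \<Rightarrow> real \<Rightarrow> nat \<Rightarrow> real^2 \<Rightarrow> (nat \<Rightarrow> real^2) \<Rightarrow> (nat \<Rightarrow> nat \<Rightarrow> real^2) \<Rightarrow> nat set \<Rightarrow> bool" where
  "fan P \<sigma> n v a b K \<longleftrightarrow> \<sigma> * \<sigma> = 1 \<and>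
     (\<forall>x y. x < y \<and> y < n \<longrightarrow> 0 < \<sigma> * det3 v (a x) (a y) \<and> \<not> misses P (a x) (a y) \<and>
       (\<forall>k\<in>K. closed_segment (a y) (b y k) \<inter> closed_segment v (a x) \<noteq> {}))"

lemma fanD:
  assumes "fan P \<sigma> n v a b K"
  shows "\<sigma> * \<sigma> = 1" "x < y \<Longrightarrow> y < n \<Longrightarrow> 0 < \<sigma> * det3 v (a x) (a y)"
    "x < y \<Longrightarrow> y < n \<Longrightarrow> \<not> misses P (a x) (a y)"
    "k \<in> K \<Longrightarrow> x < y \<Longrightarrow> y < n \<Longrightarrow> closed_segment (a y) (b y k) \<inter> closed_segment v (a x) \<noteq> {}"
  using assms by (simp_all add: fan_def)

text \<open>A pair of children is coloured by a blocking obstacle and the two sets of leg indices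
  that cross in one direction or the other. On a homogeneous subset
  \<open>uncrossed_spider_small\<close> excludes an index in neither set, so one of the sets
  contains half of all indices.\<close>

lemma spider_homogeneous:
  fixes n m :: nat
  shows "\<exists>N. \<forall>X Obs v a b. spider X Obs v a b N m \<longrightarrow>
    (\<exists>P\<in>Obs. \<exists>f \<sigma> K. (\<forall>x<n. f x < N) \<and> K \<subseteq> {..<m} \<and> m \<le> 2 * card K \<and>
      fan P \<sigma> n v (\<lambda>x. a (f x)) (\<lambda>x. b (f x)) K)"
proof -
  \<comment> \<open>Large enough both for the fan and for the nine children that
    \<open>uncrossed_spider_small\<close> needs.\<close>
  define n' where "n' = n + 9"
  obtain M where M: "\<forall>(col :: nat \<Rightarrow> nat \<Rightarrow> (real^2) set \<times> nat set \<times> nat set) S.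
      finite S \<and> card S \<le> 3 * (2 ^ m * 2 ^ m) \<and> (\<forall>x y. x < y \<and> y < M \<longrightarrow> col x y \<in> S) \<longrightarrow>
      (\<exists>h c. (\<forall>x<n'. h x < M) \<and> (\<forall>x y. x < y \<and> y < n' \<longrightarrow> h x < h y) \<and>
        (\<forall>x y. x < y \<and> y < n' \<longrightarrow> col (h x) (h y) = c))"
    by (rule exE[OF ramsey_pairs])
  define N where "N = 2 * M + 1"
  show ?thesis
  proof (intro exI[of _ N] allI impI)
    fix X Obs v a b assume "spider X Obs v a b N m"
    then interpret spider X Obs v a b N m .
    obtain \<sigma> g where s: "\<sigma> * \<sigma> = (1::real)" and g: "\<And>x. x < M \<Longrightarrow> g x < N"
      and half: "\<And>x. x < M \<Longrightarrow> 0 < \<sigma> * det3 v (a 0) (a (g x))"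
      and ord: "\<And>x y. x < y \<Longrightarrow> y < M \<Longrightarrow> 0 < \<sigma> * det3 v (a (g x)) (a (g y))"
      using half_plane_enumeration[OF N_def] by metis
    define A where "A x = a (g x)" for x
    define B where "B x = b (g x)" for x
    define L where "L x y = {k\<in>{..<m}. closed_segment (A y) (B y k) \<inter> closed_segment v (A x) \<noteq> {}}" for x y
    define R where "R x y = {k\<in>{..<m}. closed_segment (A x) (B x k) \<inter> closed_segment v (A y) \<noteq> {}}" for x y
    define blk where "blk x y = (SOME K. K \<in> Obs \<and> \<not> misses K (A x) (A y))" for x y
    have blk: "blk x y \<in> Obs \<and> \<not> misses (blk x y) (A x) (A y)" if "x < y" "y < M" for x y
      unfolding blk_def
    proof (rule someI_ex)
      have "g x \<noteq> g y" using ord[OF that] by auto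
      then have "\<not> sees (A x) (A y)" using aa[of "g x" "g y"] g[of x] g[of y] that by (simp add: A_def)
      then show "\<exists>K. K \<in> Obs \<and> \<not> misses K (A x) (A y)" by (auto elim: not_seesE)
    qed
    define col where "col x y = (blk x y, L x y, R x y)" for x y
    let ?S = "Obs \<times> Pow {..<m} \<times> Pow {..<m}"
    have "card ?S \<le> 3 * (2 ^ m * 2 ^ m)"
      using card_obs by (simp add: card_cartesian_product card_Pow)
    moreover have "finite ?S" using finite_obs by simp
    moreover have "col x y \<in> ?S" if "x < y" "y < M" for x y
      using blk[OF that] by (auto simp: col_def L_def R_def)
    ultimately have "finite ?S \<and> card ?S \<le> 3 * (2 ^ m * 2 ^ m) \<and> (\<forall>x y. x < y \<and> y < M \<longrightarrow> col x y \<in> ?S)"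
      by simp
    from M[THEN spec, THEN spec, THEN mp, OF this]
    obtain h c where hc: "(\<forall>x<n'. h x < M) \<and> (\<forall>x y. x < y \<and> y < n' \<longrightarrow> h x < h y) \<and>
        (\<forall>x y. x < y \<and> y < n' \<longrightarrow> col (h x) (h y) = c)" by (elim exE)
    then have h: "\<And>x. x < n' \<Longrightarrow> h x < M" "\<And>x y. x < y \<Longrightarrow> y < n' \<Longrightarrow> h x < h y"
      and c: "\<And>x y. x < y \<Longrightarrow> y < n' \<Longrightarrow> col (h x) (h y) = c"
      by simp_all
    obtain P Ls Rs where c_eq: "c = (P, Ls, Rs)" by (cases c)
    have P: "P \<in> Obs" "blk (h x) (h y) = P" "L (h x) (h y) = Ls" "R (h x) (h y) = Rs"
      if "x < y" "y < n'" for x y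
      using c[OF that] blk[OF h(2)[OF that] h(1)[OF that(2)]] by (auto simp: c_eq col_def)
    have PO: "P \<in> Obs" using P(1)[of 0 1] by (simp add: n'_def)
    have hit: "\<not> misses P (A (h x)) (A (h y))" if "x < y" "y < n'" for x y
      using blk[OF h(2)[OF that] h(1)[OF that(2)]] P(2)[OF that] by simp
    have cov: "k \<in> Ls \<union> Rs" if k: "k < m" for k
    proof (rule ccontr)
      assume *: "k \<notin> Ls \<union> Rs"
      have n9: "9 \<le> n'" by (simp add: n'_def)
      show False
      proof (rule uncrossed_spider_small[of "\<lambda>x. g (h x)" 0 k P \<sigma>])
        fix x :: nat assume "x < 9"
        then show "g (h x) < N" "0 < \<sigma> * det3 v (a 0) (a (g (h x)))"
          using g half h n9 by auto
      next
        fix x y :: nat assume xy: "x < y" "y < 9"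
        then have xy': "x < y" "y < n'" using n9 by auto
        show "0 < \<sigma> * det3 v (a (g (h x))) (a (g (h y)))" using ord h xy' by simp
        show "\<not> misses P (a (g (h x))) (a (g (h y)))" using hit[OF xy'] by (simp add: A_def)
        have "k \<notin> L (h x) (h y)" "k \<notin> R (h x) (h y)" using * P(3,4)[OF xy'] by simp_all
        then show "closed_segment (a (g (h y))) (b (g (h y)) k) \<inter> closed_segment v (a (g (h x))) = {}"
          "closed_segment (a (g (h x))) (b (g (h x)) k) \<inter> closed_segment v (a (g (h y))) = {}"
          using k by (auto simp: L_def R_def A_def B_def)
      qed (use s PO k N_def in auto)
    qed
    have sub: "Ls \<subseteq> {..<m}" "Rs \<subseteq> {..<m}"
      using P(3,4)[of 0 1] by (auto simp: n'_def L_def R_def)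
    have "m \<le> card (Ls \<union> Rs)"
      using card_mono[of "Ls \<union> Rs" "{..<m}"] cov finite_subset[OF sub(1)] finite_subset[OF sub(2)] by auto
    then have "m \<le> card Ls + card Rs" using card_Un_le le_trans by blast
    then consider "m \<le> 2 * card Ls" | "m \<le> 2 * card Rs" by linarith
    then show "\<exists>P\<in>Obs. \<exists>f \<sigma> K. (\<forall>x<n. f x < N) \<and> K \<subseteq> {..<m} \<and> m \<le> 2 * card K \<and>
      fan P \<sigma> n v (\<lambda>x. a (f x)) (\<lambda>x. b (f x)) K"
    proof cases
      case 1
      have "fan P \<sigma> n v (\<lambda>x. a (g (h x))) (\<lambda>x. b (g (h x))) Ls"
        unfolding fan_def
      proof (intro conjI allI ballI impI)
        fix x y assume "x < y \<and> y < n"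
        then have xy: "x < y" "y < n'" by (auto simp: n'_def)
        show "0 < \<sigma> * det3 v (a (g (h x))) (a (g (h y)))" using ord h xy by simp
        show "\<not> misses P (a (g (h x))) (a (g (h y)))" using hit[OF xy] by (simp add: A_def)
        fix k assume "k \<in> Ls"
        then show "closed_segment (a (g (h y))) (b (g (h y)) k) \<inter> closed_segment v (a (g (h x))) \<noteq> {}"
          using P(3)[OF xy] by (auto simp: L_def A_def B_def)
      qed (rule s)
      moreover have "\<forall>x<n. g (h x) < N" using g h by (simp add: n'_def)
      ultimately show ?thesis
        using sub 1 by (intro bexI[OF _ PO] exI[of _ "\<lambda>x. g (h x)"] exI[of _ \<sigma>] exI[of _ Ls] conjI)
    next
      case 2
      \<comment> \<open>Reading the children backwards turns the crossings of \<open>Rs\<close> into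
        those demanded by \<open>fan\<close>.\<close>
      define r where "r x = n - 1 - x" for x
      have "fan P (- \<sigma>) n v (\<lambda>x. a (g (h (r x)))) (\<lambda>x. b (g (h (r x)))) Rs"
        unfolding fan_def
      proof (intro conjI allI ballI impI)
        fix x y assume "x < y \<and> y < n"
        then have xy: "r y < r x" "r x < n'" by (auto simp: n'_def r_def)
        have "0 < \<sigma> * det3 v (a (g (h (r y)))) (a (g (h (r x))))" using ord h xy by simp
        then show "0 < - \<sigma> * det3 v (a (g (h (r x)))) (a (g (h (r y))))"
          by (simp add: det3_swap(1)[of v "a (g (h (r x)))"])
        show "\<not> misses P (a (g (h (r x)))) (a (g (h (r y))))"
          using hit[OF xy] misses_sym by (auto simp: A_def)
        fix k assume "k \<in> Rs"
        then show "closed_segment (a (g (h (r y)))) (b (g (h (r y))) k) \<inter> closed_segment v (a (g (h (r x)))) \<noteq> {}"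
          using P(4)[OF xy] by (auto simp: R_def A_def B_def)
      qed (use s in simp)
      moreover have "\<forall>x<n. g (h (r x)) < N" using g h by (simp add: n'_def r_def)
      ultimately show ?thesis
        using sub 2 by (intro bexI[OF _ PO] exI[of _ "\<lambda>x. g (h (r x))"] exI[of _ "- \<sigma>"] exI[of _ Rs] conjI)
    qed
  qed
qed

subsection \<open>Two nested fans\<close>

lemma between_rays_conv:
  assumes "same_side v a b d" "opp_side a d v b"
  shows "same_side a b v d"
proof -
  have "det3 v a b = det3 a b v" "det3 v a d = det3 a d v" "det3 a d b = - det3 a b d"
    by (simp_all add: det3_def algebra_simps)
  with assms show ?thesis
    by (auto simp: same_side_def opp_side_def zero_less_mult_iff mult_less_0_iff)
qed

context visibility
begin

text \<open>The crossing point is on the side of \<open>b\<close> and on the side of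
  \<open>d\<close> of the line \<open>ca\<close>.\<close>

lemma crossing_same:
  assumes "{a, b, c, d} \<subseteq> X" "distinct [a, b, c, d]"
    and x: "closed_segment a b \<inter> closed_segment c d \<noteq> {}"
  shows "same_side c a b d"
proof -
  obtain x where x: "x \<in> closed_segment a b" "x \<in> closed_segment c d" using x by blast
  have n: "det3 a b c \<noteq> 0" "det3 c d a \<noteq> 0" "det3 c a b \<noteq> 0" "det3 c a d \<noteq> 0"
    using general assms by auto
  have "x \<noteq> c" "x \<noteq> a" using n x det3_on_segment by blast+
  then have "same_side c a b x" "same_side c a d x"
    using same_towards'[OF x(1), of c a] same_towards'[OF x(2), of c a] n by simp_all
  then show ?thesis using same_trans same_sym by blast
qed

lemma hitE:
  assumes "\<not> misses K x y"
  obtains p where "p \<in> K" "p \<in> closed_segment x y"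
  using assms by (auto simp: misses_def)

text \<open>\<open>S\<close> is the obstacle of the inner fan. \<open>S = P\<close> and
  \<open>S = Q\<close> fail at once. For \<open>S = R\<close> the crossings of \<open>b3c\<close>
  leave \<open>P\<close> or \<open>Q\<close> as the obstacle that hides \<open>c\<close> from
  \<open>a2\<close>; together with the side of \<open>a2b3\<close> on which \<open>c\<close> lies
  this makes four cases.\<close>

lemma nested_fans_impossible:
  assumes X: "{v, a1, a2, a3, b1, b2, b3, c, d} \<subseteq> X"
    and dist: "distinct [v, a1, a2, a3, b1, b2, b3, c, d]"
    and edges: "sees v a1" "sees v a2" "sees v a3" "sees a2 b1" "sees a2 b2" "sees a2 b3" "sees a3 d" "sees b3 c"
    and non: "\<not> sees v b3" "\<not> sees v c" "\<not> sees a2 a3" "\<not> sees a1 b1" "\<not> sees a1 b2" "\<not> sees a1 b3"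
      "\<not> sees a3 b1" "\<not> sees a3 b2" "\<not> sees a3 b3" "\<not> sees a2 d" "\<not> sees a1 c" "\<not> sees a2 c" "\<not> sees a3 c"
      "\<not> sees b1 d" "\<not> sees b2 d" "\<not> sees b3 d" "\<not> sees b1 c" "\<not> sees b2 c" "\<not> sees c d"
    and P: "P \<in> Obs" "\<not> misses P a1 a2" "\<not> misses P a2 a3"
    and Q: "Q \<in> Obs" "\<not> misses Q v b1" "\<not> misses Q v b2" "\<not> misses Q v b3" "\<not> misses Q v d"
    and S: "S \<in> Obs" "\<not> misses S b1 b2" "\<not> misses S b1 b3" "\<not> misses S b2 b3"
    and cr: "closed_segment a2 b1 \<inter> closed_segment v a1 \<noteq> {}" "closed_segment a2 b2 \<inter> closed_segment v a1 \<noteq> {}"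
      "closed_segment a2 b3 \<inter> closed_segment v a1 \<noteq> {}" "closed_segment a3 d \<inter> closed_segment v a2 \<noteq> {}"
      "closed_segment b3 c \<inter> closed_segment a2 b1 \<noteq> {}" "closed_segment b3 c \<inter> closed_segment a2 b2 \<noteq> {}"
    and ord: "opp_side v a2 a1 a3" "opp_side a2 b2 b1 b3" "same_side a2 b3 b1 b2"
  shows False
proof -
  have general': "det3 x y z \<noteq> 0" if "{x, y, z} \<subseteq> X" "distinct [x, y, z]" for x y z
    using general that by auto
  have cross: "Obs = {Q, R, P} \<and> distinct [Q, R, P]" "misses Q b a1" "misses R a1 a2"
    if "{a2, b, v, a1} \<subseteq> X" "distinct [a2, b, v, a1]" "sees a2 b" "\<not> misses Q v b"
      "closed_segment a2 b \<inter> closed_segment v a1 \<noteq> {}" "R \<in> Obs" "\<not> misses R b a1" for b R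
    using crossing_obstacles[of a2 b v a1 Q R P] that edges P Q by blast+
  obtain R where R: "R \<in> Obs" "\<not> misses R b1 a1"
    using non(4) not_seesE misses_sym by metis
  have X': "v \<in> X" "a1 \<in> X" "a2 \<in> X" "a3 \<in> X" "b1 \<in> X" "b2 \<in> X" "b3 \<in> X" "c \<in> X" "d \<in> X"
    using X by simp_all
  note c1 = cross[of b1 R]
  have Obs: "Obs = {Q, R, P}" "Q \<noteq> R" "R \<noteq> P" "Q \<noteq> P"
    using c1(1) X' dist edges Q R cr by auto
  have Qb1: "misses Q b1 a1" and Ra: "misses R a1 a2"
    using c1 X' dist edges Q R cr by auto
  \<comment> \<open>Each crossing with \<open>va1\<close> uses up all obstacles, with
    \<open>Q\<close> and \<open>P\<close> already placed, so the third role falls to the same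
    \<open>R\<close> for every foot.\<close>
  have Rb: "\<not> misses R b a1" if b: "b \<in> {b1, b2, b3}" for b
  proof -
    have e: "sees a2 b" "\<not> misses Q v b" "closed_segment a2 b \<inter> closed_segment v a1 \<noteq> {}" "\<not> sees a1 b"
      "{a2, b, v, a1} \<subseteq> X" "distinct [a2, b, v, a1]"
      using b X' dist edges Q cr non by auto
    obtain R' where R': "R' \<in> Obs" "\<not> misses R' b a1" using e(4) not_seesE misses_sym by metis
    have "Obs = {Q, R', P} \<and> distinct [Q, R', P]" using cross(1)[OF e(5,6,1,2,3) R'] .
    then have "R' = R" using Obs by auto
    then show ?thesis using R' by simp
  qed
  have da2: "\<not> misses R d a2" "misses Q d a2"
  proof -
    obtain R' where R': "R' \<in> Obs" "\<not> misses R' d a2" using non(10) not_seesE misses_sym by metis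
    have x: "{a3, d, v, a2} \<subseteq> X" "distinct [a3, d, v, a2]" "sees a3 d" "sees v a2"
      using X' dist edges by auto
    note o = crossing_obstacles[OF x cr(4) Q(1,5) R' P(1,3)]
    have "R' = R" using o(1) Obs by auto
    then show "\<not> misses R d a2" "misses Q d a2" using R' o(2) by simp_all
  qed
  have seg: "misses K v a1" "misses K v a2" "misses K v a3" "misses K a2 b1" "misses K a2 b2" "misses K a2 b3"
    "misses K a3 d" "misses K b3 c" if "K \<in> Obs" for K
    using edges seesD that by blast+
  have convex: "convex P" "convex Q" "convex R" using convex_obs P Q R by auto
  have QR: "Q \<inter> R = {}" using disjoint_obs Q R Obs by auto
  have left1: "same_side v a2 b1 a1" and left2: "same_side v a2 b2 a1" and left3: "same_side v a2 b3 a1"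
    using crossing_same[of a2 b1 v a1] crossing_same[of a2 b2 v a1] crossing_same[of a2 b3 v a1] X' dist cr by auto
  have od: "opp_side a3 d v a2" "opp_side v a2 a3 d"
    using cr(4) crossing_opp[of a3 d v a2] crossing_opp[of v a2 a3 d] X' dist by auto
  have leftd: "same_side v a2 a1 d" using opp_opp_trans[OF ord(1) od(2)] .
  have bd: "same_side v a2 b1 d" "same_side v a2 b2 d" "same_side v a2 b3 d"
    using left1 left2 left3 leftd same_trans by blast+
  have below: "opp_side a2 b1 v a1" "opp_side a2 b2 v a1" "opp_side a2 b3 v a1"
    using cr crossing_opp[of a2 b1 v a1] crossing_opp[of a2 b2 v a1] crossing_opp[of a2 b3 v a1] X' dist by auto
  have up: "opp_side b3 c a2 b1" "same_side a2 b3 c b1" "same_side a2 b3 c b2" "opp_side a2 b1 b3 c" "opp_side a2 b2 b3 c"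
    using cr crossing_opp[of b3 c a2 b1] crossing_opp[of a2 b1 b3 c] crossing_opp[of a2 b2 b3 c]
      crossing_same[of b3 c a2 b1] crossing_same[of b3 c a2 b2] X' dist by auto
  have nc1: "closed_segment v a1 \<inter> closed_segment b3 c = {}"
    by (rule nonadjacent_edges_disjoint) (use X' dist edges non sees_sym in auto)
  have nc2: "closed_segment a2 b \<inter> closed_segment a3 d = {}" if "b \<in> {b1, b2, b3}" for b
    by (rule nonadjacent_edges_disjoint) (use that X' dist edges non sees_sym in auto)
  have nc3: "closed_segment b3 c \<inter> closed_segment a3 d = {}"
    by (rule nonadjacent_edges_disjoint) (use X' dist edges non sees_sym in auto)
  obtain u where u: "u \<in> closed_segment a3 d" "u \<in> closed_segment v a2" using cr(4) by blast
  obtain x1 where x1: "x1 \<in> closed_segment a2 b1" "x1 \<in> closed_segment v a1" using cr(1) by blast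
  obtain x2 where x2: "x2 \<in> closed_segment a2 b2" "x2 \<in> closed_segment v a1" using cr(2) by blast
  obtain x3 where x3: "x3 \<in> closed_segment a2 b3" "x3 \<in> closed_segment v a1" using cr(3) by blast
  obtain y where y: "y \<in> closed_segment b3 c" "y \<in> closed_segment a2 b1" using cr(5) by blast
  obtain p where p: "p \<in> P" "p \<in> closed_segment a1 a2" using P(2) hitE by blast
  obtain q1 where q1: "q1 \<in> Q" "q1 \<in> closed_segment v b1" using Q(2) hitE by blast
  obtain q2 where q2: "q2 \<in> Q" "q2 \<in> closed_segment v b2" using Q(3) hitE by blast
  obtain q3 where q3: "q3 \<in> Q" "q3 \<in> closed_segment v b3" using Q(4) hitE by blast
  obtain q where q: "q \<in> Q" "q \<in> closed_segment v d" using Q(5) hitE by blast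
  obtain r where r: "r \<in> R" "r \<in> closed_segment a2 d" using da2(1) hitE by (metis closed_segment_commute)
  obtain s12 where s12: "s12 \<in> S" "s12 \<in> closed_segment b1 b2" using S(2) hitE by blast
  obtain s13 where s13: "s13 \<in> S" "s13 \<in> closed_segment b1 b3" using S(3) hitE by blast
  obtain s23 where s23: "s23 \<in> S" "s23 \<in> closed_segment b2 b3" using S(4) hitE by blast
  have nd: "det3 a2 b d \<noteq> 0" if "b \<in> {b1, b2, b3}" for b
    using general'[of a2 b d] that X' dist by auto
  consider "S = P" | "S = Q" | "S = R" using S(1) Obs by auto
  then show False
  proof cases
    \<comment> \<open>\<open>P\<close> meets \<open>a1a2\<close> and, seen from \<open>a2\<close>,
      also lies behind \<open>b2\<close>; its chord then cuts \<open>va1\<close>.\<close>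
    case 1
    obtain w where w: "w \<in> P" "b2 \<in> closed_segment a2 w"
      using star_beyond[OF convex(1) seg(4)[OF P(1)] seg(5)[OF P(1)]] s12 s23 ord(2) 1 by metis
    have "p \<in> closed_segment a2 a1" using p by (simp add: closed_segment_commute)
    then have "closed_segment p w \<inter> closed_segment x2 a1 \<noteq> {}"
      using pasch[of p a2 a1 x2 w] segment_mono[OF x2(1) w(2)] by simp
    then show False
      using misses_segment[OF seg(1)[OF P(1)] convex(1) p(1) w(1) x2(2)] by auto
  next
    case 2
    have no: False
      if bb: "b \<in> {b1, b2, b3}" "b' \<in> {b1, b2, b3}" "\<not> misses Q b b'"
        "same_side a2 b v d \<and> same_side a2 b' v d \<or> opp_side a2 b v d \<and> opp_side a2 b' v d" for b b'
    proof -
      obtain s where s: "s \<in> Q" "s \<in> closed_segment b b'" using hitE bb(3) by blast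
      obtain r1 where r1: "r1 \<in> R" "r1 \<in> closed_segment b a1" using hitE Rb[OF bb(1)] by blast
      obtain r2 where r2: "r2 \<in> R" "r2 \<in> closed_segment b' a1" using hitE Rb[OF bb(2)] by blast
      show False
        by (rule star_obstacle_not_upper[OF convex(2) seg(2)[OF Q(1)] seg(7)[OF Q(1)] misses_sym[OF da2(2)]
              convex(3) Ra _ _ QR q s r r1 r2 u(2,1) od(1) nc2[OF bb(1)] nc2[OF bb(2)] _ _ _ _ bb(4)])
          (use bb(1,2) seg[OF R(1)] bd below in auto)
    qed
    have st: "same_side a2 b v d \<or> opp_side a2 b v d" if "b \<in> {b1, b2, b3}" for b
    proof -
      have "det3 a2 b v \<noteq> 0" using that opp_nz[OF below(1)] opp_nz[OF below(2)] opp_nz[OF below(3)] by auto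
      then show ?thesis using same_or_opp nd[OF that] by blast
    qed
    show False
      \<comment> \<open>Two of the three feet agree on whether \<open>d\<close> is on the side of
        \<open>v\<close>; \<open>no\<close> refutes that pair.\<close>
      using no[of b1 b2] no[of b1 b3] no[of b2 b3] st[of b1] st[of b2] st[of b3] S 2 by blast
  next
    case 3
    have x: "{b3, c, a2, b1} \<subseteq> X" "distinct [b3, c, a2, b1]" "{b3, c, a2, b2} \<subseteq> X" "distinct [b3, c, a2, b2]"
      using X' dist by auto
    obtain Q' where Q': "Q' \<in> Obs" "\<not> misses Q' a2 c" using non(12) not_seesE by metis
    obtain R' where R': "R' \<in> Obs" "\<not> misses R' c b1" using non(17) not_seesE misses_sym by metis
    obtain R'' where R'': "R'' \<in> Obs" "\<not> misses R'' c b2" using non(18) not_seesE misses_sym by metis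
    note o1 = crossing_obstacles[OF x(1,2) edges(8,4) cr(5) Q' R' S(1,3)]
    note o2 = crossing_obstacles[OF x(3,4) edges(8,5) cr(6) Q' R'' S(1,4)]
    \<comment> \<open>The crossings of \<open>b3c\<close> with \<open>a2b1\<close> and with
      \<open>a2b2\<close> share \<open>Q'\<close> and \<open>S\<close>, so their remaining obstacle
      is the same.\<close>
    have QRS: "Q' \<noteq> R'" "Q' \<noteq> R" "R' \<noteq> R" "R'' = R'" using o1(1) o2(1) 3 by auto
    then consider "Q' = P" "R' = Q" | "Q' = Q" "R' = P" using Q'(1) R'(1) Obs by auto
    note PQ = this
    obtain k where k: "k \<in> Q'" "k \<in> closed_segment a2 c" using Q'(2) hitE by blast
    obtain t1 where t1: "t1 \<in> R'" "t1 \<in> closed_segment c b1" using R'(2) hitE by blast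
    obtain t2 where t2: "t2 \<in> R'" "t2 \<in> closed_segment c b2" using R''(2) QRS hitE by blast
    have R_miss: "misses R a2 c" "misses R c b1" using o1(6,7) 3 by simp_all
    have Rs: "s12 \<in> R" "s13 \<in> R" "s23 \<in> R" using s12 s13 s23 3 by simp_all
    have ns: "det3 a2 b3 v \<noteq> 0" "det3 a2 b3 c \<noteq> 0" using general'[of a2 b3 v] general'[of a2 b3 c] X' dist by auto
    have ac: "det3 v a2 c \<noteq> 0" using general'[of v a2 c] X' dist by auto
    consider "same_side a2 b3 v c" | "opp_side a2 b3 v c" using same_or_opp ns by blast
    then show False
    proof cases
      case vc: 1
      show False
      proof (cases rule: PQ)
        case 1
        have "misses Q a2 c" using o1(4) 1 misses_sym by blast
        then show False
          using upward_leg_hidden_by_star[OF convex(1) seg(8)[OF P(1)] seg(6)[OF P(1)] _ _ p convex(2)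
              seg(8)[OF Q(1)] seg(6)[OF Q(1)] _ q3 _ _ x3 nc1 below(3) vc same_sym[OF left3] ac up(1), of k t1]
            k t1 1 by blast
      next
        case 2
        \<comment> \<open>These edges are joined by \<open>a2b3\<close>, so blocked sides alone do
          not exclude a crossing; but \<open>Q\<close> would meet the opposite sides
          \<open>b3v\<close> and \<open>ca2\<close>.\<close>
        have "closed_segment b3 c \<inter> closed_segment v a2 = {}"
        proof (rule ccontr)
          assume *: "\<not> ?thesis"
          have "{b3, c, v, a2} \<subseteq> X" "distinct [b3, c, v, a2]" using X' dist by auto
          from crossing_sides(2)[OF this edges(8,2) * Q(1)] Q(4) misses_sym
          have "misses Q c a2" by blast
          then show False using Q'(2) 2 misses_sym by blast
        qed
        moreover have "det3 a2 d c \<noteq> 0" "det3 a2 d b3 \<noteq> 0" "det3 a3 d c \<noteq> 0" "det3 a2 b1 c \<noteq> 0"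
          using general'[of a2 d c] general'[of a2 d b3] general'[of a3 d c] general'[of a2 b1 c] X' dist by auto
        moreover have "closed_segment a2 b3 \<inter> closed_segment a3 d = {}" using nc2 by simp
        moreover have "k \<in> Q" using k 2 by simp
        ultimately show False
          using upward_leg_hidden_by_upper[OF convex(2) seg(2)[OF Q(1)] seg(7)[OF Q(1)] misses_sym[OF da2(2)]
              convex(3) seg(6)[OF R(1)] seg(8)[OF R(1)] R_miss(1) QR q _ k(2) r Rs(2) s13(2) y(2,1) u(2,1) nc3 _ _
              od(1) bd(3,1) vc up(1)] ac by blast
      qed
    next
      case vc: 2
      show False
      proof (cases rule: PQ)
        case 1
        have ob: "opp_side a2 b3 v b1" "opp_side a2 b3 v b2"
          using opp_same_trans[OF vc up(2)] opp_same_trans[OF vc up(3)] .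
        have s1: "same_side a2 b1 v b3" and s2: "same_side a2 b2 v b3"
          using between_rays_conv ob left1 left2 left3 same_trans same_sym by metis+
        have n: "det3 b1 c a1 \<noteq> 0" using general'[of b1 c a1] X' dist by auto
        have oc: "opp_side a2 b1 v c" "opp_side a2 b2 v c"
          using same_opp_trans[OF s1 up(4)] same_opp_trans[OF s2 up(5)] .
        obtain r1 where r1: "r1 \<in> R" "r1 \<in> closed_segment b1 a1" using hitE Rb[of b1] by blast
        obtain r2 where r2: "r2 \<in> R" "r2 \<in> closed_segment b2 a1" using hitE Rb[of b2] by blast
        have t: "t1 \<in> Q" "t2 \<in> Q" using t1 t2 1 by simp_all
        show False
          by (rule downward_leg_hidden_by_upper[OF convex(2) seg(2)[OF Q(1)] seg(4)[OF Q(1)] seg(5)[OF Q(1)]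
                misses_sym[OF Qb1] convex(3) Ra seg(4)[OF R(1)] seg(5)[OF R(1)] R_miss(2) QR q1 q2
                t(1) t1(2) t(2) t2(2) r1 r2 Rs(2) s13(2) Rs(3) s23(2) Rs(1) s12(2)
                oc(1) below(1) s1 oc(2) below(2) s2 n y(2,1) x1 x3 nc1])
      next
        case 2
        have "k \<in> Q" using k 2 by simp
        then show False
          using convex_set_misses_zigzag[OF convex(2) seg(2)[OF Q(1)] seg(6)[OF Q(1)] seg(8)[OF Q(1)] q3 _ k(2) vc] by blast
      qed
    qed
  qed
qed

end

subsection \<open>The tree\<close>

datatype vert = Root | Mid nat | Low nat nat | Leaf nat nat

text \<open>The value at \<open>Root\<close> is a filler; \<open>adjacent\<close> tests for
  \<open>Root\<close> before using it, so no loop arises.\<close>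

fun parent :: "vert \<Rightarrow> vert" where
  "parent Root = Root"
| "parent (Mid i) = Root"
| "parent (Low i k) = Mid i"
| "parent (Leaf i k) = Low i k"

definition adjacent :: "vert \<Rightarrow> vert \<Rightarrow> bool" where
  "adjacent x y \<longleftrightarrow> x \<noteq> Root \<and> parent x = y \<or> y \<noteq> Root \<and> parent y = x"

definition verts_upto :: "nat \<Rightarrow> nat \<Rightarrow> vert set" where
  "verts_upto N M = {Root} \<union> Mid ` {..<N} \<union> case_prod Low ` ({..<N} \<times> {..<M})
     \<union> case_prod Leaf ` ({..<N} \<times> {..<M})"

lemma verts_upto_simps [simp]:
  "Root \<in> verts_upto N M" "Mid i \<in> verts_upto N M \<longleftrightarrow> i < N"
  "Low i k \<in> verts_upto N M \<longleftrightarrow> i < N \<and> k < M" "Leaf i k \<in> verts_upto N M \<longleftrightarrow> i < N \<and> k < M"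
  by (auto simp: verts_upto_def)

lemma sorted_rays:
  assumes "\<sigma> * \<sigma> = (1::real)" "0 < \<sigma> * det3 v p q" "0 < \<sigma> * det3 v q r" "0 < \<sigma> * det3 v p r"
  shows "opp_side v q p r" "same_side v r p q"
proof -
  have s: "\<sigma> = 1 \<or> \<sigma> = -1" using assms(1) by (simp add: square_eq_1_iff)
  have "det3 v q p = - det3 v p q" "det3 v r p = - det3 v p r" "det3 v r q = - det3 v q r"
    by (simp_all add: det3_def algebra_simps)
  with assms s show "opp_side v q p r" "same_side v r p q"
    by (auto simp: opp_side_def same_side_def mult_neg_pos mult_pos_neg mult_neg_neg)
qed

lemma three_elements:
  fixes K :: "nat set"
  assumes "3 \<le> card K"
  obtains k1 k2 k3 where "k1 \<in> K" "k2 \<in> K" "k3 \<in> K" "k1 < k2" "k2 < k3"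
proof -
  have "finite K" using assms by (metis card.infinite not_numeral_le_zero)
  then obtain g where "\<And>x. x < card K \<Longrightarrow> g x \<in> K" "\<And>x y. x < y \<Longrightarrow> y < card K \<Longrightarrow> g x < g y"
    using obtain_sorted_enumeration[of K "\<lambda>x. x"] by (metis inj_on_id2)
  with assms show thesis by (intro that[of "g 0" "g 1" "g 2"]) auto
qed

lemma popular_value:
  assumes "finite A" "card A \<le> 2" "5 \<le> card K" "\<And>k. k \<in> K \<Longrightarrow> \<exists>q\<in>A. R q k"
  obtains q where "q \<in> A" "3 \<le> card {k\<in>K. R q k}"
proof -
  have "K = (\<Union>q\<in>A. {k\<in>K. R q k})" using assms(4) by auto
  then have "card K \<le> (\<Sum>q\<in>A. card {k\<in>K. R q k})" using card_UN_le[OF assms(1)] by metis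
  moreover have "(\<Sum>q\<in>A. card {k\<in>K. R q k}) \<le> card A * 2"
    if "\<And>q. q \<in> A \<Longrightarrow> card {k\<in>K. R q k} \<le> 2"
    using sum_bounded_above[of A "\<lambda>q. card {k\<in>K. R q k}" 2] that by simp
  ultimately have "\<not> (\<forall>q\<in>A. card {k\<in>K. R q k} \<le> 2)" using assms(2,3) by fastforce
  then show thesis using that by (metis Suc_leI eval_nat_numeral(3) linorder_not_le)
qed

text \<open>The spiders at the vertices \<open>Mid i\<close> are made homogeneous first. Only the
  nine children selected in each are passed on as feet to the spider at the root, so every foot that
  survives belongs to both fans.\<close>

lemma deep_tree_not_representable:
  "\<exists>N M. \<forall>X Obs pos. visibility X Obs \<longrightarrow> inj_on pos (verts_upto N M) \<longrightarrow> pos ` verts_upto N M \<subseteq> X \<longrightarrow>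
     (\<forall>x\<in>verts_upto N M. \<forall>y\<in>verts_upto N M. x \<noteq> y \<longrightarrow>
        visibility.sees Obs (pos x) (pos y) = adjacent x y) \<longrightarrow> False"
proof -
  obtain M where M: "\<forall>X Obs v a b. spider X Obs v a b M 1 \<longrightarrow>
    (\<exists>P\<in>Obs. \<exists>f \<sigma> K. (\<forall>x<9. f x < M) \<and> K \<subseteq> {..<1} \<and> 1 \<le> 2 * card K \<and>
      fan P \<sigma> 9 v (\<lambda>x. a (f x)) (\<lambda>x. b (f x)) K)"
    by (rule exE[OF spider_homogeneous])
  obtain N where N: "\<forall>X Obs v a b. spider X Obs v a b N 9 \<longrightarrow>
    (\<exists>P\<in>Obs. \<exists>f \<sigma> K. (\<forall>x<4. f x < N) \<and> K \<subseteq> {..<9} \<and> 9 \<le> 2 * card K \<and>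
      fan P \<sigma> 4 v (\<lambda>x. a (f x)) (\<lambda>x. b (f x)) K)"
    by (rule exE[OF spider_homogeneous])
  show ?thesis
  proof (rule exI[of _ N], rule exI[of _ M], intro allI impI)
    fix X Obs and pos :: "vert \<Rightarrow> real^2"
    let ?V = "verts_upto N M"
    assume "visibility X Obs" and inj: "inj_on pos ?V" and X: "pos ` ?V \<subseteq> X"
      and adj: "\<forall>x\<in>?V. \<forall>y\<in>?V. x \<noteq> y \<longrightarrow> visibility.sees Obs (pos x) (pos y) = adjacent x y"
    interpret visibility X Obs by fact
    have sees: "sees (pos x) (pos y) \<longleftrightarrow> adjacent x y" if "x \<in> ?V" "y \<in> ?V" "x \<noteq> y" for x y
      using adj that by blast
    have inX: "pos x \<in> X" if "x \<in> ?V" for x using X that by blast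
    have "\<exists>S f \<tau>. S \<in> Obs \<and> (\<forall>x<9. f x < M) \<and>
        fan S \<tau> 9 (pos (Mid i)) (\<lambda>x. pos (Low i (f x))) (\<lambda>x _. pos (Leaf i (f x))) {0}"
      if i: "i < N" for i
    proof -
      have "spider X Obs (pos (Mid i)) (\<lambda>k. pos (Low i k)) (\<lambda>k _. pos (Leaf i k)) M 1"
        by unfold_locales (use i in \<open>auto simp: sees adjacent_def inX\<close>)
      from M[rule_format, OF this] obtain S f \<tau> K
        where *: "S \<in> Obs" "\<forall>x<9. f x < M" "K \<subseteq> {..<1::nat}" "1 \<le> 2 * card K"
          and fan: "fan S \<tau> 9 (pos (Mid i)) (\<lambda>x. pos (Low i (f x))) (\<lambda>x _. pos (Leaf i (f x))) K" by blast
      have "K \<noteq> {}" using *(4) by auto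
      then have "K = {0}" using *(3) by auto
      with * fan show ?thesis by blast
    qed
    then obtain S f' \<tau> where inner: "\<And>i. i < N \<Longrightarrow> S i \<in> Obs \<and> (\<forall>x<9. f' i x < M) \<and>
        fan (S i) (\<tau> i) 9 (pos (Mid i)) (\<lambda>x. pos (Low i (f' i x))) (\<lambda>x _. pos (Leaf i (f' i x))) {0}"
      by metis
    have S: "S i \<in> Obs" and f': "x < 9 \<Longrightarrow> f' i x < M"
      and fan': "fan (S i) (\<tau> i) 9 (pos (Mid i)) (\<lambda>x. pos (Low i (f' i x))) (\<lambda>x _. pos (Leaf i (f' i x))) {0}"
      if "i < N" for i x using inner[OF that] by blast+
    note \<tau> = fanD(1)[OF fan'] and ord' = fanD(2)[OF fan'] and blk' = fanD(3)[OF fan']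
      and cr' = fanD(4)[OF fan' singletonI]
    have "spider X Obs (pos Root) (\<lambda>i. pos (Mid i)) (\<lambda>i x. pos (Low i (f' i x))) N 9"
      by unfold_locales (use f' in \<open>auto simp: sees adjacent_def inX\<close>)
    from N[rule_format, OF this] obtain P f \<sigma> K where P: "P \<in> Obs" and f: "\<And>x. x < 4 \<Longrightarrow> f x < N"
      and K: "K \<subseteq> {..<9}" "9 \<le> 2 * card K"
      and fan: "fan P \<sigma> 4 (pos Root) (\<lambda>x. pos (Mid (f x))) (\<lambda>x k. pos (Low (f x) (f' (f x) k))) K"
      by blast
    note \<sigma> = fanD(1)[OF fan] and ord = fanD(2)[OF fan] and blk = fanD(3)[OF fan] and cr = fanD(4)[OF fan]
    have fne: "f x \<noteq> f y" if "x < y" "y < 4" for x y using ord[OF that] by auto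
    have f'ne: "f' i x \<noteq> f' i y" if "i < N" "x < y" "y < 9" for i x y using ord'[OF that] by auto
    have K9: "k < 9" if "k \<in> K" for k using K that by auto
    define B where "B j k = pos (Low (f j) (f' (f j) k))" for j k
    have A2: "finite (Obs - {P})" "card (Obs - {P}) \<le> 2" using finite_obs card_obs P by simp_all
    have "\<exists>q\<in>Obs - {P}. 3 \<le> card {k\<in>K. \<not> misses q (pos Root) (B j k)}" if j: "0 < j" "j < 4" for j
    proof -
      \<comment> \<open>The leg crosses the edge from the root to child 0. \<open>P\<close> already
        blocks one side of that quadrilateral, so the foot is hidden from the root by another
        obstacle.\<close>
      have hidden: "\<exists>q\<in>Obs - {P}. \<not> misses q (pos Root) (B j k)" if k: "k \<in> K" for k
      proof -
        have fj: "f j < N" "f 0 < N" "f 0 \<noteq> f j" "f' (f j) k < M" using f j fne f' K9[OF k] by simp_all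
        have "\<not> sees (pos Root) (B j k)" "\<not> sees (B j k) (pos (Mid (f 0)))"
          using fj by (simp_all add: B_def sees adjacent_def)
        then obtain q q' where q: "q \<in> Obs" "\<not> misses q (pos Root) (B j k)"
          and q': "q' \<in> Obs" "\<not> misses q' (B j k) (pos (Mid (f 0)))" using not_seesE by metis
        have d: "distinct [pos (Mid (f j)), B j k, pos Root, pos (Mid (f 0))]"
          using fj by (simp add: B_def inj_on_eq_iff[OF inj])
        have x: "{pos (Mid (f j)), B j k, pos Root, pos (Mid (f 0))} \<subseteq> X"
          using fj inX by (simp add: B_def)
        have e: "sees (pos (Mid (f j))) (B j k)" "sees (pos Root) (pos (Mid (f 0)))"
          using fj by (simp_all add: B_def sees adjacent_def)
        have meet: "closed_segment (pos (Mid (f j))) (B j k) \<inter> closed_segment (pos Root) (pos (Mid (f 0))) \<noteq> {}"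
          using cr[OF k] j by (simp add: B_def)
        have "\<not> misses P (pos (Mid (f 0))) (pos (Mid (f j)))" using blk j by simp
        from crossing_obstacles(1)[OF x d e meet q q' P this] have "distinct [q, q', P]" by simp
        then show ?thesis using q by auto
      qed
      have "5 \<le> card K" using K by linarith
      then obtain q where "q \<in> Obs - {P}" "3 \<le> card {k\<in>K. \<not> misses q (pos Root) (B j k)}"
        by (rule popular_value[OF A2 _ hidden])
      then show ?thesis by blast
    qed
    then have "\<forall>j\<in>{0<..<4}. \<exists>q. q \<in> Obs - {P} \<and> 3 \<le> card {k\<in>K. \<not> misses q (pos Root) (B j k)}"
      unfolding Bex_def by simp
    then obtain q where q': "\<forall>j\<in>{0<..<4}. q j \<in> Obs - {P} \<and> 3 \<le> card {k\<in>K. \<not> misses (q j) (pos Root) (B j k)}"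
      by (rule bchoice[THEN exE])
    have q: "q j \<in> Obs - {P}" "3 \<le> card {k\<in>K. \<not> misses (q j) (pos Root) (B j k)}"
      if "0 < j" "j < 4" for j using q' that by simp_all
    have "card (q ` {1, 2, 3}) \<le> 2"
      using card_mono[OF A2(1), of "q ` {1, 2, 3}"] A2(2) q(1) by force
    have "\<not> inj_on q {1, 2, 3 :: nat}"
    proof
      assume "inj_on q {1, 2, 3 :: nat}"
      then have "card (q ` {1, 2, 3 :: nat}) = card {1, 2, 3 :: nat}" by (rule card_image)
      with \<open>card (q ` {1, 2, 3}) \<le> 2\<close> show False by simp
    qed
    then obtain i' j' where ij': "i' \<in> {1, 2, 3}" "j' \<in> {1, 2, 3}" "i' \<noteq> j'" "q i' = q j'"
      unfolding inj_on_def by blast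
    obtain i j where ij: "0 < i" "i < j" "j < 4" "q i = q j"
    proof (cases "i' < j'")
      case True
      with ij' show thesis by (intro that[of i' j']) auto
    next
      case False
      with ij' show thesis by (intro that[of j' i']) auto
    qed
    define Q where "Q = q i"
    have "3 \<le> card {k\<in>K. \<not> misses Q (pos Root) (B i k)}" using q(2)[of i] ij(1-3) by (simp add: Q_def)
    then obtain k1 k2 k3 where k': "k1 \<in> {k\<in>K. \<not> misses Q (pos Root) (B i k)}"
      "k2 \<in> {k\<in>K. \<not> misses Q (pos Root) (B i k)}" "k3 \<in> {k\<in>K. \<not> misses Q (pos Root) (B i k)}"
      "k1 < k2" "k2 < k3" by (rule three_elements)
    then have k: "k1 \<in> K" "k2 \<in> K" "k3 \<in> K" "k1 < k2" "k2 < k3"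
      and Qk: "\<not> misses Q (pos Root) (B i k1)" "\<not> misses Q (pos Root) (B i k2)" "\<not> misses Q (pos Root) (B i k3)"
      by simp_all
    have "3 \<le> card {k\<in>K. \<not> misses Q (pos Root) (B j k)}" using q(2)[of j] ij by (simp add: Q_def)
    then obtain l where l: "l \<in> K" "\<not> misses Q (pos Root) (B j l)" by (rule three_elements) blast
    have fs: "f 0 < N" "f i < N" "f j < N" "f 0 \<noteq> f i" "f 0 \<noteq> f j" "f i \<noteq> f j"
      using f fne ij by simp_all
    have k9: "k1 < 9" "k2 < 9" "k3 < 9" "l < 9" using k l K9 by simp_all
    have ks: "f' (f i) k1 < M" "f' (f i) k2 < M" "f' (f i) k3 < M" "f' (f j) l < M"
      "f' (f i) k1 \<noteq> f' (f i) k2" "f' (f i) k1 \<noteq> f' (f i) k3" "f' (f i) k2 \<noteq> f' (f i) k3"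
      using f' f'ne fs k k9 by simp_all
    define c where "c = pos (Leaf (f i) (f' (f i) k3))"
    have sees': "sees (pos x) (pos y)" if "x \<in> ?V" "y \<in> ?V" "x \<noteq> y" "adjacent x y" for x y
      using sees that by blast
    have sees_not: "\<not> sees (pos x) (pos y)" if "x \<in> ?V" "y \<in> ?V" "x \<noteq> y" "\<not> adjacent x y" for x y
      using sees that by blast
    have vne: "f i \<noteq> f 0" "f j \<noteq> f 0" "f j \<noteq> f i" using fs by simp_all
    note simps = B_def c_def adjacent_def fs ks vne ks(5-7)[symmetric]
    show False
    proof (rule nested_fans_impossible[of "pos Root" "pos (Mid (f 0))" "pos (Mid (f i))" "pos (Mid (f j))"
          "B i k1" "B i k2" "B i k3" c "B j l" P Q "S (f i)"])
      show "{pos Root, pos (Mid (f 0)), pos (Mid (f i)), pos (Mid (f j)), B i k1, B i k2, B i k3, c, B j l} \<subseteq> X"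
        by (simp add: inX simps)
      show "distinct [pos Root, pos (Mid (f 0)), pos (Mid (f i)), pos (Mid (f j)), B i k1, B i k2, B i k3, c, B j l]"
        by (simp add: inj_on_eq_iff[OF inj] simps)
      show "sees (pos Root) (pos (Mid (f 0)))" "sees (pos Root) (pos (Mid (f i)))" "sees (pos Root) (pos (Mid (f j)))"
        "sees (pos (Mid (f i))) (B i k1)" "sees (pos (Mid (f i))) (B i k2)" "sees (pos (Mid (f i))) (B i k3)"
        "sees (pos (Mid (f j))) (B j l)" "sees (B i k3) c"
        unfolding B_def c_def by (rule sees'; simp add: simps)+
      show "\<not> sees (pos Root) (B i k3)" "\<not> sees (pos Root) c" "\<not> sees (pos (Mid (f i))) (pos (Mid (f j)))"
        "\<not> sees (pos (Mid (f 0))) (B i k1)" "\<not> sees (pos (Mid (f 0))) (B i k2)" "\<not> sees (pos (Mid (f 0))) (B i k3)"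
        "\<not> sees (pos (Mid (f j))) (B i k1)" "\<not> sees (pos (Mid (f j))) (B i k2)" "\<not> sees (pos (Mid (f j))) (B i k3)"
        "\<not> sees (pos (Mid (f i))) (B j l)" "\<not> sees (pos (Mid (f 0))) c" "\<not> sees (pos (Mid (f i))) c"
        "\<not> sees (pos (Mid (f j))) c" "\<not> sees (B i k1) (B j l)" "\<not> sees (B i k2) (B j l)"
        "\<not> sees (B i k3) (B j l)" "\<not> sees (B i k1) c" "\<not> sees (B i k2) c" "\<not> sees c (B j l)"
        unfolding B_def c_def by (rule sees_not; simp add: simps)+
      show "P \<in> Obs" "S (f i) \<in> Obs" using P S fs by simp_all
      show "Q \<in> Obs" using q(1)[of i] ij by (simp add: Q_def)
      show "\<not> misses P (pos (Mid (f 0))) (pos (Mid (f i)))" "\<not> misses P (pos (Mid (f i))) (pos (Mid (f j)))"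
        using blk ij by simp_all
      show "\<not> misses (S (f i)) (B i k1) (B i k2)" "\<not> misses (S (f i)) (B i k1) (B i k3)"
        "\<not> misses (S (f i)) (B i k2) (B i k3)"
        using blk'[OF fs(2)] k k9 by (simp_all add: B_def)
      show "closed_segment (pos (Mid (f i))) (B i k1) \<inter> closed_segment (pos Root) (pos (Mid (f 0))) \<noteq> {}"
        "closed_segment (pos (Mid (f i))) (B i k2) \<inter> closed_segment (pos Root) (pos (Mid (f 0))) \<noteq> {}"
        "closed_segment (pos (Mid (f i))) (B i k3) \<inter> closed_segment (pos Root) (pos (Mid (f 0))) \<noteq> {}"
        unfolding B_def using cr[OF k(1), of 0 i] cr[OF k(2), of 0 i] cr[OF k(3), of 0 i] ij by simp_all
      show "closed_segment (pos (Mid (f j))) (B j l) \<inter> closed_segment (pos Root) (pos (Mid (f i))) \<noteq> {}"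
        unfolding B_def using cr[OF l(1), of i j] ij by simp
      show "closed_segment (B i k3) c \<inter> closed_segment (pos (Mid (f i))) (B i k1) \<noteq> {}"
        "closed_segment (B i k3) c \<inter> closed_segment (pos (Mid (f i))) (B i k2) \<noteq> {}"
        unfolding B_def c_def using cr'[OF fs(2), of k1 k3] cr'[OF fs(2), of k2 k3] k k9 by simp_all
      show "opp_side (pos Root) (pos (Mid (f i))) (pos (Mid (f 0))) (pos (Mid (f j)))"
        using sorted_rays(1)[OF \<sigma>] ord ij by simp
      show "opp_side (pos (Mid (f i))) (B i k2) (B i k1) (B i k3)" "same_side (pos (Mid (f i))) (B i k3) (B i k1) (B i k2)"
        using sorted_rays[OF \<tau>[OF fs(2)]] ord'[OF fs(2)] k k9 by (simp_all add: B_def)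
    qed (rule Qk l(2))+
  qed
qed

section \<open>Trees given by a parent function with decreasing depth\<close>

lemma cas_consecutive:
  assumes "pre_digraph.cas (with_proj G) u p v" "Suc i < length p"
  shows "fst (p ! Suc i) = snd (p ! i)"
proof -
  have "p \<noteq> []" using assms(2) by auto
  \<comment> \<open>The vertices of the walk, read off from the tails and from the heads of its
    arcs.\<close>
  then have "map fst p @ [snd (last p)] = fst (hd p) # map snd p"
    using pre_digraph.awalk_verts_conv[of "with_proj G" u p]
      pre_digraph.awalk_verts_conv'[OF assms(1)] by simp
  then have "(map fst p @ [snd (last p)]) ! Suc i = (fst (hd p) # map snd p) ! Suc i" by simp
  then show ?thesis using assms(2) by (simp add: nth_append)
qed

lemma cas_endpoints:
  assumes "pre_digraph.cas (with_proj G) u p v" "p \<noteq> []"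
  shows "fst (p ! 0) = u" "snd (p ! (length p - 1)) = v"
proof -
  show "fst (p ! 0) = u" using assms by (cases p) (auto simp: pre_digraph.cas.simps)
  have "snd (last p) = v"
    using assms by (induction p arbitrary: u) (auto simp: pre_digraph.cas.simps)
  then show "snd (p ! (length p - 1)) = v" using assms(2) by (simp add: last_conv_nth)
qed

text \<open>Going up along \<open>par\<close> connects everything to \<open>r\<close>. On a cycle,
  both neighbours of a vertex of maximal depth would be its parent, while a cycle of length at least
  3 has distinct neighbours there.\<close>

lemma undirected_tree_parent:
  fixes V :: "'a set" and depth :: "'a \<Rightarrow> nat"
  assumes V: "finite V" "r \<in> V"
    and par: "\<And>x. x \<in> V \<Longrightarrow> x \<noteq> r \<Longrightarrow> par x \<in> V \<and> depth (par x) < depth x"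
    and A: "A = {(x, y). x \<in> V \<and> y \<in> V \<and> (x \<noteq> r \<and> par x = y \<or> y \<noteq> r \<and> par y = x)}"
  shows "undirected_tree \<lparr>pverts = V, parcs = A\<rparr>"
proof -
  let ?G = "\<lparr>pverts = V, parcs = A\<rparr>"
  have AV: "A \<subseteq> V \<times> V" by (auto simp: A)
  then have fin: "finite A" using V finite_subset by blast
  have ne: "x \<noteq> y" if "(x, y) \<in> A" for x y using that par by (fastforce simp: A)
  have sym: "sym A" by (auto simp: A sym_def)
  interpret pair_graph ?G
    by unfold_locales (use AV fin V ne sym in \<open>auto simp: symmetric_def arcs_ends_def arc_to_ends_def\<close>)
  have root: "x \<rightarrow>\<^sup>*\<^bsub>with_proj ?G\<^esub> r" if "x \<in> V" for x
    using that
  proof (induction "depth x" arbitrary: x rule: less_induct)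
    case less
    show ?case
    proof (cases "x = r")
      case False
      then have "par x \<in> V" "depth (par x) < depth x" using par less by blast+
      then have "par x \<rightarrow>\<^sup>*\<^bsub>with_proj ?G\<^esub> r" using less by blast
      moreover have "(x, par x) \<in> A" using less False \<open>par x \<in> V\<close> by (auto simp: A)
      ultimately show ?thesis by (intro adj_reachable_trans[of x "par x" r]) auto
    qed (use V in simp)
  qed
  have "strongly_connected (with_proj ?G)"
  proof (rule strongly_connectedI)
    show "verts (with_proj ?G) \<noteq> {}" using V by auto
    fix x y assume "x \<in> verts (with_proj ?G)" "y \<in> verts (with_proj ?G)"
    then have "x \<rightarrow>\<^sup>*\<^bsub>with_proj ?G\<^esub> r" "r \<rightarrow>\<^sup>*\<^bsub>with_proj ?G\<^esub> y"
      using root symmetric_reachable[OF sym_arcs] by simp_all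
    then show "x \<rightarrow>\<^sup>*\<^bsub>with_proj ?G\<^esub> y" by (rule reachable_trans)
  qed
  \<comment> \<open>\<open>connected\<close> is strong connectedness of the symmetrised graph, and
    \<open>A\<close> is already symmetric.\<close>
  moreover have "(\<Union>e\<in>A. {e, (snd e, fst e)}) = A"
    using sym unfolding sym_def by force
  then have "with_proj (mk_symmetric (with_proj ?G)) = with_proj ?G"
    by (simp add: mk_symmetric_def)
  ultimately have "Digraph_Component.connected (with_proj ?G)"
    by (simp add: Digraph_Component.connected_def)
  moreover have "\<not> (pre_digraph.cycle (with_proj ?G) p \<and> 3 \<le> length p)" for p
  proof
    assume p: "pre_digraph.cycle (with_proj ?G) p \<and> 3 \<le> length p"
    define n where "n = length p"
    have n: "3 \<le> n" using p by (simp add: n_def)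
    obtain u where u: "set p \<subseteq> A" "pre_digraph.cas (with_proj ?G) u p u"
      "distinct (tl (pre_digraph.awalk_verts (with_proj ?G) u p))" "p \<noteq> []"
      using p by (auto simp: pre_digraph.cycle_def pre_digraph.awalk_def)
    then have "distinct (map snd p)"
      using pre_digraph.awalk_verts_conv'[OF u(2)] by simp
    then have dis: "snd (p ! i) \<noteq> snd (p ! j)" if "i < n" "j < n" "i \<noteq> j" for i j
      using that by (auto simp: distinct_conv_nth n_def)
    define s where "s i = Suc i mod n" for i
    have next_fst: "fst (p ! s i) = snd (p ! i)" if "i < n" for i
    proof (cases "Suc i < n")
      case True
      then show ?thesis using cas_consecutive[OF u(2)] by (simp add: s_def n_def)
    next
      case False
      then have "Suc i = n" using that by simp
      then have "i = n - 1" "s i = 0" by (auto simp: s_def)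
      then show ?thesis using cas_endpoints[OF u(2,4)] by (simp add: n_def)
    qed
    obtain i where i: "i < n" "\<And>j. j < n \<Longrightarrow> depth (snd (p ! j)) \<le> depth (snd (p ! i))"
    proof -
      let ?D = "(\<lambda>i. depth (snd (p ! i))) ` {..<n}"
      have "?D \<noteq> {}" using n by (auto simp: lessThan_empty_iff)
      then have "Max ?D \<in> ?D" by (intro Max_in) simp
      then obtain i where "i < n" "Max ?D = depth (snd (p ! i))" by auto
      moreover have "depth (snd (p ! j)) \<le> Max ?D" if "j < n" for j using that by (intro Max_ge) auto
      ultimately show thesis using that by simp
    qed
    \<comment> \<open>The cyclic predecessor of \<open>i\<close>; adding \<open>n - 1\<close> avoids
      a truncated subtraction at 0.\<close>
    define h where "h = (i + (n - 1)) mod n"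
    have h: "h < n" "s h = i"
    proof -
      show "h < n" using n by (simp add: h_def)
      have "s h = Suc (i + (n - 1)) mod n" by (simp add: s_def h_def mod_Suc_eq)
      also have "\<dots> = i" using i n by simp
      finally show "s h = i" .
    qed
    have si: "s i < n" using n by (simp add: s_def)
    have "s i \<noteq> h"
    proof
      assume "s i = h"
      then have "Suc (Suc i mod n) mod n = i" using h(2) by (simp add: s_def)
      then have "Suc (Suc i) mod n = i" by (simp only: mod_Suc_eq)
      moreover have "Suc (Suc i) mod n = (if Suc (Suc i) < n then Suc (Suc i) else Suc (Suc i) - n)"
        using i(1) n by (simp add: mod_if)
      ultimately show False using n i(1) by (auto split: if_splits)
    qed
    have arc: "(fst (p ! j), snd (p ! j)) \<in> A" if "j < n" for j
      using u(1) that nth_mem[of j p] by (auto simp: n_def)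
    have up: "y = par (snd (p ! i))"
      if "(snd (p ! i), y) \<in> A" "depth y \<le> depth (snd (p ! i))" for y
      using that par[of y] by (auto simp: A)
    have "(snd (p ! i), snd (p ! s i)) \<in> A" using arc[OF si] next_fst[OF i(1)] by simp
    then have "snd (p ! s i) = par (snd (p ! i))" using up i(2)[OF si] by blast
    moreover have "(snd (p ! h), snd (p ! i)) \<in> A" using arc[OF i(1)] unfolding next_fst[OF h(1), unfolded h(2)] .
    then have "(snd (p ! i), snd (p ! h)) \<in> A" using sym by (meson symD)
    then have "snd (p ! h) = par (snd (p ! i))" using up i(2)[OF h(1)] by blast
    ultimately show False using dis[OF si h(1) \<open>s i \<noteq> h\<close>] by simp
  qed
  ultimately show ?thesis
    unfolding undirected_tree_def using pair_graph_axioms by blast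
qed

instance vert :: countable by countable_datatype

fun depth :: "vert \<Rightarrow> nat" where
  "depth Root = 0"
| "depth (Mid i) = 1"
| "depth (Low i k) = 2"
| "depth (Leaf i k) = 3"

text \<open>The vertices are coded by \<open>to_nat\<close> because the theorem asks for a graph on
  natural numbers.\<close>

definition tree_graph :: "nat \<Rightarrow> nat \<Rightarrow> nat pair_pre_digraph" where
  "tree_graph N M = \<lparr>pverts = to_nat ` verts_upto N M,
     parcs = {(to_nat x, to_nat y) | x y. x \<in> verts_upto N M \<and> y \<in> verts_upto N M \<and> adjacent x y}\<rparr>"

lemma parent_verts_upto:
  assumes "x \<in> verts_upto N M" "x \<noteq> Root"
  shows "parent x \<in> verts_upto N M \<and> depth (parent x) < depth x"
  using assms by (cases x) auto

lemma tree_graph_tree: "undirected_tree (tree_graph N M)"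
  unfolding tree_graph_def
proof (rule undirected_tree_parent)
  show "finite (to_nat ` verts_upto N M)" by (simp add: verts_upto_def)
  show "to_nat Root \<in> to_nat ` verts_upto N M" by simp
  show "to_nat (parent (from_nat x)) \<in> to_nat ` verts_upto N M \<and>
      depth (from_nat (to_nat (parent (from_nat x)))) < depth (from_nat x)"
    if "x \<in> to_nat ` verts_upto N M" "x \<noteq> to_nat Root" for x
    using that parent_verts_upto by auto
qed (auto simp: adjacent_def)

lemma visibility_of_representation:
  assumes rep: "convex_obstacle_representation G pos Obs" "disjoint Obs" "card Obs \<le> 3"
  shows "visibility (pos ` pverts G) Obs"
proof
  fix x y z assume "x \<in> pos ` pverts G" "y \<in> pos ` pverts G" "z \<in> pos ` pverts G" "x \<noteq> y" "x \<noteq> z" "y \<noteq> z"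
  then have "{x, y, z} \<subseteq> pos ` pverts G \<union> (\<Union>P\<in>Obs. polygon_vertices P)" "card {x, y, z} = 3"
    by auto
  then have "\<not> collinear {x, y, z}"
    using rep(1) unfolding convex_obstacle_representation_def general_position_def by blast
  then show "det3 x y z \<noteq> 0" using det3_eq_0_imp_collinear by blast
next
  show "convex K" if "K \<in> Obs" for K
    using rep(1) that polytope_imp_convex
    by (auto simp: convex_obstacle_representation_def convex_polygon_def)
  show "K \<inter> L = {}" if "K \<in> Obs" "L \<in> Obs" "K \<noteq> L" for K L
    using rep(2) that by (auto simp: disjoint_def)
qed (use rep in \<open>auto simp: convex_obstacle_representation_def\<close>)

theorem theorem2:
  shows "\<exists>G :: nat pair_pre_digraph.
    undirected_tree G \<and> disjoint_convex_obstacle_number G \<ge> 4"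
proof -
  obtain N M where NM: "\<forall>X Obs pos. visibility X Obs \<longrightarrow> inj_on pos (verts_upto N M) \<longrightarrow>
      pos ` verts_upto N M \<subseteq> X \<longrightarrow>
      (\<forall>x\<in>verts_upto N M. \<forall>y\<in>verts_upto N M. x \<noteq> y \<longrightarrow>
        visibility.sees Obs (pos x) (pos y) = adjacent x y) \<longrightarrow> False"
    using deep_tree_not_representable by blast
  let ?V = "verts_upto N M"
  let ?G = "tree_graph N M"
  have "4 \<le> card Obs" if rep: "convex_obstacle_representation ?G pos Obs" "disjoint Obs" for pos Obs
  proof (rule ccontr)
    assume "\<not> 4 \<le> card Obs"
    then interpret visibility "pos ` pverts ?G" Obs
      using visibility_of_representation[OF rep] by simp
    have V: "pverts ?G = to_nat ` ?V" by (simp add: tree_graph_def)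
    have inj: "inj_on (\<lambda>x. pos (to_nat x)) ?V"
      using rep(1) comp_inj_on[of to_nat ?V pos]
      by (auto simp: convex_obstacle_representation_def V comp_def)
    have "sees (pos (to_nat x)) (pos (to_nat y)) = adjacent x y"
      if "x \<in> ?V" "y \<in> ?V" "x \<noteq> y" for x y
    proof -
      have "(to_nat x, to_nat y) \<in> parcs ?G \<longleftrightarrow>
          (\<forall>P\<in>Obs. closed_segment (pos (to_nat x)) (pos (to_nat y)) \<inter> P = {})"
        using rep(1) that by (simp add: convex_obstacle_representation_def V)
      moreover have "(to_nat x, to_nat y) \<in> parcs ?G \<longleftrightarrow> adjacent x y"
        using that by (auto simp: tree_graph_def)
      ultimately show ?thesis by (simp add: sees_def misses_def Int_commute)
    qed
    then show False
      using NM[rule_format, OF visibility_axioms inj] by (auto simp: V)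
  qed
  \<comment> \<open>A lower bound for every member suffices, also if the set is empty and the
    infimum is infinite.\<close>
  then have "4 \<le> disjoint_convex_obstacle_number ?G"
    unfolding disjoint_convex_obstacle_number_def
    by (intro Inf_greatest) (auto simp: numeral_eq_enat)
  then show ?thesis using tree_graph_tree by blast
qed

end
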